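(* Let $c\in\mathbb{R}\setminus\{0\}$, let $\nu$ be a finite measure on $\mathbb{R}^*$ with positive Lebesgue density $\nu(x)$, and let $P^{OU}_{\nu,c}$ be the law of the periodic Ornstein–Uhlenbeck process with parameter $c$ driven by the Lévy process with Lévy measure $\nu$. Then for any non-negative test function $F$ on $([0,1]\times\mathbb{R}^* )^3\times\Omega$, $$E_{P^{OU}_{\nu,c}}\big[\mathfrak{A}^cF\big]=E_{P^{OU}_{\nu,c}}\bigg[\sum_{\substack{s_1\neq s_2:\ \Delta Z_{s_1}\neq0,\\ \Delta Z_{s_2}\neq0}}\chi_\nu(\Delta Z_{s_1},\Delta Z_{s_2})\int_0^1F\big((t,\Delta Z_{s_1}+\Delta Z_{s_2}),(s_1,\Delta Z_{s_1}),(s_2,\Delta Z_{s_2}),Z\big)\,dt\bigg],$$ where $\chi_\nu(x_1,x_2)=\dfrac{\nu(x_1+x_2)}{\nu(x_1)\nu(x_2)}$.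
   Context: $\Omega=\mathbb{D}([0,1];\mathbb{R})$ is the space of càdlàg paths, $Z$ its canonical process, $\Delta Z_t=Z_t-Z_{t-}$, $\mu_Z=\sum_{t:\Delta Z_t\neq0}\delta_{(t,\Delta Z_t)}$, $\mathbb{R}^*=\mathbb{R}\setminus\{0\}$. $\mathbb{P}_\nu$ is the law of the pure jump (compound Poisson) Lévy process with Lévy measure $\nu$. The periodic Ornstein–Uhlenbeck process is the solution of $dX_t=-cX_t\,dt+dZ_t$, $t\in[0,1]$, with $Z$ of law $\mathbb{P}_\nu$ and boundary condition $X_0=X_1$. Its law $P^{OU}_{\nu,c}$ is the image of $\mathbb{P}_\nu$ under the map $\mathbb{X}^c$ given by $$\mathbb{X}^c_0(Z)=\mathbb{X}^c_1(Z)=\frac{1}{e^c-1}\int_0^1e^{cs}\,dZ_s,\qquad \mathbb{X}^c_t(Z)=e^{-ct}\,\mathbb{X}^c_0(Z)+e^{-ct}\int_0^te^{cs}\,dZ_s.$$ (The map is applied to pure jump paths, for which the integrals are finite sums over jumps.) For $\gamma=(t,\Delta Z_t)$ an atom of $\mu_Z$, $\gamma_1=(s_1,x_1)$, $\gamma_2=(s_2,x_2)$ in $[0,1]\times\mathbb{R}^*$, $$\Theta^c_{\gamma,\gamma_1,\gamma_2}(Z)=Z+\mathbb{X}^c\big(-\Delta Z_t\mathbf{1}_{[t,1]}+x_1\mathbf{1}_{[s_1,1]}+x_2\mathbf{1}_{[s_2,1]}\big),$$ and, for non-negative $F$ on $([0,1]\times\mathbb{R}^* )^3\times\Omega$, $$\mathfrak{A}^cF(Z)=\int_{([0,1]\times\mathbb{R}^*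 )^3}F(\gamma,\gamma_1,\gamma_2,\Theta^c_{\gamma,\gamma_1,\gamma_2}Z)\,dx_1\,\delta_{\Delta Z_t-x_1}(dx_2)\,ds_1\,ds_2\,\mu_Z(d\gamma),$$ with $\gamma=(t,\Delta Z_t)$. Under $P^{OU}_{\nu,c}$, $Z$ denotes the canonical path (i.e. the periodic Ornstein–Uhlenbeck path itself). The sum runs over ordered pairs of distinct jump times. *)

theory Defs
  imports "HOL-Probability.Probability"
begin

section \<open>Cadlag paths on the unit interval\<close>

text \<open>A path is a function on the reals that is \<^const>\<open>undefined\<close> outside \<open>{0..1}\<close>, as required by
  \<^const>\<open>Pi\<^sub>M\<close>. The sigma-algebra is the one generated by the canonical process
  (it is also the Borel sigma-algebra of the Skorokhod topology).\<close>

definition cadlag_paths :: "(real \<Rightarrow> real) set" where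
  "cadlag_paths = {w \<in> extensional {0..1}.
     (\<forall>t\<in>{0..<1}. (w \<longlongrightarrow> w t) (at_right t)) \<and>
     (\<forall>t\<in>{0<..1}. \<exists>l. (w \<longlongrightarrow> l) (at_left t))}"

definition path_space :: "(real \<Rightarrow> real) measure" where
  "path_space = restrict_space (\<Pi>\<^sub>M t\<in>{0..1}. borel) cadlag_paths"

text \<open>The jump of a path at time \<open>0\<close> is \<open>0\<close> by convention.\<close>

definition jump :: "(real \<Rightarrow> real) \<Rightarrow> real \<Rightarrow> real" where
  "jump w t = (if t \<in> {0<..1} then w t - Lim (at_left t) w else 0)"

definition jump_times :: "(real \<Rightarrow> real) \<Rightarrow> real set" where
  "jump_times w = {t \<in> {0..1}. jump w t \<noteq> 0}"

text \<open>The sigma-algebra of \<open>[0,1] \<times> \<real>\<^sup>*\<close>.\<close>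

definition marks :: "(real \<times> real) measure" where
  "marks = restrict_space borel ({0..1} \<times> (- {0}))"

text \<open>\<open>\<mu>\<^sub>Z\<close>, the sum of the Dirac masses at \<open>(t, \<Delta>Z\<^sub>t)\<close> over the jump times \<open>t\<close>.\<close>

definition jump_measure :: "(real \<Rightarrow> real) \<Rightarrow> (real \<times> real) measure" where
  "jump_measure w = distr (count_space (jump_times w)) marks (\<lambda>t. (t, jump w t))"

section \<open>Compound Poisson Levy processes\<close>

text \<open>Independent increments, and stationary increments whose law is given by the Levy--Khintchine
  formula with finite Levy measure \<open>\<nu>\<close>, without drift and without Gaussian part. These conditions
  determine the law on \<^const>\<open>path_space\<close>.\<close>

definition compound_poisson_law :: "real measure \<Rightarrow> (real \<Rightarrow> real) measure \<Rightarrow> bool" where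
  "compound_poisson_law \<nu> P \<longleftrightarrow>
     prob_space P \<and> sets P = sets path_space \<and>
     (AE w in P. w 0 = 0) \<and>
     (\<forall>(n::nat) \<tau>. \<tau> \<in> {..n} \<rightarrow> {0..1} \<and> mono_on {..n} \<tau> \<longrightarrow>
        prob_space.indep_vars P (\<lambda>_. borel) (\<lambda>i w. w (\<tau> (Suc i)) - w (\<tau> i)) {..<n}) \<and>
     (\<forall>s t u. 0 \<le> s \<and> s \<le> t \<and> t \<le> 1 \<longrightarrow>
        char (distr P borel (\<lambda>w. w t - w s)) u
          = exp (complex_of_real (t - s) * (CLINT x|\<nu>. iexp (u * x) - 1)))"

section \<open>The periodic Ornstein--Uhlenbeck process\<close>

definition pure_jump :: "(real \<Rightarrow> real) \<Rightarrow> bool" where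
  "pure_jump w \<longleftrightarrow> finite (jump_times w) \<and>
     (\<forall>t\<in>{0..1}. w t = w 0 + (\<Sum>s\<in>{s \<in> jump_times w. s \<le> t}. jump w s))"

text \<open>\<open>\<integral>\<^sub>0\<^sup>t e\<^sup>c\<^sup>s dZ\<^sub>s\<close> for a pure jump path; the value \<open>0\<close> on other paths is arbitrary, compound
  Poisson paths being almost surely pure jump.\<close>

definition exp_integral :: "real \<Rightarrow> (real \<Rightarrow> real) \<Rightarrow> real \<Rightarrow> real" where
  "exp_integral c w t =
     (if pure_jump w then \<Sum>s\<in>{s \<in> jump_times w. s \<le> t}. exp (c * s) * jump w s else 0)"

definition OU_map :: "real \<Rightarrow> (real \<Rightarrow> real) \<Rightarrow> real \<Rightarrow> real" where
  "OU_map c w = (\<lambda>t\<in>{0..1}.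
     exp (- c * t) * (exp_integral c w 1 / (exp c - 1)) + exp (- c * t) * exp_integral c w t)"

text \<open>The law of the periodic process when the driving process has law \<open>P\<close>.\<close>

definition periodic_OU_law :: "real \<Rightarrow> (real \<Rightarrow> real) measure \<Rightarrow> (real \<Rightarrow> real) measure" where
  "periodic_OU_law c P = distr P path_space (OU_map c)"

section \<open>The perturbation and the associated operator\<close>

text \<open>The first argument \<open>\<gamma>\<close> is meant to be an atom \<open>(t, \<Delta>Z\<^sub>t)\<close> of \<open>\<mu>\<^sub>Z\<close>, so that \<open>snd \<gamma> = \<Delta>Z\<^sub>t\<close>.\<close>

definition OU_shift ::
  "real \<Rightarrow> real \<times> real \<Rightarrow> real \<times> real \<Rightarrow> real \<times> real \<Rightarrow> (real \<Rightarrow> real) \<Rightarrow> real \<Rightarrow> real" where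
  "OU_shift c \<gamma> \<gamma>1 \<gamma>2 Z = (\<lambda>r\<in>{0..1}. Z r +
     OU_map c (\<lambda>s\<in>{0..1}. - snd \<gamma> * indicator {fst \<gamma>..1} s
       + snd \<gamma>1 * indicator {fst \<gamma>1..1} s + snd \<gamma>2 * indicator {fst \<gamma>2..1} s) r)"

definition OU_operator ::
  "real \<Rightarrow> ((real \<times> real) \<times> (real \<times> real) \<times> (real \<times> real) \<times> (real \<Rightarrow> real) \<Rightarrow> ennreal)
    \<Rightarrow> (real \<Rightarrow> real) \<Rightarrow> ennreal" where
  "OU_operator c F Z =
     (\<integral>\<^sup>+\<gamma>. (\<integral>\<^sup>+s2\<in>{0..1}. (\<integral>\<^sup>+s1\<in>{0..1}. (\<integral>\<^sup>+x1\<in>- {0}. (\<integral>\<^sup>+x2\<in>- {0}.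
        F (\<gamma>, (s1, x1), (s2, x2), OU_shift c \<gamma> (s1, x1) (s2, x2) Z)
      \<partial>return borel (snd \<gamma> - x1)) \<partial>lborel) \<partial>lborel) \<partial>lborel) \<partial>jump_measure Z)"

text \<open>\<open>n\<close> is the Lebesgue density of the Levy measure.\<close>

definition chi :: "(real \<Rightarrow> real) \<Rightarrow> real \<Rightarrow> real \<Rightarrow> real" where
  "chi n x1 x2 = n (x1 + x2) / (n x1 * n x2)"

end

theory Submission
  imports Defs
begin

text \<open>The hypotheses determine \<open>P\<close>, so \<open>P\<close> may be replaced by an explicit Poisson mixture of laws of paths
  with finitely many independent jumps. For this mixture the Mecke formula follows by induction on the
  number of jumps. Since the map \<open>\<bbbX>\<^sup>c\<close> is linear on pure jump paths, \<open>\<Theta>\<^sup>c\<close> replaces one jump of the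
  driving path by two jumps with the same total size. By the Mecke formula the left-hand side is an
  integral against \<open>\<nu>(x) dx\<close> over the removed jump, and by its two-point version the right-hand side
  is an integral against \<open>\<nu>(x\<^sub>1) \<nu>(x\<^sub>2) \<chi>(x\<^sub>1, x\<^sub>2) dx\<^sub>1 dx\<^sub>2 = \<nu>(x\<^sub>1 + x\<^sub>2) dx\<^sub>1 dx\<^sub>2\<close>; the substitution
  \<open>x = x\<^sub>1 + x\<^sub>2\<close> identifies the two.\<close>

section \<open>Jumps of cadlag paths\<close>

text \<open>Three obstacles shape the proof. Events and test functions are measurable only with
  respect to the evaluations at fixed times, so jump times and jump sizes must be recovered from
  path values at rational times; the grids of mesh \<open>1 / n\<close> and
  \<open>exp_weight\<close> serve this purpose. The law \<open>P\<close> is known only through its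
  independent increments and their characteristic functions, hence the comparison with the mixture
  goes through finite-dimensional distributions. Finally, integrals over marks meet degenerate
  arguments: time 0, where no jump is visible, size 0, and two sizes with sum 0, for which
  \<open>(t, x1 + x2)\<close> is not a mark. All of these have measure zero, and continuing the test
  function by 0 off the marks lets the integrals run over the full line. The rate \<open>l\<close>
  of the mixture is the total mass of \<nu>; one mark is uniform in time and has density
  \<open>n / l\<close> in size.\<close>

definition step_sum :: "real set \<Rightarrow> (real \<Rightarrow> real) \<Rightarrow> real \<Rightarrow> real \<Rightarrow> real" where
  "step_sum J y a = (\<lambda>t\<in>{0..1}. a + (\<Sum>s\<in>J. y s * indicator {s..} t))"

text \<open>The pair \<open>p\<close> is arbitrary: a time at most 0 gives a constant path and a
  time above 1 the zero path, so measurability in \<open>p\<close> carries no side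
  condition.\<close>

definition step_path :: "real \<times> real \<Rightarrow> real \<Rightarrow> real" where
  "step_path p = (\<lambda>t\<in>{0..1}. snd p * indicator {fst p..1} t)"

definition path_add :: "(real \<Rightarrow> real) \<Rightarrow> (real \<Rightarrow> real) \<Rightarrow> real \<Rightarrow> real" where
  "path_add v w = (\<lambda>t\<in>{0..1}. v t + w t)"

lemma eventually_at_left_unit: "t \<in> {0<..1} \<Longrightarrow> eventually (\<lambda>r. r \<in> {0..1}) (at_left (t::real))"
  using eventually_at_left_real[of 0 t] by (auto elim!: eventually_mono)

lemma eventually_at_right_unit: "t \<in> {0..<1} \<Longrightarrow> eventually (\<lambda>r. r \<in> {0..1}) (at_right (t::real))"
  using eventually_at_right_real[of t 1] by (auto elim!: eventually_mono)

lemma cadlag_extensional: "w \<in> cadlag_paths \<Longrightarrow> w \<in> extensional {0..1}"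
  by (simp add: cadlag_paths_def)

lemma cadlag_right: "w \<in> cadlag_paths \<Longrightarrow> t \<in> {0..<1} \<Longrightarrow> (w \<longlongrightarrow> w t) (at_right t)"
  by (simp add: cadlag_paths_def)

lemma jump_eqI:
  assumes "t \<in> {0<..1}" "(w \<longlongrightarrow> l) (at_left t)"
  shows "jump w t = w t - l"
  using assms tendsto_Lim[of "at_left t" w l] by (simp add: jump_def)

text \<open>\<open>jump\<close> is defined through \<open>Lim\<close>, which is meaningful only if
  the limit exists; for a cadlag path it does and can be named
  \<open>w t - jump w t\<close>.\<close>

lemma cadlag_left:
  assumes "w \<in> cadlag_paths" "t \<in> {0<..1}"
  shows "(w \<longlongrightarrow> w t - jump w t) (at_left t)"
proof -
  obtain l where "(w \<longlongrightarrow> l) (at_left t)"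
    using assms(1) assms(2) unfolding cadlag_paths_def by blast
  with jump_eqI[OF assms(2) this] show ?thesis by simp
qed

lemma jump_times_subset: "jump_times w \<subseteq> {0<..1}"
  by (auto simp: jump_times_def jump_def split: if_splits)

lemma cadlag_pathsI:
  assumes "w \<in> extensional {0..1}"
    and "\<And>t. t \<in> {0..<1} \<Longrightarrow> ((\<lambda>r. w r) \<longlongrightarrow> w t) (at_right t)"
    and "\<And>t. t \<in> {0<..1} \<Longrightarrow> (w \<longlongrightarrow> l t) (at_left t)"
  shows "w \<in> cadlag_paths"
  using assms unfolding cadlag_paths_def by blast

lemma path_add_cadlag:
  assumes v: "v \<in> cadlag_paths" and w: "w \<in> cadlag_paths"
  shows "path_add v w \<in> cadlag_paths"
    and "t \<in> {0..1} \<Longrightarrow> jump (path_add v w) t = jump v t + jump w t"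
proof -
  have l: "(path_add v w \<longlongrightarrow> (v t - jump v t) + (w t - jump w t)) (at_left t)" if "t \<in> {0<..1}" for t
  proof (rule Lim_transform_eventually)
    show "((\<lambda>r. v r + w r) \<longlongrightarrow> (v t - jump v t) + (w t - jump w t)) (at_left t)"
      by (intro tendsto_add cadlag_left v w that)
    show "\<forall>\<^sub>F r in at_left t. v r + w r = path_add v w r"
      using eventually_at_left_unit[OF that] by eventually_elim (simp add: path_add_def)
  qed
  show "path_add v w \<in> cadlag_paths"
  proof (rule cadlag_pathsI)
    fix t :: real assume t: "t \<in> {0..<1}"
    show "(path_add v w \<longlongrightarrow> path_add v w t) (at_right t)"
    proof (rule Lim_transform_eventually)
      show "((\<lambda>r. v r + w r) \<longlongrightarrow> path_add v w t) (at_right t)"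
        using tendsto_add[OF cadlag_right[OF v t] cadlag_right[OF w t]] t by (simp add: path_add_def)
      show "\<forall>\<^sub>F r in at_right t. v r + w r = path_add v w r"
        using eventually_at_right_unit[OF t] by eventually_elim (simp add: path_add_def)
    qed
  qed (use l in \<open>auto simp: path_add_def\<close>)
  show "jump (path_add v w) t = jump v t + jump w t" if t: "t \<in> {0..1}"
  proof (cases "t = 0")
    case True then show ?thesis by (simp add: jump_def)
  next
    case False
    with t have "t \<in> {0<..1}" by auto
    from jump_eqI[OF this l[OF this]] t show ?thesis by (simp add: path_add_def)
  qed
qed

lemma tendsto_indicator_at_right: "((indicator {s..} :: real \<Rightarrow> real) \<longlongrightarrow> indicator {s..} t) (at_right t)"
proof (rule tendsto_eventually)
  show "\<forall>\<^sub>F r in at_right t. indicator {s..} r = (indicator {s..} t :: real)"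
  proof (cases "s \<le> t")
    case True
    then show ?thesis using eventually_at_right_less[of t] by (auto elim!: eventually_mono simp: indicator_def)
  next
    case False
    then show ?thesis using eventually_at_right_real[of t s] by (auto elim!: eventually_mono simp: indicator_def)
  qed
qed

lemma tendsto_indicator_at_left: "((indicator {s..} :: real \<Rightarrow> real) \<longlongrightarrow> indicator {s<..} t) (at_left t)"
proof (rule tendsto_eventually)
  show "\<forall>\<^sub>F r in at_left t. indicator {s..} r = (indicator {s<..} t :: real)"
  proof (cases "s < t")
    case True
    then show ?thesis using eventually_at_left_real[of s t] by (auto elim!: eventually_mono simp: indicator_def)
  next
    case False
    have "\<forall>\<^sub>F r in at_left t. r < t" by (simp add: eventually_at_filter)
    then show ?thesis using False by (auto elim!: eventually_mono simp: indicator_def)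
  qed
qed

text \<open>The continuous weight \<open>h\<close> serves two cases: \<open>h = 1\<close> for pure
  jump paths and \<open>h t = exp (- c * t)\<close> for periodic Ornstein-Uhlenbeck paths. Only the
  indicators are discontinuous, and left limits replace \<open>{s..}\<close> by
  \<open>{s<..}\<close>.\<close>

lemma step_sum_weighted_limits:
  fixes h :: "real \<Rightarrow> real"
  assumes "continuous_on UNIV h" and w: "\<forall>t\<in>{0..1}. w t = h t * step_sum J y a t"
  shows "t \<in> {0..<1} \<Longrightarrow> (w \<longlongrightarrow> w t) (at_right t)"
    and "t \<in> {0<..1} \<Longrightarrow> (w \<longlongrightarrow> h t * (a + (\<Sum>s\<in>J. y s * indicator {s<..} t))) (at_left t)"
proof -
  have h: "(h \<longlongrightarrow> h t) (at t within S)" for t S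
    using assms(1) by (simp add: continuous_on_eq_continuous_at continuous_at_imp_continuous_at_within
      flip: continuous_within)
  show "(w \<longlongrightarrow> w t) (at_right t)" if t: "t \<in> {0..<1}"
  proof (rule Lim_transform_eventually)
    have "((\<lambda>r. h r * (a + (\<Sum>s\<in>J. y s * indicator {s..} r)))
        \<longlongrightarrow> h t * (a + (\<Sum>s\<in>J. y s * indicator {s..} t))) (at_right t)"
      by (intro tendsto_intros h tendsto_indicator_at_right)
    then show "((\<lambda>r. h r * (a + (\<Sum>s\<in>J. y s * indicator {s..} r))) \<longlongrightarrow> w t) (at_right t)"
      using t w by (simp add: step_sum_def)
    show "\<forall>\<^sub>F r in at_right t. h r * (a + (\<Sum>s\<in>J. y s * indicator {s..} r)) = w r"
      using eventually_at_right_unit[OF t] by eventually_elim (simp add: step_sum_def w)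
  qed
  show "(w \<longlongrightarrow> h t * (a + (\<Sum>s\<in>J. y s * indicator {s<..} t))) (at_left t)" if t: "t \<in> {0<..1}"
  proof (rule Lim_transform_eventually)
    show "((\<lambda>r. h r * (a + (\<Sum>s\<in>J. y s * indicator {s..} r)))
        \<longlongrightarrow> h t * (a + (\<Sum>s\<in>J. y s * indicator {s<..} t))) (at_left t)"
      by (intro tendsto_intros h tendsto_indicator_at_left)
    show "\<forall>\<^sub>F r in at_left t. h r * (a + (\<Sum>s\<in>J. y s * indicator {s..} r)) = w r"
      using eventually_at_left_unit[OF t] by eventually_elim (simp add: step_sum_def w)
  qed
qed

text \<open>The jump is the value minus the left limit; the two indicator sums differ only in the
  term \<open>s = t\<close>, and the continuous weight multiplies that difference. Times in
  \<open>J\<close> are positive because a jump at 0 is invisible by convention.\<close>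

lemma weighted_step_sum:
  fixes h :: "real \<Rightarrow> real"
  assumes "continuous_on UNIV h" and w: "\<forall>t\<in>{0..1}. w t = h t * step_sum J y a t"
    and "w \<in> extensional {0..1}" and J: "finite J" "J \<subseteq> {0<..1}"
  shows "w \<in> cadlag_paths" and "jump w t = (if t \<in> J then h t * y t else 0)"
proof -
  note lim = step_sum_weighted_limits[OF assms(1,2)]
  show "w \<in> cadlag_paths" by (rule cadlag_pathsI[OF assms(3) lim])
  show "jump w t = (if t \<in> J then h t * y t else 0)"
  proof (cases "t \<in> {0<..1}")
    case True
    have "(\<Sum>s\<in>J. y s * indicator {s..} t) - (\<Sum>s\<in>J. y s * indicator {s<..} t)
        = (\<Sum>s\<in>J. if s = t then y t else 0)"
      by (auto simp: sum_subtractf[symmetric] indicator_def intro!: sum.cong)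
    also have "\<dots> = (if t \<in> J then y t else 0)" using J(1) by simp
    finally show ?thesis
      using jump_eqI[OF True lim(2)[OF True]] True w
      by (simp add: step_sum_def right_diff_distrib[symmetric] split: if_splits)
  qed (use J(2) in \<open>auto simp: jump_def\<close>)
qed

lemma sum_indicator_atLeast:
  fixes y :: "real \<Rightarrow> real"
  assumes "finite J"
  shows "(\<Sum>s\<in>J. y s * indicator {s..} t) = (\<Sum>s\<in>{s \<in> J. s \<le> t}. y s)"
  using assms by (intro sum.mono_neutral_cong_right) (auto simp: indicator_def)

lemma step_sum:
  assumes "finite J" "J \<subseteq> {0<..1}"
  shows "step_sum J y a \<in> cadlag_paths" and "jump (step_sum J y a) t = (if t \<in> J then y t else 0)"
    and "pure_jump (step_sum J y a)"
proof -
  have e: "step_sum J y a \<in> extensional {0..1}" by (simp add: step_sum_def)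
  show "step_sum J y a \<in> cadlag_paths"
    by (rule weighted_step_sum(1)[OF _ _ e assms, of "\<lambda>_. 1"]) auto
  show j: "jump (step_sum J y a) t = (if t \<in> J then y t else 0)" for t
    by (subst weighted_step_sum(2)[OF _ _ e assms, of "\<lambda>_. 1"]) auto
  \<comment> \<open>Only an inclusion, since \<open>y\<close> may vanish at points of
    \<open>J\<close>.\<close>
  have sub: "jump_times (step_sum J y a) \<subseteq> J" by (auto simp: jump_times_def j split: if_splits)
  have "(\<Sum>s\<in>J. y s * indicator {s..} 0) = 0"
    by (rule sum.neutral) (use assms in \<open>auto simp: indicator_def\<close>)
  then have *: "step_sum J y a 0 = a" by (simp add: step_sum_def)
  show "pure_jump (step_sum J y a)" unfolding pure_jump_def *
  proof (intro conjI ballI)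
    show "finite (jump_times (step_sum J y a))" using sub assms(1) finite_subset by blast
    fix t :: real assume t: "t \<in> {0..1}"
    have "(\<Sum>s\<in>J. y s * indicator {s..} t) = (\<Sum>s\<in>{s \<in> J. s \<le> t}. y s)"
      by (rule sum_indicator_atLeast[OF assms(1)])
    also have "\<dots> = (\<Sum>s\<in>{s \<in> jump_times (step_sum J y a). s \<le> t}. jump (step_sum J y a) s)"
      using assms sub by (intro sum.mono_neutral_cong_right) (auto simp: jump_times_def j)
    finally show "step_sum J y a t = a + (\<Sum>s\<in>{s \<in> jump_times (step_sum J y a). s \<le> t}. jump (step_sum J y a) s)"
      using t by (simp add: step_sum_def)
  qed
qed

section \<open>Sums of pure jump paths\<close>

lemma pure_jump_finite: "pure_jump w \<Longrightarrow> finite (jump_times w)"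
  by (simp add: pure_jump_def)

text \<open>Sums over the jumps of different paths become comparable once they all run over one
  finite set \<open>T\<close>: times of \<open>T\<close> without a jump contribute 0, and the
  cut-off at \<open>t\<close> becomes an indicator.\<close>

lemma pure_jump_sum_superset:
  fixes g :: "real \<Rightarrow> real"
  assumes "finite T" "jump_times w \<subseteq> T" "T \<subseteq> {0..1}"
  shows "(\<Sum>s\<in>{s \<in> jump_times w. s \<le> t}. g s * jump w s) = (\<Sum>s\<in>T. g s * jump w s * indicator {s..} t)"
proof -
  have "(\<Sum>s\<in>T. g s * jump w s * indicator {s..} t) = (\<Sum>s\<in>{s \<in> T. s \<le> t}. g s * jump w s)"
    by (rule sum_indicator_atLeast[OF assms(1)])
  also have "\<dots> = (\<Sum>s\<in>{s \<in> jump_times w. s \<le> t}. g s * jump w s)"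
    using assms by (intro sum.mono_neutral_right) (auto simp: jump_times_def)
  finally show ?thesis by simp
qed

lemma jump_times_path_add:
  assumes "v \<in> cadlag_paths" "w \<in> cadlag_paths"
  shows "jump_times (path_add v w) \<subseteq> jump_times v \<union> jump_times w"
  using path_add_cadlag(2)[OF assms] by (auto simp: jump_times_def)

text \<open>Simultaneous jumps of \<open>v\<close> and \<open>w\<close> may cancel, so the jump
  times of the sum are only contained in the union; all three sums are therefore taken over that
  union.\<close>

lemma pure_jump_path_add:
  assumes "pure_jump v" "pure_jump w" and c: "v \<in> cadlag_paths" "w \<in> cadlag_paths"
  shows "pure_jump (path_add v w)"
proof -
  let ?T = "jump_times v \<union> jump_times w"
  have fin: "finite ?T" using assms(1,2) by (auto simp: pure_jump_def)
  have T: "?T \<subseteq> {0..1}" by (auto simp: jump_times_def)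
  have "path_add v w t = path_add v w 0 + (\<Sum>s\<in>{s \<in> jump_times (path_add v w). s \<le> t}. jump (path_add v w) s)"
    if t: "t \<in> {0..1}" for t
  proof -
    have "(\<Sum>s\<in>{s \<in> jump_times (path_add v w). s \<le> t}. 1 * jump (path_add v w) s)
      = (\<Sum>s\<in>?T. 1 * jump (path_add v w) s * indicator {s..} t)"
      by (rule pure_jump_sum_superset[OF fin jump_times_path_add[OF c] T])
    also have "\<dots> = (\<Sum>s\<in>?T. 1 * jump v s * indicator {s..} t + 1 * jump w s * indicator {s..} t)"
      using T by (intro sum.cong refl) (auto simp: path_add_cadlag(2)[OF c] distrib_right)
    also have "\<dots> = (\<Sum>s\<in>{s \<in> jump_times v. s \<le> t}. 1 * jump v s) + (\<Sum>s\<in>{s \<in> jump_times w. s \<le> t}. 1 * jump w s)"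
      unfolding sum.distrib
      by (rule arg_cong2[where f="(+)"]; rule pure_jump_sum_superset[symmetric, OF fin _ T]; auto)
    finally have "(\<Sum>s\<in>{s \<in> jump_times (path_add v w). s \<le> t}. jump (path_add v w) s)
      = (\<Sum>s\<in>{s \<in> jump_times v. s \<le> t}. jump v s) + (\<Sum>s\<in>{s \<in> jump_times w. s \<le> t}. jump w s)" by simp
    moreover have "v t = v 0 + (\<Sum>s\<in>{s \<in> jump_times v. s \<le> t}. jump v s)"
      "w t = w 0 + (\<Sum>s\<in>{s \<in> jump_times w. s \<le> t}. jump w s)"
      using assms(1,2) t unfolding pure_jump_def by blast+
    moreover have "path_add v w t = v t + w t" "path_add v w 0 = v 0 + w 0"
      using t by (simp_all add: path_add_def)
    ultimately show ?thesis by linarith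
  qed
  then show ?thesis
    using finite_subset[OF jump_times_path_add[OF c] fin] unfolding pure_jump_def by blast
qed

lemma step_path_eq_step_sum:
  "step_path (s, x) = (if s \<le> 0 then step_sum {} (\<lambda>_. 0) x
     else if s \<le> 1 then step_sum {s} (\<lambda>_. x) 0 else step_sum {} (\<lambda>_. 0) 0)"
  by (auto simp: step_path_def step_sum_def fun_eq_iff indicator_def)

lemma step_path:
  shows step_path_cadlag: "step_path p \<in> cadlag_paths" and pure_jump_step_path: "pure_jump (step_path p)"
    and jump_step_path: "jump (step_path p) t = (if fst p \<in> {0<..1} \<and> t = fst p then snd p else 0)"
proof -
  have empty: "finite ({}::real set)" "({}::real set) \<subseteq> {0<..1}" by auto
  obtain s x where p: "p = (s, x)" by (cases p)
  consider "s \<le> 0" | "0 < s" "s \<le> 1" | "1 < s" by linarith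
  then have "step_path p \<in> cadlag_paths \<and> pure_jump (step_path p) \<and>
     jump (step_path p) t = (if fst p \<in> {0<..1} \<and> t = fst p then snd p else 0)"
  proof cases
    case 2
    then have "finite {s}" "{s} \<subseteq> {0<..1}" by auto
    note step_sum[OF this]
    with 2 show ?thesis by (simp add: p step_path_eq_step_sum)
  qed (simp_all add: p step_path_eq_step_sum step_sum[OF empty])
  then show "step_path p \<in> cadlag_paths" "pure_jump (step_path p)"
    "jump (step_path p) t = (if fst p \<in> {0<..1} \<and> t = fst p then snd p else 0)" by auto
qed

text \<open>The new time must not be a jump time of \<open>w\<close>, as otherwise the two jumps
  would merge or cancel.\<close>

lemma jump_add_step_path:
  assumes "w \<in> cadlag_paths" "t \<in> {0<..1}" "t \<notin> jump_times w" "x \<noteq> 0"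
  shows "jump_times (path_add w (step_path (t, x))) = insert t (jump_times w)"
    and "jump (path_add w (step_path (t, x))) t = x"
    and "s \<in> jump_times w \<Longrightarrow> jump (path_add w (step_path (t, x))) s = jump w s"
  using assms by (auto simp: jump_times_def path_add_cadlag(2)[OF _ step_path_cadlag] jump_step_path split: if_splits)

section \<open>The periodic Ornstein--Uhlenbeck map\<close>

lemma exp_integral_eq:
  assumes "pure_jump w"
  shows "exp_integral c w t = (\<Sum>s\<in>jump_times w. exp (c * s) * jump w s * indicator {s..} t)"
  using pure_jump_sum_superset[of "jump_times w" w "\<lambda>s. exp (c * s)" t, OF pure_jump_finite[OF assms]] assms
    jump_times_subset[of w]
  by (force simp: exp_integral_def)

text \<open>Additivity is confined to pure jump paths: the default value 0 on other paths is not
  additive. The jumps add up at every time of the common finite set.\<close>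

lemma exp_integral_path_add:
  assumes "pure_jump v" "pure_jump w" and c: "v \<in> cadlag_paths" "w \<in> cadlag_paths"
  shows "exp_integral a (path_add v w) t = exp_integral a v t + exp_integral a w t"
proof -
  let ?T = "jump_times v \<union> jump_times w"
  have fin: "finite ?T" using assms(1,2) by (auto simp: pure_jump_def)
  have T: "?T \<subseteq> {0..1}" by (auto simp: jump_times_def)
  have "exp_integral a (path_add v w) t = (\<Sum>s\<in>?T. exp (a * s) * jump (path_add v w) s * indicator {s..} t)"
    using pure_jump_path_add[OF assms] pure_jump_sum_superset[OF fin jump_times_path_add[OF c] T]
    by (simp add: exp_integral_def)
  also have "\<dots> = (\<Sum>s\<in>?T. exp (a * s) * jump v s * indicator {s..} t + exp (a * s) * jump w s * indicator {s..} t)"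
    using T by (intro sum.cong refl) (auto simp: path_add_cadlag(2)[OF c] distrib_right distrib_left)
  also have "\<dots> = exp_integral a v t + exp_integral a w t"
    unfolding sum.distrib exp_integral_def using assms(1,2)
    by (simp add: pure_jump_sum_superset[OF fin _ T])
  finally show ?thesis .
qed

lemma OU_map_path_add:
  assumes "pure_jump v" "pure_jump w" "v \<in> cadlag_paths" "w \<in> cadlag_paths"
  shows "OU_map c (path_add v w) = path_add (OU_map c v) (OU_map c w)"
  unfolding OU_map_def exp_integral_path_add[OF assms] path_add_def[of "restrict _ _"]
  by (rule restrict_ext) (simp add: add_divide_distrib distrib_left)

text \<open>Variation of constants: up to the factor \<open>exp (- c * t)\<close> the periodic path
  is a step function started at its boundary value, with jumps
  \<open>exp (c * s) * jump w s\<close>.\<close>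

lemma OU_map_weighted:
  assumes "pure_jump w"
  shows "\<forall>t\<in>{0..1}. OU_map c w t = exp (- c * t) *
    step_sum (jump_times w) (\<lambda>s. exp (c * s) * jump w s) (exp_integral c w 1 / (exp c - 1)) t"
  by (simp add: OU_map_def exp_integral_eq[OF assms, of c t for t] step_sum_def distrib_left)

lemma OU_map_cadlag: "OU_map c w \<in> cadlag_paths"
proof (cases "pure_jump w")
  case True
  have "OU_map c w \<in> extensional {0..1}" by (simp add: OU_map_def)
  note weighted_step_sum(1)[OF _ OU_map_weighted[OF True] this]
  then show ?thesis
    by this (intro continuous_intros pure_jump_finite[OF True] jump_times_subset)+
next
  case False
  then have "OU_map c w = step_sum {} (\<lambda>_. 0) 0"
    by (auto simp: OU_map_def exp_integral_def step_sum_def)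
  then show ?thesis using step_sum(1)[of "{}"] by simp
qed

text \<open>The weight inside the sum and the factor in front cancel at the jump time, so solving
  the equation changes neither times nor sizes of jumps. Sums over jumps of the periodic path are
  thus sums over jumps of the driving path.\<close>

lemma jump_OU_map:
  assumes "pure_jump w"
  shows "jump (OU_map c w) t = jump w t" and "jump_times (OU_map c w) = jump_times w"
proof -
  show j: "jump (OU_map c w) t = jump w t" for t
  proof -
    have "OU_map c w \<in> extensional {0..1}" by (simp add: OU_map_def)
    note weighted_step_sum(2)[OF _ OU_map_weighted[OF assms] this]
    then have "jump (OU_map c w) t = (if t \<in> jump_times w then exp (- c * t) * (exp (c * t) * jump w t) else 0)"
      by this (intro continuous_intros pure_jump_finite[OF assms] jump_times_subset)+
    also have "\<dots> = jump w t"
      by (auto simp: jump_times_def jump_def mult.assoc[symmetric] exp_add[symmetric])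
    finally show ?thesis .
  qed
  then show "jump_times (OU_map c w) = jump_times w" by (simp add: jump_times_def)
qed

lemma OU_shift_eq:
  "OU_shift c \<gamma> \<gamma>1 \<gamma>2 Z = path_add Z (OU_map c (path_add (path_add (step_path (fst \<gamma>, - snd \<gamma>))
     (step_path \<gamma>1)) (step_path \<gamma>2)))"
proof -
  have "(\<lambda>s\<in>{0..1}. - snd \<gamma> * indicator {fst \<gamma>..1} s + snd \<gamma>1 * indicator {fst \<gamma>1..1} s
        + snd \<gamma>2 * indicator {fst \<gamma>2..1} s)
      = path_add (path_add (step_path (fst \<gamma>, - snd \<gamma>)) (step_path \<gamma>1)) (step_path \<gamma>2)"
    by (auto simp: path_add_def step_path_def)
  then show ?thesis unfolding OU_shift_def by (simp add: path_add_def)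
qed

section \<open>Measurability of the jumps of pure jump paths\<close>

text \<open>Rational time points make the condition measurable; for a cadlag path it says that at most one
  jump occurs in \<open>{a<..b}\<close>.\<close>

definition one_jump :: "real \<Rightarrow> real \<Rightarrow> (real \<Rightarrow> real) \<Rightarrow> bool" where
  "one_jump a b w \<longleftrightarrow> (\<forall>r\<in>\<rat> \<inter> {a..b}. \<forall>s\<in>\<rat> \<inter> {r..b}. \<forall>u\<in>\<rat> \<inter> {s..b}. w r = w s \<or> w s = w u)"

text \<open>If \<open>w\<close> has a single jump in \<open>{a<..b}\<close> and
  \<open>w a \<noteq> w b\<close>, this is the jump time, the first time with the final value. The
  infimum runs over countably many points to stay measurable in \<open>w\<close>; a point where the
  final value is not yet reached contributes \<open>b\<close>, which cannot lower the
  infimum.\<close>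

definition jump_location :: "real \<Rightarrow> real \<Rightarrow> (real \<Rightarrow> real) \<Rightarrow> real" where
  "jump_location a b w = (INF r\<in>\<rat> \<inter> {a..b}. if w r = w b then r else b)"

definition grid_adapted :: "nat \<Rightarrow> (real \<Rightarrow> real) \<Rightarrow> bool" where
  "grid_adapted n w \<longleftrightarrow> (\<forall>i\<in>{..<n}. one_jump (real i / n) (real (Suc i) / n) w)"

section \<open>Intervals with at most one jump\<close>

lemma cadlag_rational_approx:
  assumes w: "w \<in> cadlag_paths" and r: "a \<le> r" "r < b" "0 \<le> a" "b \<le> 1" and e: "e > 0"
  shows "\<exists>q\<in>\<rat>. r < q \<and> q < b \<and> \<bar>w q - w r\<bar> < e"
proof -
  have "r \<in> {0..<1}" using r by auto
  from tendstoD[OF cadlag_right[OF w this] e]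
  have "\<forall>\<^sub>F q in at_right r. dist (w q) (w r) < e" .
  then obtain b' where b': "b' > r" "\<And>q. q > r \<Longrightarrow> q < b' \<Longrightarrow> dist (w q) (w r) < e"
    by (auto simp: eventually_at_right[OF r(2)])
  have "r < min b b'" using b' r by auto
  from Rats_dense_in_real[OF this] obtain q where "q \<in> \<rat>" "r < q" "q < min b b'" by auto
  with b' show ?thesis by (intro bexI[of _ q]) (auto simp: dist_real_def)
qed

text \<open>If three real times violated the alternative, rational times at or slightly to the right
  of them would violate it too, by right continuity. At \<open>u = b\<close> no room is left inside
  the interval, so \<open>b\<close> itself must be rational.\<close>

lemma one_jump_real:
  assumes w: "w \<in> cadlag_paths" and o: "one_jump a b w" and ab: "0 \<le> a" "b \<le> 1" "b \<in> \<rat>"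
    and rsu: "a \<le> r" "r < s" "s < u" "u \<le> b"
  shows "w r = w s \<or> w s = w u"
proof (rule ccontr)
  assume "\<not> ?thesis"
  then have ne: "\<bar>w r - w s\<bar> > 0" "\<bar>w s - w u\<bar> > 0" by auto
  \<comment> \<open>Half the smaller gap: two different values, each moved by less than
    \<open>e\<close>, cannot become equal.\<close>
  define e where "e = min \<bar>w r - w s\<bar> \<bar>w s - w u\<bar> / 2"
  have e: "e > 0" "2 * e \<le> \<bar>w r - w s\<bar>" "2 * e \<le> \<bar>w s - w u\<bar>" using ne by (auto simp: e_def)
  obtain r' where r': "r' \<in> \<rat>" "r < r'" "r' < s" "\<bar>w r' - w r\<bar> < e"
    using cadlag_rational_approx[OF w rsu(1,2) ab(1) _ e(1)] rsu ab by force
  obtain s' where s': "s' \<in> \<rat>" "s < s'" "s' < u" "\<bar>w s' - w s\<bar> < e"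
    using cadlag_rational_approx[OF w _ rsu(3) ab(1) _ e(1)] rsu ab by force
  obtain u' where u': "u' \<in> \<rat>" "u \<le> u'" "u' \<le> b" "\<bar>w u' - w u\<bar> < e"
  proof (cases "u = b")
    case True then show ?thesis using that[of u] ab e by auto
  next
    case False
    then have "u < b" using rsu by auto
    from cadlag_rational_approx[OF w _ this ab(1,2) e(1)] rsu show ?thesis using that by force
  qed
  have "r' \<in> \<rat> \<inter> {a..b}" "s' \<in> \<rat> \<inter> {r'..b}" "u' \<in> \<rat> \<inter> {s'..b}"
    using r' s' u' rsu by auto
  then have "w r' = w s' \<or> w s' = w u'"
    using o unfolding one_jump_def by blast
  with r'(4) s'(4) u'(4) e(2,3) show False by linarith
qed

text \<open>If \<open>w a = w b\<close>, the path is constant and \<open>\<tau> = b\<close> is as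
  good a choice as any. Otherwise \<tau> is the infimum of the times from which on the path stays at
  \<open>w b\<close>.\<close>

lemma one_jump_const:
  assumes w: "w \<in> cadlag_paths" and o: "one_jump a b w"
    and ab: "0 \<le> a" "a < b" "b \<le> 1" "a \<in> \<rat>" "b \<in> \<rat>"
  obtains \<tau> where "a < \<tau>" "\<tau> \<le> b" "\<And>s. a \<le> s \<Longrightarrow> s < \<tau> \<Longrightarrow> w s = w a" "\<And>s. \<tau> \<le> s \<Longrightarrow> s \<le> b \<Longrightarrow> w s = w b"
proof (cases "w a = w b")
  case True
  have "w s = w b" if "a \<le> s" "s \<le> b" for s
    using one_jump_real[OF w o ab(1,3,5), of a s b] that True by (cases "a = s"; cases "s = b") auto
  then have c: "w s = w a" if "a \<le> s" "s < b" for s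
    unfolding True using that by (meson less_imp_le)
  have "w s = w b" if "b \<le> s" "s \<le> b" for s using antisym[OF that] by simp
  from that[OF ab(2) order_refl c this] show ?thesis .
next
  case False
  define T where "T = {s \<in> {a..b}. \<forall>u\<in>{s..b}. w u = w b}"
  define \<tau> where "\<tau> = Inf T"
  have bT: "b \<in> T" using ab by (auto simp: T_def)
  have bdd: "bdd_below T" by (rule bdd_belowI[of _ a]) (auto simp: T_def)
  have ge: "a \<le> \<tau>" unfolding \<tau>_def by (rule cInf_greatest, use bT in blast, simp add: T_def)
  have le: "\<tau> \<le> b" unfolding \<tau>_def by (rule cInf_lower[OF bT bdd])
  have above: "w s = w b" if "\<tau> < s" "s \<le> b" for s
  proof -
    from that(1) obtain x where "x \<in> T" "x < s"
      unfolding \<tau>_def using cInf_lessD[of T s] bT by auto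
    moreover have "s \<in> {x..b}" using that \<open>x < s\<close> by simp
    ultimately show ?thesis unfolding T_def by blast
  qed
  \<comment> \<open>Right continuity puts the infimum itself into the final piece.\<close>
  have at: "w \<tau> = w b"
  proof (rule ccontr)
    assume *: "w \<tau> \<noteq> w b"
    then have "\<tau> < b" using le by (cases "\<tau> = b") auto
    from cadlag_rational_approx[OF w ge this ab(1,3), of "\<bar>w \<tau> - w b\<bar>"] *
    obtain q where "\<tau> < q" "q < b" "\<bar>w q - w \<tau>\<bar> < \<bar>w \<tau> - w b\<bar>" by auto
    with above[of q] show False by auto
  qed
  \<comment> \<open>Some \<open>u \<ge> s\<close> has a value other than \<open>w b\<close>, so
    comparison with \<open>a\<close> and \<open>b\<close> forces \<open>w u = w a\<close>; a second
    comparison squeezes \<open>s\<close> between \<open>a\<close> and \<open>u\<close>.\<close>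
  have below: "w s = w a" if s: "a \<le> s" "s < \<tau>" for s
  proof -
    have "s \<notin> T" using s cInf_lower[OF _ bdd, of s] unfolding \<tau>_def by auto
    then obtain u where u: "s \<le> u" "u \<le> b" "w u \<noteq> w b" using s le by (auto simp: T_def)
    have "u \<noteq> b" using u by auto
    then have ua: "w u = w a"
      using one_jump_real[OF w o ab(1,3,5), of a u b] u s by (cases "a = u") auto
    show ?thesis
    proof (cases "a = s \<or> s = u")
      case True then show ?thesis using ua by metis
    next
      case False
      have "w a = w s \<or> w s = w u"
        by (rule one_jump_real[OF w o ab(1,3,5)]) (use False u(1,2) s(1) in auto)
      then show ?thesis using ua by metis
    qed
  qed
  have "a \<noteq> \<tau>" using False at by auto
  then have "a < \<tau>" using ge by simp
  moreover have "w s = w b" if "\<tau> \<le> s" "s \<le> b" for s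
    using above[of s] at that by (cases "s = \<tau>") auto
  ultimately show ?thesis using that[OF _ le below] by blast
qed

text \<open>A rational before \<tau> contributes \<open>b\<close>, so \<tau> is a lower bound; if
  \<open>\<tau> < b\<close>, rationals just after \<tau> contribute themselves and come arbitrarily
  close.\<close>

lemma jump_location_eq:
  assumes ab: "a < b" "a \<in> \<rat>" and \<tau>: "a < \<tau>" "\<tau> \<le> b" "\<And>s. a \<le> s \<Longrightarrow> s < \<tau> \<Longrightarrow> w s = w a"
    "\<And>s. \<tau> \<le> s \<Longrightarrow> s \<le> b \<Longrightarrow> w s = w b" and ne: "w a \<noteq> w b"
  shows "jump_location a b w = \<tau>"
proof -
  let ?f = "\<lambda>r. if w r = w b then r else b"
  have lower: "\<tau> \<le> ?f r" if "r \<in> \<rat> \<inter> {a..b}" for r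
    using that \<tau>(2) \<tau>(3)[of r] ne by (cases "r < \<tau>") auto
  have bdd: "bdd_below (?f ` (\<rat> \<inter> {a..b}))" using lower by (rule bdd_belowI2)
  have "\<tau> \<le> jump_location a b w" unfolding jump_location_def
    by (rule cINF_greatest) (use lower ab in auto)
  moreover have "jump_location a b w \<le> \<tau>"
  proof (cases "\<tau> = b")
    case True
    have "jump_location a b w \<le> ?f a" unfolding jump_location_def
      by (rule cINF_lower[OF bdd]) (use ab in auto)
    with ne True show ?thesis by simp
  next
    case False
    show ?thesis
    proof (rule dense_ge_bounded)
      show "\<tau> < b" using False \<tau> by auto
      fix x assume x: "\<tau> < x" "x < b"
      then obtain q where q: "q \<in> \<rat>" "\<tau> < q" "q < x" using Rats_dense_in_real by blast
      have "jump_location a b w \<le> ?f q" unfolding jump_location_def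
        by (rule cINF_lower[OF bdd]) (use q x \<tau>(1) in auto)
      with q x \<tau>(4)[of q] show "jump_location a b w \<le> x" by auto
    qed
  qed
  ultimately show ?thesis by simp
qed

lemma jump_const_pieces:
  assumes ab: "0 \<le> a" "b \<le> 1" and \<tau>: "a < \<tau>" "\<tau> \<le> b" "\<And>s. a \<le> s \<Longrightarrow> s < \<tau> \<Longrightarrow> w s = w a"
    "\<And>s. \<tau> \<le> s \<Longrightarrow> s \<le> b \<Longrightarrow> w s = w b" and t: "a < t" "t \<le> b"
  shows "jump w t = (if t = \<tau> then w b - w a else 0)"
proof -
  have t1: "t \<in> {0<..1}" using t ab by auto
  have lim: "(w \<longlongrightarrow> l) (at_left t)" if "c < t" "\<And>s. c < s \<Longrightarrow> s < t \<Longrightarrow> w s = l" for c l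
    by (rule tendsto_eventually) (use eventually_at_left_real[OF that(1)] that(2) in \<open>auto elim!: eventually_mono\<close>)
  consider "t < \<tau>" | "t = \<tau>" | "\<tau> < t" by linarith
  then show ?thesis
  proof cases
    case 1
    have "(w \<longlongrightarrow> w a) (at_left t)" by (rule lim[OF t(1)], rule \<tau>(3)) (use 1 in auto)
    from jump_eqI[OF t1 this] 1 \<tau>(3)[of t] t show ?thesis by auto
  next
    case 2
    have "(w \<longlongrightarrow> w a) (at_left t)" by (rule lim[OF t(1)], rule \<tau>(3)) (use 2 in auto)
    from jump_eqI[OF t1 this] 2 \<tau>(4)[of t] t show ?thesis by auto
  next
    case 3
    have "(w \<longlongrightarrow> w b) (at_left t)" by (rule lim[OF 3], rule \<tau>(4)) (use t in auto)
    from jump_eqI[OF t1 this] 3 \<tau>(4)[of t] t show ?thesis by auto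
  qed
qed

text \<open>Time and size of the jump in one cell become functionals of the endpoint values and of
  \<open>jump_location\<close>, all of them measurable. The increment formula serves to glue cells
  together.\<close>

lemma one_jump_jump_times:
  assumes w: "w \<in> cadlag_paths" and o: "one_jump a b w"
    and ab: "0 \<le> a" "a < b" "b \<le> 1" "a \<in> \<rat>" "b \<in> \<rat>"
  shows "jump_times w \<inter> {a<..b} = (if w a = w b then {} else {jump_location a b w})"
    and "w a \<noteq> w b \<Longrightarrow> jump w (jump_location a b w) = w b - w a"
    and "t \<in> {a..b} \<Longrightarrow> w t - w a = (\<Sum>s\<in>jump_times w \<inter> {a<..t}. jump w s)"
proof -
  obtain \<tau> where \<tau>: "a < \<tau>" "\<tau> \<le> b" "\<And>s. a \<le> s \<Longrightarrow> s < \<tau> \<Longrightarrow> w s = w a"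
    "\<And>s. \<tau> \<le> s \<Longrightarrow> s \<le> b \<Longrightarrow> w s = w b"
    using one_jump_const[OF w o ab] by blast
  note j = jump_const_pieces[OF ab(1,3) \<tau>]
  have loc: "w a \<noteq> w b \<Longrightarrow> jump_location a b w = \<tau>" by (rule jump_location_eq[OF ab(2,4) \<tau>])
  have jt: "t \<in> jump_times w \<longleftrightarrow> jump w t \<noteq> 0" if "a < t" "t \<le> b" for t
    using that ab by (auto simp: jump_times_def)
  show 1: "jump_times w \<inter> {a<..b} = (if w a = w b then {} else {jump_location a b w})"
    using loc \<tau>(1,2) by (auto simp: jt j split: if_splits)
  show "w a \<noteq> w b \<Longrightarrow> jump w (jump_location a b w) = w b - w a"
    using loc \<tau>(1,2) by (simp add: j)
  assume t: "t \<in> {a..b}"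
  show "w t - w a = (\<Sum>s\<in>jump_times w \<inter> {a<..t}. jump w s)"
  proof (cases "w a \<noteq> w b \<and> \<tau> \<le> t")
    case True
    then have "jump_times w \<inter> {a<..t} = {\<tau>}" using t \<tau>(1) by (auto simp: jt j split: if_splits)
    then show ?thesis using \<tau>(1,2) \<tau>(4)[of t] t True by (simp add: j)
  next
    case False
    then have "jump_times w \<inter> {a<..t} = {}" using t \<tau>(1) by (auto simp: jt j split: if_splits)
    then show ?thesis using \<tau>(3)[of t] \<tau>(4)[of t] t False by (cases "t < \<tau>") auto
  qed
qed

section \<open>Uniform grids that separate the jumps\<close>

lemma grid_cells: "0 < n \<Longrightarrow> {0<..1} = (\<Union>i<n. {real i / n <.. real (Suc i) / n})"
proof (intro equalityI subsetI)
  fix t :: real assume n: "0 < n" and t: "t \<in> {0<..1}"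
  \<comment> \<open>Cells are open on the left, so the cell of \<open>t\<close> has index
    \<open>k - 1\<close>, and 0 lies in no cell, in line with the convention for its jump.\<close>
  define k where "k = nat \<lceil>t * n\<rceil>"
  have k: "real k = of_int \<lceil>t * n\<rceil>" using t n by (simp add: k_def)
  have "t * n \<le> k" "k < t * n + 1" unfolding k by linarith+
  moreover have "t * n > 0" "t * n \<le> n" using t n by auto
  ultimately have "k > 0" "real k < real n + 1" by (cases k; linarith)+
  then obtain i where i: "k = Suc i" "i < n" by (cases k) auto
  then show "t \<in> (\<Union>i<n. {real i / n <.. real (Suc i) / n})"
    using \<open>t * n \<le> k\<close> \<open>k < t * n + 1\<close> n by (intro UN_I[of i]) (auto simp: field_simps)
next
  fix t :: real assume n: "0 < n" and "t \<in> (\<Union>i<n. {real i / n <.. real (Suc i) / n})"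
  then obtain i where i: "i < n" "real i / n < t" "t \<le> real (Suc i) / n" by auto
  have "0 \<le> real i / n" "real (Suc i) / n \<le> 1" using n i(1) by (auto simp: field_simps)
  then have "0 < t" "t \<le> 1" using i by linarith+
  then show "t \<in> {0<..1}" by simp
qed

lemma grid_cells_disjoint: "disjoint_family_on (\<lambda>i. {real i / n <.. real (Suc i) / n}) UNIV" for n :: nat
proof (unfold disjoint_family_on_def, safe)
  fix i j :: nat and x :: real assume ij: "i \<noteq> j" "x \<in> {real i / n <.. real (Suc i) / n}" "x \<in> {real j / n <.. real (Suc j) / n}"
  show "x \<in> {}"
  proof (cases "n = 0")
    case False
    then have "0 < real n" by simp
    then have "real i < x * n" "x * n \<le> real (Suc i)" "real j < x * n" "x * n \<le> real (Suc j)"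
      using ij by (auto simp: field_simps)
    then have "real i < real (Suc j)" "real j < real (Suc i)" by linarith+
    then show ?thesis using ij(1) by simp
  qed (use ij in auto)
qed

context
  fixes n :: nat and w assumes n: "0 < n" and w: "w \<in> cadlag_paths" and g: "grid_adapted n w"
begin

private lemma cell:
  assumes "i < n"
  shows "one_jump (real i / n) (real (Suc i) / n) w" "0 \<le> real i / n" "real i / n < real (Suc i) / n"
    "real (Suc i) / n \<le> 1" "real i / n \<in> \<rat>" "real (Suc i) / n \<in> \<rat>"
proof -
  show "one_jump (real i / n) (real (Suc i) / n) w" using g assms by (auto simp: grid_adapted_def)
  show "real (Suc i) / n \<le> 1" "real i / n < real (Suc i) / n" using assms by (auto simp: field_simps)
qed (auto intro!: Rats_divide simp del: of_nat_Suc)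

lemma grid_adapted_finite: "finite (jump_times w)"
proof -
  have "jump_times w = (\<Union>i<n. jump_times w \<inter> {real i / n <.. real (Suc i) / n})"
    using jump_times_subset[of w] grid_cells[OF n] by auto
  also have "finite \<dots>"
    by (intro finite_UN_I) (auto simp: one_jump_jump_times(1)[OF w cell] simp del: of_nat_Suc)
  finally show ?thesis .
qed

text \<open>The right-hand side involves only path values at grid points and
  \<open>jump_location\<close>, so that the measurability of a sum over jumps can be read off from
  it.\<close>

lemma grid_adapted_jump_sum:
  fixes f :: "real \<Rightarrow> real \<Rightarrow> 'a::comm_monoid_add"
  shows "(\<Sum>s\<in>jump_times w. f s (jump w s)) = (\<Sum>i<n. if w (real i / n) = w (real (Suc i) / n) then 0
      else f (jump_location (real i / n) (real (Suc i) / n) w) (w (real (Suc i) / n) - w (real i / n)))"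
proof -
  let ?C = "\<lambda>i. {real i / n <.. real (Suc i) / n}"
  have "(\<Sum>s\<in>jump_times w. f s (jump w s)) = (\<Sum>s\<in>(\<Union>i<n. jump_times w \<inter> ?C i). f s (jump w s))"
    using jump_times_subset[of w] grid_cells[OF n] by (intro sum.cong) auto
  also have "\<dots> = (\<Sum>i<n. \<Sum>s\<in>jump_times w \<inter> ?C i. f s (jump w s))"
  proof (rule sum.UNION_disjoint)
    show "\<forall>i\<in>{..<n}. \<forall>j\<in>{..<n}. i \<noteq> j \<longrightarrow> jump_times w \<inter> ?C i \<inter> (jump_times w \<inter> ?C j) = {}"
      using grid_cells_disjoint[of n] unfolding disjoint_family_on_def by blast
  qed (use grid_adapted_finite in auto)
  also have "\<dots> = (\<Sum>i<n. if w (real i / n) = w (real (Suc i) / n) then 0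
      else f (jump_location (real i / n) (real (Suc i) / n) w) (w (real (Suc i) / n) - w (real i / n)))"
    by (intro sum.cong refl)
       (auto simp: one_jump_jump_times(1,2)[OF w cell] simp del: of_nat_Suc)
  finally show ?thesis .
qed

text \<open>Induction over the cells: the formula at the left endpoint of a cell is extended by the
  increment inside the cell.\<close>

lemma grid_adapted_pure_jump: "pure_jump w"
proof -
  have *: "\<forall>t\<in>{0..real i / n}. w t = w 0 + (\<Sum>s\<in>{s \<in> jump_times w. s \<le> t}. jump w s)" if "i \<le> n" for i
    using that
  proof (induction i)
    case 0
    have "{s \<in> jump_times w. s \<le> 0} = {}" using jump_times_subset[of w] by auto
    then show ?case by (simp add: cong: conj_cong)
  next
    case (Suc i)
    let ?a = "real i / n" and ?b = "real (Suc i) / n"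
    have i: "i < n" using Suc by simp
    have IH: "\<forall>t\<in>{0..?a}. w t = w 0 + (\<Sum>s\<in>{s \<in> jump_times w. s \<le> t}. jump w s)"
      by (rule Suc.IH) (use i in simp)
    show ?case
    proof
      fix t assume t: "t \<in> {0..?b}"
      show "w t = w 0 + (\<Sum>s\<in>{s \<in> jump_times w. s \<le> t}. jump w s)"
      proof (cases "t \<le> ?a")
        case True
        then show ?thesis using t by (intro IH[rule_format]) simp
      next
        case False
        then have ta: "t \<in> {?a..?b}" using t by auto
        have "{s \<in> jump_times w. s \<le> t} = {s \<in> jump_times w. s \<le> ?a} \<union> (jump_times w \<inter> {?a<..t})"
          using False by auto
        then have "(\<Sum>s\<in>{s \<in> jump_times w. s \<le> t}. jump w s)
          = (\<Sum>s\<in>{s \<in> jump_times w. s \<le> ?a}. jump w s) + (\<Sum>s\<in>jump_times w \<inter> {?a<..t}. jump w s)"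
          using grid_adapted_finite by (simp only:) (intro sum.union_disjoint; auto)
        moreover have "w ?a = w 0 + (\<Sum>s\<in>{s \<in> jump_times w. s \<le> ?a}. jump w s)"
          by (rule IH[rule_format]) simp
        ultimately show ?thesis
          using one_jump_jump_times(3)[OF w cell[OF i] ta] by linarith
      qed
    qed
  qed
  have "real n / n = 1" using n by simp
  with *[OF order_refl] have "\<forall>t\<in>{0..1}. w t = w 0 + (\<Sum>s\<in>{s \<in> jump_times w. s \<le> t}. jump w s)"
    by (simp only:)
  with grid_adapted_finite show ?thesis unfolding pure_jump_def by blast
qed

end

text \<open>The mesh is chosen below the least distance between two jump times. Two changes of value
  within one cell would need two jump times at distance at most \<open>1 / n\<close>.\<close>

lemma pure_jump_grid_adapted:
  assumes "pure_jump w"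
  shows "\<exists>n>0. grid_adapted n w"
proof -
  let ?J = "jump_times w"
  have fin: "finite ?J" by (rule pure_jump_finite[OF assms])
  \<comment> \<open>Removing 0 discards the diagonal; inserting 1 keeps the set nonempty when there
    are fewer than two jumps.\<close>
  define D where "D = insert 1 ((\<lambda>(x, y). \<bar>x - y\<bar>) ` (?J \<times> ?J) - {0})"
  have D: "finite D" "D \<noteq> {}" "\<And>d. d \<in> D \<Longrightarrow> d > 0" using fin by (auto simp: D_def)
  have "Min D > 0" using D by (simp add: Min_gr_iff)
  then obtain m where m: "inverse (real (Suc m)) < Min D" using reals_Archimedean by blast
  define n where "n = Suc m"
  have n: "0 < n" "1 / n < Min D" using m by (auto simp: n_def inverse_eq_divide)
  have "one_jump (real i / n) (real (Suc i) / n) w" if i: "i < n" for i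
    unfolding one_jump_def
  proof (intro ballI, rule ccontr)
    let ?a = "real i / n" and ?b = "real (Suc i) / n"
    fix r s u assume rsu: "r \<in> \<rat> \<inter> {?a..?b}" "s \<in> \<rat> \<inter> {r..?b}" "u \<in> \<rat> \<inter> {s..?b}"
      and ne: "\<not> (w r = w s \<or> w s = w u)"
    have b: "?b \<le> 1" "0 \<le> ?a" "?b - ?a = 1 / n" using i n by (auto simp: field_simps)
    have ex: "\<exists>x\<in>?J. p < x \<and> x \<le> q" if pq: "p \<le> q" "?a \<le> p" "q \<le> ?b" "w p \<noteq> w q" for p q
    proof (rule ccontr)
      assume "\<not> ?thesis"
      then have "{s \<in> ?J. s \<le> p} = {s \<in> ?J. s \<le> q}" using pq by force
      moreover have "p \<in> {0..1}" "q \<in> {0..1}" using pq b unfolding atLeastAtMost_iff by linarith+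
      moreover have "w p = w 0 + (\<Sum>s\<in>{s \<in> ?J. s \<le> p}. jump w s)"
        "w q = w 0 + (\<Sum>s\<in>{s \<in> ?J. s \<le> q}. jump w s)"
        using assms \<open>p \<in> {0..1}\<close> \<open>q \<in> {0..1}\<close> unfolding pure_jump_def by blast+
      ultimately show False using pq by simp
    qed
    obtain x where x: "x \<in> ?J" "r < x" "x \<le> s" using ex[of r s] rsu ne by auto
    obtain y where y: "y \<in> ?J" "s < y" "y \<le> u" using ex[of s u] rsu ne by auto
    have "\<bar>x - y\<bar> \<in> D" using x y by (auto simp: D_def intro!: image_eqI[of _ _ "(x, y)"])
    then have "Min D \<le> \<bar>x - y\<bar>" using D by simp
    with x y rsu b n show False by auto
  qed
  with n show ?thesis by (auto simp: grid_adapted_def)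
qed

text \<open>This writes the set of pure jump paths as a countable union of conditions on rational
  times, hence as an event.\<close>

lemma pure_jump_iff: "w \<in> cadlag_paths \<Longrightarrow> pure_jump w \<longleftrightarrow> (\<exists>n>0. grid_adapted n w)"
  using pure_jump_grid_adapted grid_adapted_pure_jump by blast

section \<open>Measurable functionals of pure jump paths\<close>

definition pure_jump_space :: "(real \<Rightarrow> real) measure" where
  "pure_jump_space = restrict_space path_space {w. pure_jump w}"

lemma space_path_space: "space path_space = cadlag_paths"
  by (auto simp: path_space_def space_restrict_space space_PiM PiE_def cadlag_paths_def)

lemma space_pure_jump_space: "space pure_jump_space = {w \<in> cadlag_paths. pure_jump w}"
  by (auto simp: pure_jump_space_def space_restrict_space space_path_space)

lemma measurable_path_space_eval:
  assumes Y: "Y \<in> M \<rightarrow>\<^sub>M path_space" and t: "t \<in> {0..1}"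
  shows "(\<lambda>x. Y x t) \<in> borel_measurable M"
proof -
  have "(\<lambda>w. w t) \<in> borel_measurable path_space"
    unfolding path_space_def using t by (intro measurable_restrict_space1 measurable_component_singleton)
  from measurable_compose[OF Y this] show ?thesis .
qed

lemma measurable_path_spaceI:
  assumes "\<And>x. x \<in> space M \<Longrightarrow> Y x \<in> cadlag_paths"
    and "\<And>t. t \<in> {0..1} \<Longrightarrow> (\<lambda>x. Y x t) \<in> borel_measurable M"
  shows "Y \<in> M \<rightarrow>\<^sub>M path_space"
  unfolding path_space_def
proof (rule measurable_restrict_space2)
  show "Y \<in> space M \<rightarrow> cadlag_paths" using assms by auto
  show "Y \<in> M \<rightarrow>\<^sub>M (\<Pi>\<^sub>M t\<in>{0..1}. borel)"
    by (rule measurable_PiM_single') (use assms cadlag_extensional in \<open>force simp: PiE_def\<close>)+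
qed

lemma measurable_pure_jump_spaceI:
  assumes "Y \<in> M \<rightarrow>\<^sub>M path_space" "\<And>x. x \<in> space M \<Longrightarrow> pure_jump (Y x)"
  shows "Y \<in> M \<rightarrow>\<^sub>M pure_jump_space"
  unfolding pure_jump_space_def using assms by (intro measurable_restrict_space2) auto

lemma measurable_pure_jump_path[measurable_dest]:
  "Y \<in> M \<rightarrow>\<^sub>M pure_jump_space \<Longrightarrow> Y \<in> M \<rightarrow>\<^sub>M path_space"
  unfolding pure_jump_space_def by (simp add: measurable_restrict_space2_iff)

lemma pred_ball_countable:
  assumes "countable I" "\<And>i. i \<in> I \<Longrightarrow> Measurable.pred M (\<lambda>x. P x i)"
  shows "Measurable.pred M (\<lambda>x. \<forall>i\<in>I. P x i)"
  using sets.sets_Collect_countable_All'[of I M "\<lambda>i x. P x i"] assms by (auto simp: pred_def)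

lemma measurable_one_jump:
  assumes Y: "Y \<in> M \<rightarrow>\<^sub>M path_space" and "0 \<le> a" "b \<le> 1"
  shows "Measurable.pred M (\<lambda>x. one_jump a b (Y x))"
proof -
  have c: "countable (\<rat> \<inter> {p..q::real})" for p q by (intro countable_Int1 countable_rat)
  have [measurable]: "t \<in> {a..b} \<Longrightarrow> (\<lambda>x. Y x t) \<in> borel_measurable M" for t
    by (rule measurable_path_space_eval[OF Y]) (use assms in auto)
  show ?thesis unfolding one_jump_def
  proof (intro pred_ball_countable c)
    fix r s u assume "r \<in> \<rat> \<inter> {a..b}" "s \<in> \<rat> \<inter> {r..b}" "u \<in> \<rat> \<inter> {s..b}"
    then have [measurable]: "(\<lambda>x. Y x r) \<in> borel_measurable M" "(\<lambda>x. Y x s) \<in> borel_measurable M" "(\<lambda>x. Y x u) \<in> borel_measurable M"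
      by auto
    show "Measurable.pred M (\<lambda>x. Y x r = Y x s \<or> Y x s = Y x u)" by measurable
  qed
qed

lemma measurable_grid_adapted:
  assumes "Y \<in> M \<rightarrow>\<^sub>M path_space"
  shows "Measurable.pred M (\<lambda>x. grid_adapted n (Y x))"
  unfolding grid_adapted_def
proof (intro pred_intros_countable_bounded)
  fix i assume "i \<in> {..<n}"
  then show "Measurable.pred M (\<lambda>x. one_jump (real i / n) (real (Suc i) / n) (Y x))"
    by (intro measurable_one_jump assms) (auto simp: field_simps)
qed

lemma measurable_pure_jump:
  assumes Y: "Y \<in> M \<rightarrow>\<^sub>M path_space"
  shows "Measurable.pred M (\<lambda>x. pure_jump (Y x))"
proof -
  have "Measurable.pred M (\<lambda>x. \<exists>n\<in>{0<..}. grid_adapted n (Y x))"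
    by (intro pred_intros_countable_bounded measurable_grid_adapted Y)
  also have "?this \<longleftrightarrow> ?thesis"
    by (rule measurable_cong) (use measurable_space[OF Y] in \<open>auto simp: pure_jump_iff space_path_space\<close>)
  finally show ?thesis .
qed

lemma measurable_jump_location:
  assumes Y: "Y \<in> M \<rightarrow>\<^sub>M path_space" and "0 \<le> a" "a \<le> b" "b \<le> 1"
  shows "(\<lambda>x. jump_location a b (Y x)) \<in> borel_measurable M"
  unfolding jump_location_def
proof (rule borel_measurable_cINF_real)
  show "countable (\<rat> \<inter> {a..b})" by (intro countable_Int1 countable_rat)
  fix r assume "r \<in> \<rat> \<inter> {a..b}"
  then have [measurable]: "(\<lambda>x. Y x r) \<in> borel_measurable M" "(\<lambda>x. Y x b) \<in> borel_measurable M"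
    using assms by (auto intro!: measurable_path_space_eval[OF Y])
  show "(\<lambda>x. if Y x r = Y x b then r else b) \<in> borel_measurable M" by measurable
qed

text \<open>Where the grid of mesh \<open>1 / n\<close> separates the jumps, the sum is an explicit
  finite sum over cells. These events cover the space as \<open>n\<close> varies, and measurability
  is checked on each of them. The argument \<open>x\<close> of \<open>g\<close> allows the summand
  to depend on the whole path and on further variables.\<close>

lemma measurable_jump_sum:
  fixes g :: "'a \<times> real \<times> real \<Rightarrow> 'b::{second_countable_topology, topological_comm_monoid_add}"
  assumes Y: "Y \<in> M \<rightarrow>\<^sub>M pure_jump_space" and g[measurable]: "g \<in> borel_measurable (M \<Otimes>\<^sub>M borel \<Otimes>\<^sub>M borel)"
  shows "(\<lambda>x. \<Sum>s\<in>jump_times (Y x). g (x, s, jump (Y x) s)) \<in> borel_measurable M"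
proof (rule measurable_piecewise_restrict)
  note Y' = measurable_pure_jump_path[OF Y]
  let ?C = "\<lambda>n. {x \<in> space M. grid_adapted n (Y x)}"
  show "countable (?C ` {0<..})" by auto
  show "space M \<subseteq> \<Union> (?C ` {0<..})"
    using measurable_space[OF Y] pure_jump_grid_adapted by (fastforce simp: space_pure_jump_space)
  fix \<Omega> assume "\<Omega> \<in> ?C ` {0<..}"
  then obtain n where n: "n > 0" and \<Omega>: "\<Omega> = ?C n" by auto
  show "\<Omega> \<inter> space M \<in> sets M" using measurable_grid_adapted[OF Y', of n] by (simp add: \<Omega> pred_def Int_absorb2)
  have [measurable]: "(\<lambda>x. Y x (real i / n)) \<in> borel_measurable M" if "i \<le> n" for i
    using that n by (intro measurable_path_space_eval[OF Y']) auto
  have [measurable]: "(\<lambda>x. jump_location (real i / n) (real (Suc i) / n) (Y x)) \<in> borel_measurable M" if "i < n" for i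
    using that n by (intro measurable_jump_location[OF Y']) (auto simp: field_simps)
  let ?g = "\<lambda>i x. if Y x (real i / n) = Y x (real (Suc i) / n) then 0
      else g (x, jump_location (real i / n) (real (Suc i) / n) (Y x), Y x (real (Suc i) / n) - Y x (real i / n))"
  have "(\<lambda>x. \<Sum>i<n. ?g i x) \<in> borel_measurable M"
  proof (rule borel_measurable_sum)
    fix i assume "i \<in> {..<n}"
    then have "i \<le> n" "Suc i \<le> n" "i < n" by auto
    then show "?g i \<in> borel_measurable M" by measurable
  qed
  then have "(\<lambda>x. \<Sum>i<n. ?g i x) \<in> borel_measurable (restrict_space M \<Omega>)" by (rule measurable_restrict_space1)
  also have "?this \<longleftrightarrow> (\<lambda>x. \<Sum>s\<in>jump_times (Y x). g (x, s, jump (Y x) s)) \<in> borel_measurable (restrict_space M \<Omega>)"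
    by (rule measurable_cong)
       (use measurable_space[OF Y'] n in \<open>auto simp: \<Omega> space_restrict_space space_path_space grid_adapted_jump_sum[where f="\<lambda>s y. g (_, s, y)"]\<close>)
  finally show "(\<lambda>x. \<Sum>s\<in>jump_times (Y x). g (x, s, jump (Y x) s)) \<in> borel_measurable (restrict_space M \<Omega>)" .
qed

section \<open>Poisson superposition of jumps\<close>

definition add_jump :: "(real \<Rightarrow> real) \<Rightarrow> real \<times> real \<Rightarrow> real \<Rightarrow> real" where
  "add_jump w p = path_add w (step_path p)"

lemma add_jump_commute: "add_jump (add_jump w p) q = add_jump (add_jump w q) p"
  by (rule ext) (simp add: add_jump_def path_add_def)

lemma add_jump_apply: "t \<in> {0..1} \<Longrightarrow> add_jump w p t = w t + snd p * indicator {..t} (fst p)"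
  by (auto simp: add_jump_def path_add_def step_path_def indicator_def)

lemma add_jump_space:
  "w \<in> space pure_jump_space \<Longrightarrow> add_jump w p \<in> space pure_jump_space"
  by (auto simp: add_jump_def space_pure_jump_space pure_jump_path_add path_add_cadlag(1) step_path_cadlag
      pure_jump_step_path)

lemma measurable_add_jump[measurable (raw)]:
  assumes Y: "Y \<in> M \<rightarrow>\<^sub>M pure_jump_space" and p[measurable]: "p \<in> M \<rightarrow>\<^sub>M borel \<Otimes>\<^sub>M borel"
  shows "(\<lambda>x. add_jump (Y x) (p x)) \<in> M \<rightarrow>\<^sub>M pure_jump_space"
proof (rule measurable_pure_jump_spaceI)
  have sp: "add_jump (Y x) (p x) \<in> space pure_jump_space" if "x \<in> space M" for x
    using add_jump_space measurable_space[OF Y that] by auto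
  show "pure_jump (add_jump (Y x) (p x))" if "x \<in> space M" for x
    using sp[OF that] by (simp add: space_pure_jump_space)
  show "(\<lambda>x. add_jump (Y x) (p x)) \<in> M \<rightarrow>\<^sub>M path_space"
  proof (rule measurable_path_spaceI)
    show "add_jump (Y x) (p x) \<in> cadlag_paths" if "x \<in> space M" for x
      using sp[OF that] by (simp add: space_pure_jump_space)
    fix t :: real assume t: "t \<in> {0..1}"
    have [measurable]: "(\<lambda>x. Y x t) \<in> borel_measurable M"
      by (rule measurable_path_space_eval[OF measurable_pure_jump_path[OF Y] t])
    show "(\<lambda>x. add_jump (Y x) (p x) t) \<in> borel_measurable M"
      unfolding add_jump_apply[OF t] by measurable
  qed
qed

definition zero_path :: "real \<Rightarrow> real" where
  "zero_path = (\<lambda>t\<in>{0..1}. 0)"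

lemma zero_path: "zero_path \<in> space pure_jump_space" "jump_times zero_path = {}"
proof -
  have *: "zero_path = step_sum {} (\<lambda>_. 0) 0" by (simp add: zero_path_def step_sum_def)
  have "finite ({}::real set)" "{} \<subseteq> {0<..1::real}" by auto
  note s = step_sum[OF this, of "\<lambda>_. 0" 0, folded *]
  show "zero_path \<in> space pure_jump_space" using s by (simp add: space_pure_jump_space)
  show "jump_times zero_path = {}" using s(2) by (auto simp: jump_times_def)
qed

text \<open>\<open>m\<close> is the law of one mark (time and size) and \<open>l\<close> the mean
  number of marks. Absence of fixed times makes a fresh mark avoid any given finite set of jump
  times almost surely, so that jumps never merge.\<close>

locale jump_law = prob_space m for m :: "(real \<times> real) measure" +
  fixes l :: real
  assumes sets_m[measurable_cong, simp]: "sets m = sets (borel \<Otimes>\<^sub>M borel)"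
    and rate_pos: "l > 0"
    and AE_jump: "AE p in m. fst p \<in> {0<..1} \<and> snd p \<noteq> 0"
    and no_fixed_times: "AE p in m. fst p \<noteq> t"
begin

text \<open>The superposition of \<open>k\<close> independent marks, built one mark at a time to
  support induction on their number.\<close>

primrec n_jumps_law :: "nat \<Rightarrow> (real \<Rightarrow> real) measure" where
  "n_jumps_law 0 = return pure_jump_space zero_path"
| "n_jumps_law (Suc k) = distr (n_jumps_law k \<Otimes>\<^sub>M m) pure_jump_space (\<lambda>(w, p). add_jump w p)"

text \<open>Given that it has \<open>k\<close> jumps, a compound Poisson process is a superposition
  of \<open>k\<close> independent marks; mixing over a Poisson number of jumps gives the process
  back.\<close>

definition poisson_law :: "(real \<Rightarrow> real) measure" where
  "poisson_law = measure_pmf (poisson_pmf l) \<bind> n_jumps_law"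

lemma sets_n_jumps_law[measurable_cong, simp]: "sets (n_jumps_law k) = sets pure_jump_space"
  by (cases k) auto

lemma prob_space_n_jumps_law: "prob_space (n_jumps_law k)"
proof (induction k)
  case 0
  then show ?case using prob_space_return[OF zero_path(1)] by simp
next
  case (Suc k)
  interpret K: prob_space "n_jumps_law k" by fact
  interpret P: pair_prob_space "n_jumps_law k" m ..
  show ?case by (simp add: P.prob_space_distr)
qed

lemma space_n_jumps_law[simp]: "space (n_jumps_law k) = space pure_jump_space"
  by (rule sets_eq_imp_space_eq) simp

lemma space_m[simp]: "space m = UNIV"
  using sets_eq_imp_space_eq[OF sets_m] by (simp add: space_pair_measure)

lemma n_jumps_law_kernel[measurable]: "n_jumps_law \<in> measure_pmf (poisson_pmf l) \<rightarrow>\<^sub>M subprob_algebra pure_jump_space"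
proof -
  have "n_jumps_law k \<in> space (subprob_algebra pure_jump_space)" for k
    using prob_space_n_jumps_law[of k]
    by (auto simp: space_subprob_algebra intro: prob_space_imp_subprob_space)
  then show ?thesis by simp
qed

lemma sets_poisson_law[measurable_cong, simp]: "sets poisson_law = sets pure_jump_space"
  unfolding poisson_law_def by (rule sets_bind) auto

lemma space_poisson_law[simp]: "space poisson_law = space pure_jump_space"
  by (rule sets_eq_imp_space_eq) simp

lemma prob_space_poisson_law: "prob_space poisson_law"
  unfolding poisson_law_def
  by (rule measure_pmf.prob_space_bind[OF _ n_jumps_law_kernel]) (simp add: prob_space_n_jumps_law)

sublocale Q: prob_space poisson_law by (rule prob_space_poisson_law)
sublocale Qm: pair_prob_space poisson_law m ..

lemma nn_integral_n_jumps_law_Suc: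
  assumes [measurable]: "f \<in> borel_measurable pure_jump_space"
  shows "(\<integral>\<^sup>+w. f w \<partial>n_jumps_law (Suc k)) = (\<integral>\<^sup>+w. \<integral>\<^sup>+p. f (add_jump w p) \<partial>m \<partial>n_jumps_law k)"
proof -
  have "(\<integral>\<^sup>+w. f w \<partial>n_jumps_law (Suc k)) = (\<integral>\<^sup>+x. f (add_jump (fst x) (snd x)) \<partial>(n_jumps_law k \<Otimes>\<^sub>M m))"
    by (simp add: nn_integral_distr split_beta)
  also have "\<dots> = (\<integral>\<^sup>+w. \<integral>\<^sup>+p. f (add_jump w p) \<partial>m \<partial>n_jumps_law k)"
    by (subst nn_integral_fst[symmetric]) auto
  finally show ?thesis .
qed

lemma nn_integral_poisson_law:
  assumes "f \<in> borel_measurable pure_jump_space"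
  shows "(\<integral>\<^sup>+w. f w \<partial>poisson_law) = (\<Sum>k. ennreal (pmf (poisson_pmf l) k) * (\<integral>\<^sup>+w. f w \<partial>n_jumps_law k))"
proof -
  have "(\<integral>\<^sup>+w. f w \<partial>poisson_law) = (\<integral>\<^sup>+k. \<integral>\<^sup>+w. f w \<partial>n_jumps_law k \<partial>measure_pmf (poisson_pmf l))"
    unfolding poisson_law_def by (rule nn_integral_bind[OF assms n_jumps_law_kernel])
  also have "\<dots> = (\<integral>\<^sup>+k. ennreal (pmf (poisson_pmf l) k) * (\<integral>\<^sup>+w. f w \<partial>n_jumps_law k) \<partial>count_space UNIV)"
    by (rule nn_integral_measure_pmf)
  finally show ?thesis by (simp add: nn_integral_count_space_nat)
qed

text \<open>The jump times of \<open>w\<close> are finitely many, and each is hit with probability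
  0.\<close>

lemma AE_new_jump:
  assumes w: "w \<in> space pure_jump_space"
  shows "AE p in m. fst p \<in> {0<..1} \<and> snd p \<noteq> 0 \<and> fst p \<notin> jump_times w"
proof -
  have "AE p in m. \<forall>t\<in>jump_times w. fst p \<noteq> t"
    using w no_fixed_times pure_jump_finite[of w]
    by (intro AE_ball_countable[THEN iffD2] ballI) (auto simp: space_pure_jump_space countable_finite)
  with AE_jump show ?thesis by eventually_elim auto
qed

lemma add_new_jump:
  assumes w: "w \<in> space pure_jump_space" and p: "fst p \<in> {0<..1} \<and> snd p \<noteq> 0 \<and> fst p \<notin> jump_times w"
  shows "jump_times (add_jump w p) = insert (fst p) (jump_times w)" "jump (add_jump w p) (fst p) = snd p"
    "s \<in> jump_times w \<Longrightarrow> jump (add_jump w p) s = jump w s" "finite (jump_times w)"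
  using jump_add_step_path[of w "fst p" "snd p"] p w pure_jump_finite[of w]
  by (auto simp: add_jump_def space_pure_jump_space)

lemma sum_add_new_jump:
  assumes w: "w \<in> space pure_jump_space" and p: "fst p \<in> {0<..1} \<and> snd p \<noteq> 0 \<and> fst p \<notin> jump_times w"
  shows "(\<Sum>s\<in>jump_times (add_jump w p). f (s, jump (add_jump w p) s))
     = f p + (\<Sum>s\<in>jump_times w. f (s, jump w s))"
proof -
  note j = add_new_jump[OF w p]
  have "(\<Sum>s\<in>jump_times (add_jump w p). f (s, jump (add_jump w p) s))
      = f (fst p, snd p) + (\<Sum>s\<in>jump_times w. f (s, jump (add_jump w p) s))"
    using j p by simp
  also have "(\<Sum>s\<in>jump_times w. f (s, jump (add_jump w p) s)) = (\<Sum>s\<in>jump_times w. f (s, jump w s))"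
    by (rule sum.cong) (simp_all add: j)
  finally show ?thesis by simp
qed

section \<open>Mecke formulas for one and for two jumps\<close>

lemma measurable_jump_sum_path:
  assumes Y: "Y \<in> M \<rightarrow>\<^sub>M pure_jump_space" and X: "X \<in> M \<rightarrow>\<^sub>M N"
    and G[measurable]: "G \<in> borel_measurable ((borel \<Otimes>\<^sub>M borel) \<Otimes>\<^sub>M N)"
  shows "(\<lambda>x. \<Sum>s\<in>jump_times (Y x). G ((s, jump (Y x) s), X x) :: ennreal) \<in> borel_measurable M"
proof -
  have "(\<lambda>(x, s, y). G ((s, y), X x)) \<in> borel_measurable (M \<Otimes>\<^sub>M borel \<Otimes>\<^sub>M borel)"
    using X by measurable
  from measurable_jump_sum[OF Y this] show ?thesis by simp
qed

text \<open>A jump of \<open>add_jump w p\<close> is either \<open>p\<close> or an older one. The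
  new jump gives one copy of the right-hand integral. For the older ones \<open>p\<close> is frozen
  and the induction hypothesis is applied to the function with \<open>p\<close> added, which is why
  \<open>G\<close> is arbitrary; this gives \<open>k + 1\<close> more copies, the order of adding
  marks being immaterial.\<close>

lemma n_jumps_Mecke:
  assumes "G \<in> borel_measurable ((borel \<Otimes>\<^sub>M borel) \<Otimes>\<^sub>M pure_jump_space)"
  shows "(\<integral>\<^sup>+w. (\<Sum>s\<in>jump_times w. G ((s, jump w s), w)) \<partial>n_jumps_law (Suc k))
    = of_nat (Suc k) * (\<integral>\<^sup>+w. \<integral>\<^sup>+p. G (p, add_jump w p) \<partial>m \<partial>n_jumps_law k)"
  using assms
proof (induction k arbitrary: G)
  case (0 G)
  note [measurable] = 0
  have [measurable]: "(\<lambda>w. \<Sum>s\<in>jump_times w. G ((s, jump w s), w)) \<in> borel_measurable pure_jump_space"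
    by (rule measurable_jump_sum_path[where N=pure_jump_space]) auto
  have "(\<integral>\<^sup>+w. (\<Sum>s\<in>jump_times w. G ((s, jump w s), w)) \<partial>n_jumps_law (Suc 0))
    = (\<integral>\<^sup>+w. \<integral>\<^sup>+p. (\<Sum>s\<in>jump_times (add_jump w p). G ((s, jump (add_jump w p) s), add_jump w p)) \<partial>m \<partial>n_jumps_law 0)"
    by (rule nn_integral_n_jumps_law_Suc) measurable
  also have "\<dots> = (\<integral>\<^sup>+p. (\<Sum>s\<in>jump_times (add_jump zero_path p). G ((s, jump (add_jump zero_path p) s), add_jump zero_path p)) \<partial>m)"
    by (simp add: nn_integral_return zero_path)
  also have "\<dots> = (\<integral>\<^sup>+p. G (p, add_jump zero_path p) \<partial>m)"
  proof (rule nn_integral_cong_AE)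
    show "AE p in m. (\<Sum>s\<in>jump_times (add_jump zero_path p). G ((s, jump (add_jump zero_path p) s), add_jump zero_path p))
      = G (p, add_jump zero_path p)"
      using AE_new_jump[OF zero_path(1)]
    proof eventually_elim
      case (elim p)
      from sum_add_new_jump[OF zero_path(1) elim, of "\<lambda>\<gamma>. G (\<gamma>, add_jump zero_path p)"]
      show ?case by (simp add: zero_path(2))
    qed
  qed
  also have "\<dots> = (\<integral>\<^sup>+w. \<integral>\<^sup>+p. G (p, add_jump w p) \<partial>m \<partial>n_jumps_law 0)"
    by (simp add: nn_integral_return zero_path)
  finally show ?case by simp
next
  case (Suc k G)
  note [measurable] = Suc.prems
  interpret K: prob_space "n_jumps_law k" by (rule prob_space_n_jumps_law)
  interpret K': prob_space "n_jumps_law (Suc k)" by (rule prob_space_n_jumps_law)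
  interpret P: pair_sigma_finite "n_jumps_law k" m ..
  interpret P': pair_sigma_finite "n_jumps_law (Suc k)" m ..
  let ?B = "\<integral>\<^sup>+w. \<integral>\<^sup>+p. G (p, add_jump w p) \<partial>m \<partial>n_jumps_law (Suc k)"
  have [measurable]: "(\<lambda>w. \<Sum>s\<in>jump_times w. G ((s, jump w s), w)) \<in> borel_measurable pure_jump_space"
    by (rule measurable_jump_sum_path[where N=pure_jump_space]) auto
  have [measurable]: "(\<lambda>x. \<Sum>s\<in>jump_times (fst x). G ((s, jump (fst x) s), add_jump (fst x) (snd x)))
      \<in> borel_measurable (pure_jump_space \<Otimes>\<^sub>M borel \<Otimes>\<^sub>M borel)"
    by (rule measurable_jump_sum_path[where N=pure_jump_space]) auto
  have "(\<integral>\<^sup>+w. (\<Sum>s\<in>jump_times w. G ((s, jump w s), w)) \<partial>n_jumps_law (Suc (Suc k)))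
    = (\<integral>\<^sup>+w. \<integral>\<^sup>+p. (\<Sum>s\<in>jump_times (add_jump w p). G ((s, jump (add_jump w p) s), add_jump w p)) \<partial>m \<partial>n_jumps_law (Suc k))"
    by (rule nn_integral_n_jumps_law_Suc) measurable
  also have "\<dots> = (\<integral>\<^sup>+w. \<integral>\<^sup>+p. G (p, add_jump w p) + (\<Sum>s\<in>jump_times w. G ((s, jump w s), add_jump w p)) \<partial>m \<partial>n_jumps_law (Suc k))"
  proof (rule nn_integral_cong)
    fix w assume "w \<in> space (n_jumps_law (Suc k))"
    then have w: "w \<in> space pure_jump_space" by simp
    show "(\<integral>\<^sup>+p. (\<Sum>s\<in>jump_times (add_jump w p). G ((s, jump (add_jump w p) s), add_jump w p)) \<partial>m)
      = (\<integral>\<^sup>+p. G (p, add_jump w p) + (\<Sum>s\<in>jump_times w. G ((s, jump w s), add_jump w p)) \<partial>m)"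
    proof (rule nn_integral_cong_AE)
      show "AE p in m. (\<Sum>s\<in>jump_times (add_jump w p). G ((s, jump (add_jump w p) s), add_jump w p))
        = G (p, add_jump w p) + (\<Sum>s\<in>jump_times w. G ((s, jump w s), add_jump w p))"
        using AE_new_jump[OF w]
      proof eventually_elim
        case (elim p)
        show ?case by (rule sum_add_new_jump[OF w elim, of "\<lambda>\<gamma>. G (\<gamma>, add_jump w p)"])
      qed
    qed
  qed
  also have "\<dots> = ?B + (\<integral>\<^sup>+w. \<integral>\<^sup>+p. (\<Sum>s\<in>jump_times w. G ((s, jump w s), add_jump w p)) \<partial>m \<partial>n_jumps_law (Suc k))"
  proof -
    have "(\<integral>\<^sup>+w. \<integral>\<^sup>+p. G (p, add_jump w p) + (\<Sum>s\<in>jump_times w. G ((s, jump w s), add_jump w p)) \<partial>m \<partial>n_jumps_law (Suc k))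
      = (\<integral>\<^sup>+w. (\<integral>\<^sup>+p. G (p, add_jump w p) \<partial>m) + (\<integral>\<^sup>+p. (\<Sum>s\<in>jump_times w. G ((s, jump w s), add_jump w p)) \<partial>m) \<partial>n_jumps_law (Suc k))"
      by (intro nn_integral_cong nn_integral_add) (auto simp del: n_jumps_law.simps)
    also have "\<dots> = ?B + (\<integral>\<^sup>+w. \<integral>\<^sup>+p. (\<Sum>s\<in>jump_times w. G ((s, jump w s), add_jump w p)) \<partial>m \<partial>n_jumps_law (Suc k))"
      by (intro nn_integral_add) (auto simp del: n_jumps_law.simps)
    finally show ?thesis .
  qed
  also have "(\<integral>\<^sup>+w. \<integral>\<^sup>+p. (\<Sum>s\<in>jump_times w. G ((s, jump w s), add_jump w p)) \<partial>m \<partial>n_jumps_law (Suc k))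
    = (\<integral>\<^sup>+p. \<integral>\<^sup>+w. (\<Sum>s\<in>jump_times w. G ((s, jump w s), add_jump w p)) \<partial>n_jumps_law (Suc k) \<partial>m)"
    by (rule P'.Fubini'[symmetric]) (simp add: split_beta' del: n_jumps_law.simps)
  also have "\<dots> = (\<integral>\<^sup>+p. of_nat (Suc k) * (\<integral>\<^sup>+w. \<integral>\<^sup>+q. G (q, add_jump (add_jump w q) p) \<partial>m \<partial>n_jumps_law k) \<partial>m)"
  proof (rule nn_integral_cong)
    fix p :: "real \<times> real"
    have [measurable]: "p \<in> space (borel \<Otimes>\<^sub>M borel)" by (simp add: space_pair_measure)
    have "(\<lambda>x. G (fst x, add_jump (snd x) p)) \<in> borel_measurable ((borel \<Otimes>\<^sub>M borel) \<Otimes>\<^sub>M pure_jump_space)"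
      by measurable
    from Suc.IH[OF this]
    show "(\<integral>\<^sup>+w. (\<Sum>s\<in>jump_times w. G ((s, jump w s), add_jump w p)) \<partial>n_jumps_law (Suc k))
      = of_nat (Suc k) * (\<integral>\<^sup>+w. \<integral>\<^sup>+q. G (q, add_jump (add_jump w q) p) \<partial>m \<partial>n_jumps_law k)"
      by (simp only: fst_conv snd_conv)
  qed
  also have "\<dots> = of_nat (Suc k) * (\<integral>\<^sup>+p. \<integral>\<^sup>+w. \<integral>\<^sup>+q. G (q, add_jump (add_jump w q) p) \<partial>m \<partial>n_jumps_law k \<partial>m)"
    by (rule nn_integral_cmult) measurable
  also have "(\<integral>\<^sup>+p. \<integral>\<^sup>+w. \<integral>\<^sup>+q. G (q, add_jump (add_jump w q) p) \<partial>m \<partial>n_jumps_law k \<partial>m)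
     = (\<integral>\<^sup>+w. \<integral>\<^sup>+p. \<integral>\<^sup>+q. G (q, add_jump (add_jump w q) p) \<partial>m \<partial>m \<partial>n_jumps_law k)"
    by (rule P.Fubini') measurable
  \<comment> \<open>After commuting the two marks, \<open>q\<close> is the distinguished jump and is
    added last, to a path with the \<open>k + 1\<close> jumps of
    \<open>n_jumps_law (Suc k)\<close>.\<close>
  also have "\<dots> = (\<integral>\<^sup>+w. \<integral>\<^sup>+p. \<integral>\<^sup>+q. G (q, add_jump (add_jump w p) q) \<partial>m \<partial>m \<partial>n_jumps_law k)"
    by (simp only: add_jump_commute)
  also have "\<dots> = ?B"
    by (rule nn_integral_n_jumps_law_Suc[symmetric]) measurable
  finally show ?case by (simp add: distrib_right del: n_jumps_law.simps)
qed

text \<open>The Poisson weights satisfy \<open>(k + 1) * p (k + 1) = l * p k\<close>, so a shift of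
  the series by one turns the factor \<open>k + 1\<close> for a fixed number of jumps into the rate
  \<open>l\<close>. The term without jumps vanishes.\<close>

theorem Mecke:
  assumes G[measurable]: "G \<in> borel_measurable ((borel \<Otimes>\<^sub>M borel) \<Otimes>\<^sub>M pure_jump_space)"
  shows "(\<integral>\<^sup>+w. (\<Sum>s\<in>jump_times w. G ((s, jump w s), w)) \<partial>poisson_law)
    = ennreal l * (\<integral>\<^sup>+w. \<integral>\<^sup>+p. G (p, add_jump w p) \<partial>m \<partial>poisson_law)"
proof -
  have S[measurable]: "(\<lambda>w. \<Sum>s\<in>jump_times w. G ((s, jump w s), w)) \<in> borel_measurable pure_jump_space"
    by (rule measurable_jump_sum_path[where N=pure_jump_space]) auto
  let ?p = "pmf (poisson_pmf l)"
  let ?A = "\<lambda>k. \<integral>\<^sup>+w. (\<Sum>s\<in>jump_times w. G ((s, jump w s), w)) \<partial>n_jumps_law k"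
  let ?B = "\<lambda>k. \<integral>\<^sup>+w. \<integral>\<^sup>+p. G (p, add_jump w p) \<partial>m \<partial>n_jumps_law k"
  have 0: "?A 0 = 0" by (simp add: nn_integral_return zero_path)
  have p: "ennreal (?p (Suc k)) * of_nat (Suc k) = ennreal l * ennreal (?p k)" for k
    using rate_pos
    by (simp add: pmf_poisson ennreal_of_nat_eq_real_of_nat ennreal_mult[symmetric] del: of_nat_Suc)
  have "(\<integral>\<^sup>+w. (\<Sum>s\<in>jump_times w. G ((s, jump w s), w)) \<partial>poisson_law) = (\<Sum>k. ennreal (?p k) * ?A k)"
    by (rule nn_integral_poisson_law[OF S])
  also have "\<dots> = (\<Sum>k. ennreal (?p (Suc k)) * ?A (Suc k))"
  proof -
    have "(\<lambda>k. ennreal (?p (Suc k)) * ?A (Suc k)) sums (\<Sum>k. ennreal (?p (Suc k)) * ?A (Suc k))"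
      by (rule summable_sums) simp
    from sums_Suc[OF this] show ?thesis unfolding 0 by (simp add: sums_iff)
  qed
  also have "\<dots> = (\<Sum>k. ennreal l * (ennreal (?p k) * ?B k))"
    by (simp only: n_jumps_Mecke[OF G] p mult.assoc[symmetric])
  also have "\<dots> = ennreal l * (\<Sum>k. ennreal (?p k) * ?B k)"
    by (rule ennreal_suminf_cmult)
  also have "(\<Sum>k. ennreal (?p k) * ?B k) = (\<integral>\<^sup>+w. \<integral>\<^sup>+p. G (p, add_jump w p) \<partial>m \<partial>poisson_law)"
    by (rule nn_integral_poisson_law[symmetric]) measurable
  finally show ?thesis .
qed

text \<open>The one-jump formula is used twice, for the outer jump and then, with that mark
  \<open>p\<close> frozen, for the inner one. Once \<open>p\<close> is added, removing its time
  leaves almost surely the old jump times.\<close>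

theorem Mecke2:
  assumes H[measurable]: "H \<in> borel_measurable ((borel \<Otimes>\<^sub>M borel) \<Otimes>\<^sub>M (borel \<Otimes>\<^sub>M borel) \<Otimes>\<^sub>M pure_jump_space)"
  shows "(\<integral>\<^sup>+w. (\<Sum>s\<in>jump_times w. \<Sum>t\<in>jump_times w - {s}. H ((s, jump w s), (t, jump w t), w)) \<partial>poisson_law)
    = ennreal l * (ennreal l * (\<integral>\<^sup>+w. \<integral>\<^sup>+p. \<integral>\<^sup>+q. H (p, q, add_jump (add_jump w p) q) \<partial>m \<partial>m \<partial>poisson_law))"
proof -
  let ?G = "\<lambda>(p, w). \<Sum>t\<in>jump_times w - {fst p}. H (p, (t, jump w t), w)"
  \<comment> \<open>Excluding the outer time is moved into the summand, so that the sum runs over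
    all jump times and is covered by the measurability of jump sums.\<close>
  let ?G' = "\<lambda>(p, w). \<Sum>t\<in>jump_times w. (\<lambda>(q, p, w). if fst q = fst p then 0 else H (p, q, w)) ((t, jump w t), p, w)"
  have "?G' \<in> borel_measurable ((borel \<Otimes>\<^sub>M borel) \<Otimes>\<^sub>M pure_jump_space)"
    unfolding split_beta' by (rule measurable_jump_sum_path[unfolded split_beta']) measurable
  also have "?this \<longleftrightarrow> ?G \<in> borel_measurable ((borel \<Otimes>\<^sub>M borel) \<Otimes>\<^sub>M pure_jump_space)"
    using pure_jump_finite
    by (intro measurable_cong)
       (auto simp: space_pair_measure space_pure_jump_space intro!: sum.mono_neutral_cong_right split: if_splits)
  finally have G[measurable]: "?G \<in> borel_measurable ((borel \<Otimes>\<^sub>M borel) \<Otimes>\<^sub>M pure_jump_space)" .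
  have [measurable]: "(\<lambda>x. \<Sum>t\<in>jump_times (fst x). H (snd x, (t, jump (fst x) t), add_jump (fst x) (snd x)))
     \<in> borel_measurable (pure_jump_space \<Otimes>\<^sub>M borel \<Otimes>\<^sub>M borel)"
  proof -
    have "(\<lambda>x. \<Sum>t\<in>jump_times (fst x). (\<lambda>(q, w, p). H (p, q, add_jump w p)) ((t, jump (fst x) t), x))
     \<in> borel_measurable (pure_jump_space \<Otimes>\<^sub>M borel \<Otimes>\<^sub>M borel)"
      by (rule measurable_jump_sum_path) measurable
    then show ?thesis by (simp add: split_beta')
  qed
  have "(\<integral>\<^sup>+w. (\<Sum>s\<in>jump_times w. \<Sum>t\<in>jump_times w - {s}. H ((s, jump w s), (t, jump w t), w)) \<partial>poisson_law)
     = ennreal l * (\<integral>\<^sup>+w. \<integral>\<^sup>+p. ?G (p, add_jump w p) \<partial>m \<partial>poisson_law)"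
    using Mecke[OF G] by simp
  also have "(\<integral>\<^sup>+w. \<integral>\<^sup>+p. ?G (p, add_jump w p) \<partial>m \<partial>poisson_law)
     = (\<integral>\<^sup>+w. \<integral>\<^sup>+p. (\<Sum>t\<in>jump_times w. H (p, (t, jump w t), add_jump w p)) \<partial>m \<partial>poisson_law)"
  proof (rule nn_integral_cong)
    fix w assume "w \<in> space poisson_law"
    then have w: "w \<in> space pure_jump_space" by simp
    show "(\<integral>\<^sup>+p. ?G (p, add_jump w p) \<partial>m) = (\<integral>\<^sup>+p. (\<Sum>t\<in>jump_times w. H (p, (t, jump w t), add_jump w p)) \<partial>m)"
    proof (rule nn_integral_cong_AE)
      show "AE p in m. ?G (p, add_jump w p) = (\<Sum>t\<in>jump_times w. H (p, (t, jump w t), add_jump w p))"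
        using AE_new_jump[OF w]
      proof eventually_elim
        case (elim p)
        note j = add_new_jump[OF w elim]
        have "jump_times (add_jump w p) - {fst p} = jump_times w" using j(1) elim by auto
        then show ?case by (simp add: j(3))
      qed
    qed
  qed
  also have "\<dots> = (\<integral>\<^sup>+p. \<integral>\<^sup>+w. (\<Sum>t\<in>jump_times w. H (p, (t, jump w t), add_jump w p)) \<partial>poisson_law \<partial>m)"
    by (rule Qm.Fubini'[symmetric]) (simp add: split_beta')
  also have "\<dots> = (\<integral>\<^sup>+p. ennreal l * (\<integral>\<^sup>+w. \<integral>\<^sup>+q. H (p, q, add_jump (add_jump w q) p) \<partial>m \<partial>poisson_law) \<partial>m)"
  proof (rule nn_integral_cong)
    fix p :: "real \<times> real"
    have [measurable]: "p \<in> space (borel \<Otimes>\<^sub>M borel)" by (simp add: space_pair_measure)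
    have "(\<lambda>x. H (p, fst x, add_jump (snd x) p)) \<in> borel_measurable ((borel \<Otimes>\<^sub>M borel) \<Otimes>\<^sub>M pure_jump_space)"
      by measurable
    from Mecke[OF this]
    show "(\<integral>\<^sup>+w. (\<Sum>t\<in>jump_times w. H (p, (t, jump w t), add_jump w p)) \<partial>poisson_law)
      = ennreal l * (\<integral>\<^sup>+w. \<integral>\<^sup>+q. H (p, q, add_jump (add_jump w q) p) \<partial>m \<partial>poisson_law)"
      by (simp only: fst_conv snd_conv)
  qed
  also have "\<dots> = ennreal l * (\<integral>\<^sup>+p. \<integral>\<^sup>+w. \<integral>\<^sup>+q. H (p, q, add_jump (add_jump w q) p) \<partial>m \<partial>poisson_law \<partial>m)"
    by (rule nn_integral_cmult) measurable
  also have "(\<integral>\<^sup>+p. \<integral>\<^sup>+w. \<integral>\<^sup>+q. H (p, q, add_jump (add_jump w q) p) \<partial>m \<partial>poisson_law \<partial>m)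
     = (\<integral>\<^sup>+w. \<integral>\<^sup>+p. \<integral>\<^sup>+q. H (p, q, add_jump (add_jump w q) p) \<partial>m \<partial>m \<partial>poisson_law)"
    by (rule Qm.Fubini') measurable
  finally show ?thesis by (simp only: add_jump_commute)
qed

end

section \<open>Joint laws and characteristic functions\<close>

text \<open>Divided by its mass \<open>c\<close>, the weight \<open>h\<close> is a probability
  density, and the laws of \<open>X\<close> under the two weighted measures have equal
  characteristic functions. The mass is the same for both measures, as \<open>u = 0\<close> shows;
  if it is 0, both sides vanish.\<close>

lemma weighted_char_unique:
  fixes X h :: "'a \<Rightarrow> real"
  assumes M1: "prob_space M1" and M2: "prob_space M2"
    and meas: "X \<in> borel_measurable M1" "X \<in> borel_measurable M2" "h \<in> borel_measurable M1" "h \<in> borel_measurable M2"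
    and h: "\<And>w. 0 \<le> h w" "\<And>w. h w \<le> b"
    and eq: "\<And>u. (CLINT w|M1. h w * iexp (u * X w)) = (CLINT w|M2. h w * iexp (u * X w))"
    and B[measurable]: "B \<in> sets borel"
  shows "(LINT w|M1. h w * indicator B (X w)) = (LINT w|M2. h w * indicator B (X w))"
proof -
  have int: "integrable M h" if "prob_space M" "h \<in> borel_measurable M" for M
  proof -
    interpret prob_space M by fact
    show ?thesis using h that(2) by (intro integrable_const_bound[of _ b]) auto
  qed
  define c where "c = (LINT w|M1. h w)"
  have c1: "c = (LINT w|M1. h w)" by (simp add: c_def)
  have c2: "c = (LINT w|M2. h w)"
    using eq[of 0] unfolding c_def by (simp del: of_real_mult)
  show ?thesis
  proof (cases "c = 0")
    case True
    have "(LINT w|M. h w * indicator B (X w)) = 0"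
      if M: "prob_space M" "h \<in> borel_measurable M" "(LINT w|M. h w) = 0" for M
    proof -
      have "AE w in M. h w = 0"
        using integral_nonneg_eq_0_iff_AE[OF int[OF M(1,2)]] h(1) M(3) by simp
      then have "AE w in M. h w * indicator B (X w) = 0" by eventually_elim simp
      then show ?thesis by (rule integral_eq_zero_AE)
    qed
    then show ?thesis using M1 M2 meas c1 c2 True by metis
  next
    case False
    then have c: "c > 0" using c1 h(1) Bochner_Integration.integral_nonneg[of M1 h] by (simp add: less_le)
    define N where "N M = distr (density M (\<lambda>w. ennreal (h w / c))) borel X" for M
    have N: "real_distribution (N M) \<and> (\<forall>u. char (N M) u = (CLINT w|M. h w * iexp (u * X w)) / c) \<and>
       measure (N M) B = (LINT w|M. h w * indicator B (X w)) / c"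
      if M: "prob_space M" and [measurable]: "X \<in> borel_measurable M" "h \<in> borel_measurable M" and cM: "c = (LINT w|M. h w)" for M
    proof -
      let ?D = "density M (\<lambda>w. ennreal (h w / c))"
      have "(\<integral>\<^sup>+w. ennreal (h w / c) \<partial>M) = ennreal (LINT w|M. h w / c)"
        using int[OF M] h c by (intro nn_integral_eq_integral) auto
      also have "(LINT w|M. h w / c) = 1" using c cM by simp
      finally have "emeasure ?D (space ?D) = 1" by (simp add: emeasure_density cong: nn_integral_cong)
      then interpret D: prob_space ?D by (rule prob_spaceI)
      have 1: "real_distribution (N M)" unfolding N_def by (intro D.real_distribution_distr) simp
      have 2: "char (N M) u = (CLINT w|M. h w * iexp (u * X w)) / c" for u
      proof -
        have "char (N M) u = (CLINT w|?D. iexp (u * X w))"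
          unfolding char_def N_def by (subst integral_distr) auto
        also have "\<dots> = (CLINT w|M. (h w / c) *\<^sub>R iexp (u * X w))"
          using h c by (subst integral_density) auto
        also have "\<dots> = (CLINT w|M. (h w * iexp (u * X w)) / c)"
          by (simp add: scaleR_conv_of_real)
        finally show ?thesis by simp
      qed
      have "measure (N M) B = (LINT x|N M. indicator B x)" by (simp add: N_def)
      also have "\<dots> = (LINT w|?D. indicator B (X w))"
        unfolding N_def by (subst integral_distr) auto
      also have "\<dots> = (LINT w|M. (h w / c) *\<^sub>R indicator B (X w))"
        using h c by (subst integral_density) auto
      also have "\<dots> = (LINT w|M. h w * indicator B (X w)) / c" by simp
      finally show ?thesis using 1 2 by blast
    qed
    note N1 = N[OF M1 meas(1,3) c1] and N2 = N[OF M2 meas(2,4) c2]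
    have "N M1 = N M2"
      using N1 N2 eq by (intro Levy_uniqueness) auto
    then show ?thesis using N1 N2 c by (metis nonzero_divide_eq_eq less_numeral_extra(3) order_less_irrefl)
  qed
qed

text \<open>The exponential factors of the joint characteristic function are replaced by indicator functions
  one coordinate at a time. A complex weight \<open>iexp V\<close> is recovered from the nonnegative weights
  \<open>1\<close>, \<open>1 + cos V\<close> and \<open>1 + sin V\<close>, to which one-dimensional uniqueness applies.\<close>

lemma joint_char_unique:
  fixes X :: "'i \<Rightarrow> 'a \<Rightarrow> real"
  assumes M1: "prob_space M1" and M2: "prob_space M2"
    and meas1[measurable]: "\<And>i. i \<in> I \<Longrightarrow> X i \<in> borel_measurable M1"
    and meas2[measurable]: "\<And>i. i \<in> I \<Longrightarrow> X i \<in> borel_measurable M2"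
    and eq: "\<And>J u. finite J \<Longrightarrow> J \<subseteq> I \<Longrightarrow>
      (CLINT w|M1. iexp (\<Sum>j\<in>J. u j * X j w)) = (CLINT w|M2. iexp (\<Sum>j\<in>J. u j * X j w))"
    and K: "finite K" "K \<subseteq> I" and B[measurable]: "\<And>k. k \<in> K \<Longrightarrow> B k \<in> sets borel"
  shows "(LINT w|M1. (\<Prod>k\<in>K. indicator (B k) (X k w))) = (LINT w|M2. (\<Prod>k\<in>K. indicator (B k) (X k w) :: real))"
proof -
  define H where "H K w = (\<Prod>k\<in>K. indicator (B k) (X k w) :: real)" for K w
  define V where "V J u w = (\<Sum>j\<in>J. u j * X j w)" for J u w
  have H_nn: "0 \<le> H K w" and H_le: "H K w \<le> 1" for K w
    unfolding H_def by (auto intro!: prod_nonneg prod_le_1 simp: indicator_def)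
  have H_meas: "H K' \<in> borel_measurable M" if "K' \<subseteq> K" "M \<in> {M1, M2}" for K' M
  proof -
    have "X k \<in> borel_measurable M" "B k \<in> sets borel" if "k \<in> K'" for k
      using that \<open>K' \<subseteq> K\<close> \<open>M \<in> _\<close> K by auto
    then show ?thesis unfolding H_def
      by (intro borel_measurable_prod) (auto intro!: borel_measurable_indicator' measurable_compose[OF _ borel_measurable_indicator])
  qed
  have V_meas: "V J u \<in> borel_measurable M" if "J \<subseteq> I" "M \<in> {M1, M2}" for J u M
    unfolding V_def using that by (intro borel_measurable_sum borel_measurable_times) auto
  have int: "integrable M f"
    if "M \<in> {M1, M2}" "f \<in> borel_measurable M" "\<And>w. norm (f w) \<le> b" for M and f :: "'a \<Rightarrow> 'c::{banach, second_countable_topology}" and b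
  proof -
    interpret prob_space M using that M1 M2 by auto
    show ?thesis using that by (intro integrable_const_bound[of _ b]) auto
  qed
  \<comment> \<open>Coordinates in \<open>K'\<close> already carry indicators, while those in the
    disjoint set \<open>J\<close> still carry exponentials.\<close>
  have main: "\<forall>J u. finite J \<longrightarrow> J \<subseteq> I \<longrightarrow> J \<inter> K' = {} \<longrightarrow>
     (CLINT w|M1. H K' w * iexp (V J u w)) = (CLINT w|M2. H K' w * iexp (V J u w))" if "K' \<subseteq> K" for K'
    using finite_subset[OF that K(1)] that
  proof (induction K')
    case empty
    then show ?case using eq by (auto simp: H_def V_def)
  next
    case (insert k K')
    show ?case
    proof (intro allI impI)
      fix J u assume J: "finite J" "J \<subseteq> I" "J \<inter> insert k K' = {}"
      have kI: "k \<in> I" and kB: "B k \<in> sets borel" using insert.prems K B by auto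
      have K': "K' \<subseteq> K" using insert.prems by simp
      let ?E = "\<lambda>M v s. CLINT w|M. H K' w * iexp (v * X k w + s * V J u w)"
      \<comment> \<open>An instance of the induction hypothesis, with frequency \<open>v\<close> at
        \<open>k\<close> and \<open>s * u\<close> on \<open>J\<close>. The values 0, 1 and -1 of
        \<open>s\<close> suffice to express the weights \<open>1 + cos V\<close> and
        \<open>1 + sin V\<close>.\<close>
      have E: "?E M1 v s = ?E M2 v s" for v s
      proof -
        let ?u = "\<lambda>j. if j = k then v else s * u j"
        have "V (insert k J) ?u w = v * X k w + s * V J u w" for w
          unfolding V_def using J by (auto simp: sum_distrib_left mult.assoc intro!: sum.cong)
        moreover have "(CLINT w|M1. H K' w * iexp (V (insert k J) ?u w)) = (CLINT w|M2. H K' w * iexp (V (insert k J) ?u w))"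
          using insert.IH[OF K', rule_format, of "insert k J" ?u] J kI insert.hyps by auto
        ultimately show ?thesis by simp
      qed
      have meas: "X k \<in> borel_measurable M" "H K' \<in> borel_measurable M" "V J u \<in> borel_measurable M"
        if "M \<in> {M1, M2}" for M
        using that kI H_meas[OF K' that] V_meas[OF J(2) that] by auto
      have iexp_sum: "iexp (x + 1 * y) = iexp x * iexp y" "iexp (x + (-1) * y) = iexp x * iexp (- y)" for x y
        by (simp_all add: distrib_left exp_add[symmetric] right_diff_distrib)
      have int_E: "integrable M (\<lambda>w. H K' w * iexp (v * X k w + s * V J u w))" if M: "M \<in> {M1, M2}" for M v s
        using meas[OF M] H_nn H_le by (intro int[OF M, of _ 1]) (auto simp: norm_mult)
      have lin: "(CLINT w|M. f w + (g w + h w) / c) = (CLINT w|M. f w) + ((CLINT w|M. g w) + (CLINT w|M. h w)) / c"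
         "(CLINT w|M. f w + (g w - h w) / c) = (CLINT w|M. f w) + ((CLINT w|M. g w) - (CLINT w|M. h w)) / c"
        if "integrable M f" "integrable M g" "integrable M h" for M f g h c
        using that by simp_all
      have lin_real: "(CLINT w|M. complex_of_real (f w - h w) + \<i> * complex_of_real (g w - h w))
         = complex_of_real (integral\<^sup>L M f - integral\<^sup>L M h) + \<i> * complex_of_real (integral\<^sup>L M g - integral\<^sup>L M h)"
        if "integrable M f" "integrable M g" "integrable M h" for M and f g h :: "'a \<Rightarrow> real"
      proof -
        have "complex_integrable M (\<lambda>w. complex_of_real (f w - h w))" "complex_integrable M (\<lambda>w. complex_of_real (g w - h w))"
          using that by (auto simp del: of_real_diff)
        then show ?thesis using that by (simp del: of_real_diff)
      qed
      have C: "(CLINT w|M. (H K' w * (1 + cos (V J u w))) * iexp (v * X k w))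
          = ?E M v 0 + (?E M v 1 + ?E M v (-1)) / 2" if M: "M \<in> {M1, M2}" for M v
      proof -
        have "(H K' w * (1 + cos (V J u w))) * iexp (v * X k w) = H K' w * iexp (v * X k w + 0 * V J u w)
           + (H K' w * iexp (v * X k w + 1 * V J u w) + H K' w * iexp (v * X k w + (-1) * V J u w)) / 2" for w
        proof -
          have tr: "complex_of_real (cos (V J u w)) = (iexp (V J u w) + iexp (- V J u w)) / 2"
            by (simp add: cos_of_real[symmetric] cos_exp_eq)
          have alg: "h * (1 + d) * a = h * a + (h * (a * b) + h * (a * b')) / 2" if "d = (b + b') / 2"
            for a b b' d h :: complex
            unfolding that by (simp add: algebra_simps add_divide_distrib)
          show ?thesis unfolding iexp_sum
            using alg[OF tr, of "of_real (H K' w)" "iexp (v * X k w)"] by simp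
        qed
        then show ?thesis
          by (simp only: lin(1)[OF int_E[OF M] int_E[OF M] int_E[OF M]])
      qed
      have S: "(CLINT w|M. (H K' w * (1 + sin (V J u w))) * iexp (v * X k w))
          = ?E M v 0 + (?E M v 1 - ?E M v (-1)) / (2 * \<i>)" if M: "M \<in> {M1, M2}" for M v
      proof -
        have "(H K' w * (1 + sin (V J u w))) * iexp (v * X k w) = H K' w * iexp (v * X k w + 0 * V J u w)
           + (H K' w * iexp (v * X k w + 1 * V J u w) - H K' w * iexp (v * X k w + (-1) * V J u w)) / (2 * \<i>)" for w
        proof -
          have tr: "complex_of_real (sin (V J u w)) = (iexp (V J u w) - iexp (- V J u w)) / (2 * \<i>)"
            by (simp add: sin_of_real[symmetric] sin_exp_eq)
          have alg: "h * (1 + d) * a = h * a + (h * (a * b) - h * (a * b')) / (2 * \<i>)" if "d = (b - b') / (2 * \<i>)"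
            for a b b' d h :: complex
            unfolding that by (simp add: algebra_simps diff_divide_distrib)
          show ?thesis unfolding iexp_sum
            using alg[OF tr, of "of_real (H K' w)" "iexp (v * X k w)"] by simp
        qed
        then show ?thesis
          by (simp only: lin(2)[OF int_E[OF M] int_E[OF M] int_E[OF M]])
      qed
      have R: "(LINT w|M1. h w * indicator (B k) (X k w)) = (LINT w|M2. h w * indicator (B k) (X k w))"
        if "\<And>M. M \<in> {M1, M2} \<Longrightarrow> h \<in> borel_measurable M" "\<And>w. 0 \<le> h w" "\<And>w. h w \<le> 2"
          "\<And>v. (CLINT w|M1. h w * iexp (v * X k w)) = (CLINT w|M2. h w * iexp (v * X k w))" for h :: "'a \<Rightarrow> real"
        by (rule weighted_char_unique[OF M1 M2 _ _ _ _ that(2,3,4) kB]) (use meas that(1) in auto)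
      have bnd: "0 \<le> H K' w * (1 + cos (V J u w))" "H K' w * (1 + cos (V J u w)) \<le> 2"
         "0 \<le> H K' w * (1 + sin (V J u w))" "H K' w * (1 + sin (V J u w)) \<le> 2" "H K' w \<le> 2" for w
      proof -
        have b: "0 \<le> H K' w * (1 + x) \<and> H K' w * (1 + x) \<le> 2" if "-1 \<le> x" "x \<le> 1" for x
          using mult_mono[of "H K' w" 1 "1 + x" 2] mult_nonneg_nonneg[of "H K' w" "1 + x"] H_nn[of K' w] H_le[of K' w] that
          by simp
        show "0 \<le> H K' w * (1 + cos (V J u w))" "H K' w * (1 + cos (V J u w)) \<le> 2"
         "0 \<le> H K' w * (1 + sin (V J u w))" "H K' w * (1 + sin (V J u w)) \<le> 2" "H K' w \<le> 2"
          using b[of "cos (V J u w)"] b[of "sin (V J u w)"] H_le[of K' w] by auto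
      qed
      have R0: "(LINT w|M1. H K' w * indicator (B k) (X k w)) = (LINT w|M2. H K' w * indicator (B k) (X k w))"
        using meas H_nn bnd E[of _ 0] by (intro R) auto
      have RC: "(LINT w|M1. (H K' w * (1 + cos (V J u w))) * indicator (B k) (X k w))
         = (LINT w|M2. (H K' w * (1 + cos (V J u w))) * indicator (B k) (X k w))"
      proof (rule R)
        show "(CLINT w|M1. (H K' w * (1 + cos (V J u w))) * iexp (v * X k w))
          = (CLINT w|M2. (H K' w * (1 + cos (V J u w))) * iexp (v * X k w))" for v
          unfolding C[OF insertI1] C[OF insertI2[OF singletonI]] E ..
      qed (use meas bnd in auto)
      have RS: "(LINT w|M1. (H K' w * (1 + sin (V J u w))) * indicator (B k) (X k w))
         = (LINT w|M2. (H K' w * (1 + sin (V J u w))) * indicator (B k) (X k w))"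
      proof (rule R)
        show "(CLINT w|M1. (H K' w * (1 + sin (V J u w))) * iexp (v * X k w))
          = (CLINT w|M2. (H K' w * (1 + sin (V J u w))) * iexp (v * X k w))" for v
          unfolding S[OF insertI1] S[OF insertI2[OF singletonI]] E ..
      qed (use meas bnd in auto)
      \<comment> \<open>Euler's formula in the form
        \<open>iexp V = ((1 + cos V) - 1) + \<i> * ((1 + sin V) - 1)\<close>; the integrals of the
        three nonnegative weights agree by \<open>RC\<close>, \<open>RS\<close> and
        \<open>R0\<close>.\<close>
      have F: "(CLINT w|M. H (insert k K') w * iexp (V J u w))
        = of_real ((LINT w|M. (H K' w * (1 + cos (V J u w))) * indicator (B k) (X k w)) - (LINT w|M. H K' w * indicator (B k) (X k w)))
        + \<i> * of_real ((LINT w|M. (H K' w * (1 + sin (V J u w))) * indicator (B k) (X k w)) - (LINT w|M. H K' w * indicator (B k) (X k w)))"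
        if M: "M \<in> {M1, M2}" for M
      proof -
        note [measurable] = meas[OF M] kB
        have ind: "(\<lambda>w. indicator (B k) (X k w) :: real) \<in> borel_measurable M" by measurable
        have i0: "integrable M (\<lambda>w. H K' w * indicator (B k) (X k w))"
          using H_nn H_le ind by (intro int[OF M, of _ 1]) (auto simp: indicator_def)
        have iC: "integrable M (\<lambda>w. (H K' w * (1 + cos (V J u w))) * indicator (B k) (X k w))"
          using bnd ind by (intro int[OF M, of _ 2]) (auto simp: indicator_def)
        have iS: "integrable M (\<lambda>w. (H K' w * (1 + sin (V J u w))) * indicator (B k) (X k w))"
          using bnd ind by (intro int[OF M, of _ 2]) (auto simp: indicator_def)
        have "H (insert k K') w * iexp (V J u w) =
          of_real ((H K' w * (1 + cos (V J u w))) * indicator (B k) (X k w) - H K' w * indicator (B k) (X k w))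
          + \<i> * of_real ((H K' w * (1 + sin (V J u w))) * indicator (B k) (X k w) - H K' w * indicator (B k) (X k w))" for w
        proof -
          have "iexp (V J u w) = of_real (cos (V J u w)) + \<i> * of_real (sin (V J u w))"
            by (simp add: exp_Euler cos_of_real sin_of_real)
          moreover have "H (insert k K') w = H K' w * indicator (B k) (X k w)"
            using insert.hyps by (simp add: H_def mult.commute)
          ultimately show ?thesis by (simp add: algebra_simps)
        qed
        then show ?thesis by (simp only: lin_real[OF iC iS i0])
      qed
      show "(CLINT w|M1. H (insert k K') w * iexp (V J u w)) = (CLINT w|M2. H (insert k K') w * iexp (V J u w))"
        using F[of M1] F[of M2] R0 RC RS by simp
    qed
  qed
  \<comment> \<open>With all of \<open>K\<close> treated and \<open>J\<close> empty, no exponential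
    is left.\<close>
  from main[OF order_refl, rule_format, of "{}" undefined]
  have "(CLINT w|M1. complex_of_real (H K w)) = (CLINT w|M2. complex_of_real (H K w))"
    by (simp add: V_def)
  then show ?thesis by (simp add: H_def del: of_real_prod)
qed

section \<open>Identification of compound Poisson laws\<close>

context jump_law
begin

text \<open>Disintegration over the number of jumps, carried out separately for real and imaginary
  parts.\<close>

lemma integral_poisson_law:
  fixes f :: "(real \<Rightarrow> real) \<Rightarrow> complex"
  assumes f[measurable]: "f \<in> borel_measurable pure_jump_space" and b: "\<And>w. norm (f w) \<le> 1"
  shows "(CLINT w|poisson_law. f w) = (\<integral>k. (CLINT w|n_jumps_law k. f w) \<partial>measure_pmf (poisson_pmf l))"
proof -
  have int: "integrable M f" if "prob_space M" "sets M = sets pure_jump_space" for M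
  proof -
    interpret M: prob_space M by fact
    have "f \<in> borel_measurable M" using f measurable_cong_sets[OF that(2) refl] by blast
    then show ?thesis using b by (intro M.integrable_const_bound[of _ 1]) auto
  qed
  have N: "AE k in measure_pmf (poisson_pmf l). emeasure (n_jumps_law k) (space (n_jumps_law k)) \<le> ennreal 1"
    using prob_space.emeasure_space_1[OF prob_space_n_jumps_law] by (intro AE_I2) (simp del: space_n_jumps_law)
  have c: "integrable (measure_pmf (poisson_pmf l)) (\<lambda>k. CLINT w|n_jumps_law k. f w)"
  proof (rule measure_pmf.integrable_const_bound[of _ 1])
    have "norm (CLINT w|n_jumps_law k. f w) \<le> 1" for k
    proof -
      interpret K: prob_space "n_jumps_law k" by (rule prob_space_n_jumps_law)
      have "norm (CLINT w|n_jumps_law k. f w) \<le> (LINT w|n_jumps_law k. norm (f w))" by simp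
      also have "\<dots> \<le> (LINT w|n_jumps_law k. 1)"
        using int[OF prob_space_n_jumps_law] b by (intro integral_mono) auto
      finally show ?thesis using K.prob_space by (simp del: space_n_jumps_law)
    qed
    then show "AE k in measure_pmf (poisson_pmf l). norm (CLINT w|n_jumps_law k. f w) \<le> 1" by simp
  qed simp
  have "(LINT w|poisson_law. Re (f w)) = (\<integral>k. (LINT w|n_jumps_law k. Re (f w)) \<partial>measure_pmf (poisson_pmf l))"
    unfolding poisson_law_def
    by (rule integral_bind[OF _ _ n_jumps_law_kernel _ N, where B=1])
       (use order_trans[OF abs_Re_le_cmod b] in \<open>auto intro: measure_pmf.finite_measure_axioms\<close>)
  moreover have "(LINT w|poisson_law. Im (f w)) = (\<integral>k. (LINT w|n_jumps_law k. Im (f w)) \<partial>measure_pmf (poisson_pmf l))"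
    unfolding poisson_law_def
    by (rule integral_bind[OF _ _ n_jumps_law_kernel _ N, where B=1])
       (use order_trans[OF abs_Im_le_cmod b] in \<open>auto intro: measure_pmf.finite_measure_axioms\<close>)
  ultimately show ?thesis
    using int[OF prob_space_poisson_law] int[OF prob_space_n_jumps_law] c
    by (intro complex_eqI) (simp_all flip: integral_Re integral_Im)
qed

text \<open>The probability generating function of the Poisson distribution: an exponential series
  times \<open>exp (- l)\<close>. The bound on \<open>z\<close> makes the powers integrable.\<close>

lemma integral_pmf_poisson_power:
  fixes z :: complex
  assumes "norm z \<le> 1"
  shows "(\<integral>k. z ^ k \<partial>measure_pmf (poisson_pmf l)) = exp (l * (z - 1))"
proof -
  let ?p = "pmf (poisson_pmf l)"
  have int: "integrable (measure_pmf (poisson_pmf l)) (\<lambda>k. z ^ k)"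
    using assms by (intro measure_pmf.integrable_const_bound[of _ 1]) (auto simp: norm_power power_le_one)
  have "integrable (count_space UNIV) (\<lambda>k. ?p k *\<^sub>R z ^ k)"
    using int unfolding measure_pmf_eq_density by (subst (asm) integrable_density) auto
  from sums_integral_count_space_nat[OF this]
  have "(\<lambda>k. ?p k *\<^sub>R z ^ k) sums (\<integral>k. z ^ k \<partial>measure_pmf (poisson_pmf l))"
    unfolding measure_pmf_eq_density by (subst integral_density) auto
  moreover have "(\<lambda>k. ?p k *\<^sub>R z ^ k) sums (exp (l * z) * exp (- l))"
  proof -
    have "(\<lambda>k. (of_real l * z) ^ k /\<^sub>R fact k * exp (- of_real l)) sums (exp (of_real l * z) * exp (- of_real l))"
      by (intro sums_mult2 exp_converges)
    also have "(\<lambda>k. (of_real l * z) ^ k /\<^sub>R fact k * exp (- of_real l)) = (\<lambda>k. ?p k *\<^sub>R z ^ k)"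
      using rate_pos by (auto simp: fun_eq_iff scaleR_conv_of_real power_mult_distrib exp_of_real[symmetric] divide_inverse)
    finally show ?thesis by (simp add: exp_of_real[of "- l", symmetric])
  qed
  ultimately have "(\<integral>k. z ^ k \<partial>measure_pmf (poisson_pmf l)) = exp (l * z) * exp (- l)"
    by (rule sums_unique2)
  also have "\<dots> = exp (l * z) * exp (of_real (- l))" by (simp only: exp_of_real)
  also have "\<dots> = exp (l * (z - 1))"
    unfolding exp_add[symmetric] by (simp add: algebra_simps)
  finally show ?thesis .
qed

text \<open>If each added mark multiplies \<open>f\<close> by \<open>g\<close>, then
  \<open>k\<close> jumps contribute the \<open>k\<close>-th power of the mean of \<open>g\<close>,
  and the Poisson generating function sums these powers to the compound Poisson exponential.\<close>

lemma integral_multiplicative: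
  fixes f :: "(real \<Rightarrow> real) \<Rightarrow> complex"
  assumes f[measurable]: "f \<in> borel_measurable pure_jump_space" and fb: "\<And>w. norm (f w) \<le> 1"
    and g[measurable]: "g \<in> borel_measurable (borel \<Otimes>\<^sub>M borel)" and gb: "\<And>p. norm (g p) \<le> 1"
    and f0: "f zero_path = 1" and fg: "\<And>w p. f (add_jump w p) = f w * g p"
  shows "(CLINT w|poisson_law. f w) = exp (l * ((CLINT p|m. g p) - 1))"
proof -
  have k: "(CLINT w|n_jumps_law k. f w) = (CLINT p|m. g p) ^ k" for k
  proof (induction k)
    case 0
    then show ?case by (simp add: integral_return zero_path(1) f0)
  next
    case (Suc k)
    interpret K: prob_space "n_jumps_law k" by (rule prob_space_n_jumps_law)
    interpret P: pair_prob_space "n_jumps_law k" m ..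
    have int: "integrable (n_jumps_law k \<Otimes>\<^sub>M m) (\<lambda>x. f (fst x) * g (snd x))"
      using fb gb by (intro P.integrable_const_bound[of _ 1]) (auto simp: norm_mult mult_le_one)
    have "(CLINT w|n_jumps_law (Suc k). f w) = (CLINT x|n_jumps_law k \<Otimes>\<^sub>M m. f (fst x) * g (snd x))"
      by (simp add: integral_distr split_beta fg)
    also have "\<dots> = (CLINT w|n_jumps_law k. CLINT p|m. f w * g p)"
      using P.integral_fst'[OF int] by simp
    also have "\<dots> = (CLINT p|m. g p) * (CLINT w|n_jumps_law k. f w)" by simp
    finally show ?case using Suc by simp
  qed
  have "norm (CLINT p|m. g p) \<le> 1"
  proof -
    have int: "integrable m g" using gb by (intro integrable_const_bound[of _ 1]) auto
    have "norm (CLINT p|m. g p) \<le> (LINT p|m. norm (g p))" by simp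
    also have "\<dots> \<le> (LINT p|m. 1)"
      using int gb by (intro integral_mono) auto
    finally show ?thesis using prob_space by simp
  qed
  from integral_pmf_poisson_power[OF this] show ?thesis
    by (simp only: integral_poisson_law[OF f fb] k)
qed

lemma AE_poisson_law_start: "AE w in poisson_law. w 0 = 0"
proof -
  have [measurable]: "(\<lambda>w. w 0) \<in> borel_measurable pure_jump_space"
    by (rule measurable_path_space_eval[OF measurable_pure_jump_path]) auto
  have "AE w in n_jumps_law k. w 0 = 0" for k
  proof (induction k)
    case 0
    have "Measurable.pred pure_jump_space (\<lambda>w. w 0 = 0)" by measurable
    then have "AE w in return pure_jump_space zero_path. w 0 = 0"
      by (subst AE_return[OF zero_path(1)]) (simp_all add: zero_path_def)
    then show ?case by (simp only: n_jumps_law.simps)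
  next
    case (Suc k)
    interpret K: prob_space "n_jumps_law k" by (rule prob_space_n_jumps_law)
    interpret P: pair_prob_space "n_jumps_law k" m ..
    have "AE x in n_jumps_law k \<Otimes>\<^sub>M m. add_jump (fst x) (snd x) 0 = 0"
    proof (rule P.AE_pair_measure)
      have [measurable]: "(\<lambda>x. add_jump (fst x) (snd x) 0) \<in> borel_measurable (pure_jump_space \<Otimes>\<^sub>M borel \<Otimes>\<^sub>M borel)"
        by (rule measurable_path_space_eval[OF measurable_pure_jump_path]) auto
      show "{x \<in> space (n_jumps_law k \<Otimes>\<^sub>M m). add_jump (fst x) (snd x) 0 = 0} \<in> sets (n_jumps_law k \<Otimes>\<^sub>M m)"
        by measurable
      show "AE w in n_jumps_law k. AE p in m. add_jump (fst (w, p)) (snd (w, p)) 0 = 0"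
        using Suc.IH
      proof eventually_elim
        case (elim w)
        show ?case using AE_jump
        proof eventually_elim
          case (elim p)
          then show ?case using \<open>w 0 = 0\<close> by (simp add: add_jump_apply)
        qed
      qed
    qed
    then show ?case unfolding n_jumps_law.simps by (subst AE_distr_iff) (auto simp: split_beta)
  qed
  then show ?thesis
    unfolding poisson_law_def by (subst AE_bind[OF n_jumps_law_kernel]) auto
qed

end

text \<open>Abel summation: with 0 added and the times sorted, each value is the telescoping sum of
  the increments before it, so the increment following \<open>\<tau> i\<close> collects the
  coefficients of all later times. Joint characteristic functions of values thereby become those of
  increments.\<close>

lemma sum_eq_increments:
  fixes J :: "real set" and u :: "real \<Rightarrow> real"
  assumes J: "finite J" "J \<subseteq> {0..1}"
  shows "\<exists>(n::nat) \<tau> v. \<tau> \<in> {..n} \<rightarrow> {0..1} \<and> mono_on {..n} \<tau> \<and>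
    (\<forall>w. w 0 = 0 \<longrightarrow> (\<Sum>j\<in>J. u j * w j) = (\<Sum>i<n. v i * (w (\<tau> (Suc i)) - w (\<tau> i))))"
proof -
  define T where "T = sorted_list_of_set (insert 0 J)"
  define n where "n = length T - 1"
  define \<tau> where "\<tau> = (!) T"
  \<comment> \<open>The added time 0 gets coefficient 0 unless it already belongs to
    \<open>J\<close>.\<close>
  define u' where "u' j = (if j \<in> J then u j else 0)" for j
  define v where "v i = (\<Sum>k\<le>n. if i < k then u' (\<tau> k) else 0)" for i
  have T: "sorted T" "distinct T" "set T = insert 0 J" using J(1) by (simp_all add: T_def del: sorted_list_of_set_insert_remove)
  then have ne: "T \<noteq> []" by auto
  then have len: "{..<length T} = {..n}" by (auto simp: n_def neq_Nil_conv)
  have bij: "bij_betw \<tau> {..n} (insert 0 J)" unfolding \<tau>_def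
    by (rule bij_betw_nth[OF T(2)]) (use len T in auto)
  have mono: "mono_on {..n} \<tau>"
    unfolding \<tau>_def by (rule mono_onI) (use len T(1) sorted_nth_mono in \<open>metis lessThan_iff\<close>)
  have in01: "\<tau> \<in> {..n} \<rightarrow> {0..1}"
  proof
    fix i assume "i \<in> {..n}"
    then have "\<tau> i \<in> insert 0 J" using bij_betwE[OF bij] by blast
    then show "\<tau> i \<in> {0..1}" using J(2) by auto
  qed
  have \<tau>0: "\<tau> 0 = 0"
  proof -
    have "0 \<in> \<tau> ` {..n}" using bij_betw_imp_surj_on[OF bij] by simp
    then obtain k where k: "k \<le> n" "\<tau> k = 0" by auto
    then have "\<tau> 0 \<le> 0" using mono_onD[OF mono, of 0 k] by auto
    with in01 show ?thesis by force
  qed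
  have "(\<Sum>j\<in>J. u j * w j) = (\<Sum>i<n. v i * (w (\<tau> (Suc i)) - w (\<tau> i)))" if "w 0 = 0" for w :: "real \<Rightarrow> real"
  proof -
    let ?D = "\<lambda>i. w (\<tau> (Suc i)) - w (\<tau> i)"
    have "(\<Sum>j\<in>J. u j * w j) = (\<Sum>j\<in>insert 0 J. u' j * w j)"
      using J(1) that by (intro sum.mono_neutral_cong_left) (auto simp: u'_def)
    also have "\<dots> = (\<Sum>k\<le>n. u' (\<tau> k) * w (\<tau> k))"
      by (rule sum.reindex_bij_betw[OF bij, symmetric])
    also have "\<dots> = (\<Sum>k\<le>n. \<Sum>i<n. (if i < k then u' (\<tau> k) else 0) * ?D i)"
    proof (rule sum.cong[OF refl])
      fix k assume k: "k \<in> {..n}"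
      have "w (\<tau> k) = (\<Sum>i<k. ?D i)"
        using sum_lessThan_telescope[of "\<lambda>i. w (\<tau> i)" k] \<tau>0 that by simp
      also have "u' (\<tau> k) * \<dots> = (\<Sum>i<k. u' (\<tau> k) * ?D i)" by (rule sum_distrib_left)
      also have "\<dots> = (\<Sum>i<n. (if i < k then u' (\<tau> k) else 0) * ?D i)"
        using k by (intro sum.mono_neutral_cong_left) auto
      finally show "u' (\<tau> k) * w (\<tau> k) = (\<Sum>i<n. (if i < k then u' (\<tau> k) else 0) * ?D i)" .
    qed
    also have "\<dots> = (\<Sum>i<n. v i * ?D i)"
      by (subst sum.swap) (simp only: v_def sum_distrib_right)
    finally show ?thesis .
  qed
  with in01 mono show ?thesis by blast
qed

text \<open>The half-open intervals are disjoint, so at most one term of the exponent is nonzero.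
  Subtracting 1 makes the expression additive over the intervals, as in the Levy-Khintchine
  exponent.\<close>

lemma iexp_sum_indicator:
  fixes \<tau> :: "nat \<Rightarrow> real"
  assumes "mono_on {..n} \<tau>"
  shows "iexp (\<Sum>i<n. v i * (x * indicator {\<tau> i<..\<tau> (Suc i)} t)) - 1
    = (\<Sum>i<n. complex_of_real (indicator {\<tau> i<..\<tau> (Suc i)} t) * (iexp (v i * x) - 1))"
  using assms
proof (induction n)
  case (Suc n)
  have mono: "mono_on {..n} \<tau>" using Suc.prems by (rule monotone_on_subset) auto
  show ?case
  proof (cases "t \<in> {\<tau> n<..\<tau> (Suc n)}")
    case True
    have z: "indicator {\<tau> i<..\<tau> (Suc i)} t = (0::real)" if "i < n" for i
    proof -
      have "\<tau> (Suc i) \<le> \<tau> n" using mono_onD[OF mono, of "Suc i" n] that by auto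
      with True show ?thesis by (auto simp: indicator_def)
    qed
    then have "(\<Sum>i<n. v i * (x * indicator {\<tau> i<..\<tau> (Suc i)} t)) = 0"
      "(\<Sum>i<n. complex_of_real (indicator {\<tau> i<..\<tau> (Suc i)} t) * (iexp (v i * x) - 1)) = 0"
      by (auto intro!: sum.neutral)
    with True show ?thesis by simp
  next
    case False
    then show ?thesis using Suc.IH[OF mono] by simp
  qed
qed simp

text \<open>The density lives on the whole line and is fixed to be 0 at the origin, so that almost
  every size under the normalised density is nonzero; \<open>l\<close> is the total mass of the Levy
  measure.\<close>

locale levy_density =
  fixes n :: "real \<Rightarrow> real" and l :: real
  assumes n_meas[measurable]: "n \<in> borel_measurable borel" and n_nonneg: "\<And>x. 0 \<le> n x"
    and n_zero: "n 0 = 0"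
    and n_int: "(\<integral>\<^sup>+x. ennreal (n x) \<partial>lborel) = ennreal l" and l_pos: "l > 0"
begin

definition time_law :: "real measure" where
  "time_law = density lborel (\<lambda>t. ennreal (indicator {0..1} t))"

definition size_law :: "real measure" where
  "size_law = density lborel (\<lambda>x. ennreal (n x / l))"

definition mark_law :: "(real \<times> real) measure" where
  "mark_law = time_law \<Otimes>\<^sub>M size_law"

lemma sets_laws[measurable_cong, simp]: "sets time_law = sets borel" "sets size_law = sets borel"
  by (simp_all add: time_law_def size_law_def)

sublocale T: prob_space time_law
  by standard (simp add: time_law_def emeasure_density ennreal_indicator)

sublocale S: prob_space size_law
proof
  have "(\<integral>\<^sup>+x. ennreal (n x / l) \<partial>lborel) = (\<integral>\<^sup>+x. ennreal (n x) * ennreal (1 / l) \<partial>lborel)"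
    using l_pos n_nonneg by (intro nn_integral_cong) (simp add: ennreal_mult[symmetric])
  also have "\<dots> = ennreal l * ennreal (1 / l)" by (subst nn_integral_multc) (auto simp: n_int)
  also have "\<dots> = 1" using l_pos by (simp add: ennreal_mult[symmetric])
  finally show "emeasure size_law (space size_law) = 1"
    by (simp add: size_law_def emeasure_density)
qed

sublocale TS: pair_prob_space time_law size_law ..

lemma AE_time_law: "AE t in time_law. t \<in> {0<..1} \<and> t \<noteq> s"
proof -
  have "AE t in lborel. t \<noteq> (0::real) \<and> t \<noteq> s"
    using AE_lborel_singleton[of 0] AE_lborel_singleton[of s] by eventually_elim simp
  then have "AE t in lborel. 0 < ennreal (indicator {0..1} t) \<longrightarrow> t \<in> {0<..1} \<and> t \<noteq> s"
    by eventually_elim (auto simp: indicator_def)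
  then show ?thesis unfolding time_law_def by (subst AE_density) simp_all
qed

lemma AE_size_law: "AE x in size_law. x \<noteq> 0"
  unfolding size_law_def by (subst AE_density) (auto simp: n_zero intro!: AE_I2)

sublocale jump_law mark_law l
proof (rule jump_law.intro[OF _ jump_law_axioms.intro])
  show "prob_space mark_law" unfolding mark_law_def by (rule TS.prob_space_axioms)
  show s: "sets mark_law = sets (borel \<Otimes>\<^sub>M borel)"
    unfolding mark_law_def by (rule sets_pair_measure_cong) simp_all
  show "0 < l" by (rule l_pos)
  show "AE p in mark_law. fst p \<in> {0<..1} \<and> snd p \<noteq> 0"
    unfolding mark_law_def
  proof (rule TS.AE_pair_measure)
    show "AE t in time_law. AE x in size_law. fst (t, x) \<in> {0<..1} \<and> snd (t, x) \<noteq> 0"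
      using AE_time_law[of 0] by eventually_elim (use AE_size_law in auto)
  qed measurable
  show "AE p in mark_law. fst p \<noteq> t" for t
    unfolding mark_law_def
  proof (rule TS.AE_pair_measure)
    show "AE s in time_law. AE x in size_law. fst (s, x) \<noteq> t"
      using AE_time_law[of t] by eventually_elim auto
  qed measurable
qed

text \<open>The rate \<open>l\<close> cancels the normalisation of \<open>size_law\<close>, leaving
  the intensity \<open>n x\<close> with respect to Lebesgue measure.\<close>

lemma nn_integral_mark_law:
  assumes [measurable]: "f \<in> borel_measurable (borel \<Otimes>\<^sub>M borel)"
  shows "ennreal l * (\<integral>\<^sup>+p. f p \<partial>mark_law) = (\<integral>\<^sup>+t. indicator {0..1} t * (\<integral>\<^sup>+x. ennreal (n x) * f (t, x) \<partial>lborel) \<partial>lborel)"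
proof -
  have "(\<integral>\<^sup>+p. f p \<partial>mark_law) = (\<integral>\<^sup>+t. \<integral>\<^sup>+x. f (t, x) \<partial>size_law \<partial>time_law)"
    unfolding mark_law_def by (subst S.nn_integral_fst[symmetric]) auto
  also have "\<dots> = (\<integral>\<^sup>+t. indicator {0..1} t * (\<integral>\<^sup>+x. ennreal (n x / l) * f (t, x) \<partial>lborel) \<partial>lborel)"
    unfolding time_law_def size_law_def
    by (simp add: nn_integral_density ennreal_indicator)
  also have "ennreal l * \<dots> = (\<integral>\<^sup>+t. ennreal l * (indicator {0..1} t * (\<integral>\<^sup>+x. ennreal (n x / l) * f (t, x) \<partial>lborel)) \<partial>lborel)"
    by (rule nn_integral_cmult[symmetric]) measurable
  also have "\<dots> = (\<integral>\<^sup>+t. indicator {0..1} t * (\<integral>\<^sup>+x. ennreal l * (ennreal (n x / l) * f (t, x)) \<partial>lborel) \<partial>lborel)"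
    by (subst nn_integral_cmult) (auto simp: mult.left_commute)
  also have "\<dots> = (\<integral>\<^sup>+t. indicator {0..1} t * (\<integral>\<^sup>+x. ennreal (n x) * f (t, x) \<partial>lborel) \<partial>lborel)"
    using l_pos n_nonneg by (simp add: mult.assoc[symmetric] ennreal_mult[symmetric])
  finally show ?thesis .
qed

text \<open>A mark falls into at most one of the disjoint intervals, hence the mean of
  \<open>g - 1\<close> is a sum over intervals, and its exponential is the product that independent
  stationary increments demand.\<close>

lemma poisson_law_increments:
  fixes k :: nat
  assumes \<tau>: "\<tau> \<in> {..k} \<rightarrow> {0..1}" "mono_on {..k} \<tau>"
  shows "(CLINT w|poisson_law. iexp (\<Sum>i<k. v i * (w (\<tau> (Suc i)) - w (\<tau> i))))
    = (\<Prod>i<k. exp (of_real (\<tau> (Suc i) - \<tau> i) * (l * (CLINT x|size_law. iexp (v i * x) - 1))))"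
proof -
  define f where "f w = iexp (\<Sum>i<k. v i * (w (\<tau> (Suc i)) - w (\<tau> i)))" for w
  define g where "g p = iexp (\<Sum>i<k. v i * (snd p * indicator {\<tau> i<..\<tau> (Suc i)} (fst p)))" for p
  have \<tau>01: "\<tau> i \<in> {0..1}" if "i \<le> k" for i using \<tau>(1) that by auto
  have \<tau>le: "\<tau> i \<le> \<tau> (Suc i)" if "i < k" for i using mono_onD[OF \<tau>(2), of i "Suc i"] that by auto
  have ev: "(\<lambda>w. w (\<tau> i)) \<in> borel_measurable pure_jump_space" if "i \<le> k" for i
    using \<tau>01[OF that] by (intro measurable_path_space_eval[OF measurable_pure_jump_path]) auto
  have f: "f \<in> borel_measurable pure_jump_space"
  proof -
    have "(\<lambda>w. \<Sum>i<k. v i * (w (\<tau> (Suc i)) - w (\<tau> i))) \<in> borel_measurable pure_jump_space"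
      by (intro borel_measurable_sum borel_measurable_times borel_measurable_diff borel_measurable_const ev) auto
    then show ?thesis unfolding f_def by measurable
  qed
  have g: "g \<in> borel_measurable (borel \<Otimes>\<^sub>M borel)" unfolding g_def by measurable
  have "(CLINT w|poisson_law. f w) = exp (l * ((CLINT p|mark_law. g p) - 1))"
  proof (rule integral_multiplicative[OF f _ g])
    show "norm (f w) \<le> 1" for w by (simp add: f_def)
    show "norm (g p) \<le> 1" for p by (simp add: g_def)
    show "f zero_path = 1"
    proof -
      have "(\<Sum>i<k. v i * (zero_path (\<tau> (Suc i)) - zero_path (\<tau> i))) = 0"
        using \<tau>01 by (intro sum.neutral) (auto simp: zero_path_def)
      then show ?thesis by (simp add: f_def)
    qed
    show "f (add_jump w p) = f w * g p" for w p
    proof -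
      have "add_jump w p (\<tau> (Suc i)) - add_jump w p (\<tau> i)
        = (w (\<tau> (Suc i)) - w (\<tau> i)) + snd p * indicator {\<tau> i<..\<tau> (Suc i)} (fst p)" if "i < k" for i
        using \<tau>01[of i] \<tau>01[of "Suc i"] \<tau>le[of i] that by (auto simp: add_jump_apply indicator_def)
      then have "(\<Sum>i<k. v i * (add_jump w p (\<tau> (Suc i)) - add_jump w p (\<tau> i)))
        = (\<Sum>i<k. v i * (w (\<tau> (Suc i)) - w (\<tau> i))) + (\<Sum>i<k. v i * (snd p * indicator {\<tau> i<..\<tau> (Suc i)} (fst p)))"
        unfolding sum.distrib[symmetric] by (intro sum.cong) (auto simp: distrib_left)
      then show ?thesis unfolding f_def g_def by (simp only: of_real_add distrib_left exp_add)
    qed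
  qed
  also have "(CLINT p|mark_law. g p) - 1 = (\<Sum>i<k. of_real (\<tau> (Suc i) - \<tau> i) * (CLINT x|size_law. iexp (v i * x) - 1))"
  proof -
    let ?h = "\<lambda>i p. complex_of_real (indicator {\<tau> i<..\<tau> (Suc i)} (fst p)) * (iexp (v i * snd p) - 1)"
    have bound: "norm (iexp y - 1) \<le> 2" for y
      using norm_triangle_ineq4[of "iexp y" 1] by simp
    have int: "integrable mark_law (?h i)" for i
    proof (rule integrable_const_bound[of _ 2])
      have "norm (?h i p) \<le> 2" for p
        using bound[of "v i * snd p"] by (cases "fst p \<in> {\<tau> i<..\<tau> (Suc i)}") (simp_all add: norm_mult)
      then show "AE p in mark_law. norm (?h i p) \<le> 2" by (intro AE_I2)
    qed measurable
    have intg: "integrable mark_law g"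
    proof (rule integrable_const_bound[of _ 1])
      show "g \<in> borel_measurable mark_law" using g measurable_cong_sets[OF sets_m refl] by blast
    qed (simp add: g_def)
    have "(CLINT p|mark_law. g p) - 1 = (CLINT p|mark_law. g p - 1)"
      using intg by (simp add: prob_space del: space_m)
    also have "\<dots> = (CLINT p|mark_law. (\<Sum>i<k. ?h i p))"
      unfolding g_def iexp_sum_indicator[OF \<tau>(2)] ..
    also have "\<dots> = (\<Sum>i<k. CLINT p|mark_law. ?h i p)"
      by (rule Bochner_Integration.integral_sum) (rule int)
    also have "\<dots> = (\<Sum>i<k. of_real (\<tau> (Suc i) - \<tau> i) * (CLINT x|size_law. iexp (v i * x) - 1))"
    proof (rule sum.cong[OF refl])
      fix i assume "i \<in> {..<k}"
      then have i: "i < k" by simp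
      \<comment> \<open>Time and size of a mark are independent; the time factor produces the
        interval length.\<close>
      have "(CLINT p|mark_law. ?h i p) = (CLINT t|time_law. CLINT x|size_law. ?h i (t, x))"
        using TS.integral_fst'[OF int[of i, unfolded mark_law_def]] unfolding mark_law_def by simp
      also have "\<dots> = (CLINT t|time_law. complex_of_real (indicator {\<tau> i<..\<tau> (Suc i)} t)) * (CLINT x|size_law. iexp (v i * x) - 1)"
        by simp
      also have "(CLINT t|time_law. complex_of_real (indicator {\<tau> i<..\<tau> (Suc i)} t)) = of_real (\<tau> (Suc i) - \<tau> i)"
      proof -
        have "(LINT t|time_law. indicator {\<tau> i<..\<tau> (Suc i)} t) = (LINT t|lborel. indicator {0..1} t *\<^sub>R indicator {\<tau> i<..\<tau> (Suc i)} t :: real)"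
          unfolding time_law_def by (subst integral_density) auto
        also have "\<dots> = (LINT t|lborel. indicator {\<tau> i<..\<tau> (Suc i)} t)"
          using \<tau>01[of i] \<tau>01[of "Suc i"] i by (intro Bochner_Integration.integral_cong) (auto simp: indicator_def)
        also have "\<dots> = \<tau> (Suc i) - \<tau> i" using \<tau>le[OF i] by simp
        finally show ?thesis by simp
      qed
      finally show "(CLINT p|mark_law. ?h i p) = of_real (\<tau> (Suc i) - \<tau> i) * (CLINT x|size_law. iexp (v i * x) - 1)" .
    qed
    finally show ?thesis .
  qed
  finally show ?thesis
    unfolding f_def by (simp add: sum_distrib_left exp_sum mult.left_commute del: of_real_diff)
qed

end

section \<open>Finite-dimensional laws determine a law on path space\<close>

lemma emeasure_cylinder:
  assumes N: "prob_space N" "sets N = sets path_space"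
    and J: "finite J" "J \<subseteq> {0..1}" and A: "\<And>j. j \<in> J \<Longrightarrow> A j \<in> sets borel"
  shows "emeasure (distr N (\<Pi>\<^sub>M t\<in>{0..1}. borel) (\<lambda>w. w)) (prod_emb {0..1} (\<lambda>_. borel) J (Pi\<^sub>E J A))
    = ennreal (LINT w|N. (\<Prod>j\<in>J. indicator (A j) (w j)))"
proof -
  interpret prob_space N by fact
  have id: "(\<lambda>w. w) \<in> N \<rightarrow>\<^sub>M (\<Pi>\<^sub>M t\<in>{0..1}. borel)"
    unfolding measurable_cong_sets[OF N(2) refl] path_space_def by (rule measurable_restrict_space1) simp
  have sp: "space N = cadlag_paths" using sets_eq_imp_space_eq[OF N(2)] by (simp add: space_path_space)
  let ?C = "{w \<in> space N. \<forall>j\<in>J. w j \<in> A j}"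
  have emb: "prod_emb {0..1} (\<lambda>_. borel) J (Pi\<^sub>E J A) \<in> sets (\<Pi>\<^sub>M t\<in>{0..1}. borel)"
    using J A by (intro sets_PiM_I) auto
  have C: "(\<lambda>w. w) -` prod_emb {0..1} (\<lambda>_. borel) J (Pi\<^sub>E J A) \<inter> space N = ?C"
    using J(2) cadlag_extensional by (auto simp: prod_emb_def sp PiE_iff restrict_def extensional_def)
  have C_sets: "?C \<in> sets N" using measurable_sets[OF id emb] unfolding C .
  have "emeasure (distr N (\<Pi>\<^sub>M t\<in>{0..1}. borel) (\<lambda>w. w)) (prod_emb {0..1} (\<lambda>_. borel) J (Pi\<^sub>E J A)) = emeasure N ?C"
    by (subst emeasure_distr[OF id emb]) (simp only: C)
  also have "\<dots> = ennreal (LINT w|N. indicator ?C w)"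
    using C_sets by (simp add: emeasure_eq_measure)
  also have "(LINT w|N. indicator ?C w) = (LINT w|N. (\<Prod>j\<in>J. indicator (A j) (w j)) :: real)"
  proof (rule Bochner_Integration.integral_cong[OF refl])
    fix w assume w: "w \<in> space N"
    show "indicator ?C w = (\<Prod>j\<in>J. indicator (A j) (w j) :: real)"
    proof (cases "\<forall>j\<in>J. w j \<in> A j")
      case False
      then have "(\<Prod>j\<in>J. indicator (A j) (w j) :: real) = 0"
        using J(1) by (intro prod_zero) (auto simp: indicator_def)
      with False show ?thesis by auto
    qed (use w in simp)
  qed
  finally show ?thesis .
qed

text \<open>An event of \<open>path_space\<close> is the trace
  \<open>cadlag_paths \<inter> B\<close> of a product event and has the mass of \<open>B\<close>
  under the image in the full product. There cylinders decide equality, and their masses are fixed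
  by the joint characteristic functions.\<close>

lemma path_law_eqI:
  assumes P: "prob_space P" "sets P = sets path_space" and R: "prob_space R" "sets R = sets path_space"
    and eq: "\<And>J u. finite J \<Longrightarrow> J \<subseteq> {0..1} \<Longrightarrow>
      (CLINT w|P. iexp (\<Sum>j\<in>J. u j * w j)) = (CLINT w|R. iexp (\<Sum>j\<in>J. u j * w j))"
  shows "P = R"
proof -
  let ?D = "\<lambda>N. distr N (\<Pi>\<^sub>M t\<in>{0..1}. borel) (\<lambda>w. w) :: (real \<Rightarrow> real) measure"
  have id: "(\<lambda>w. w) \<in> N \<rightarrow>\<^sub>M (\<Pi>\<^sub>M t\<in>{0..1}. borel)" if "sets N = sets path_space" for N :: "(real \<Rightarrow> real) measure"
    unfolding measurable_cong_sets[OF that refl] path_space_def by (rule measurable_restrict_space1) simp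
  have coord: "(\<lambda>w. w j) \<in> borel_measurable N" if "j \<in> {0..1}" "sets N = sets path_space" for j :: real and N :: "(real \<Rightarrow> real) measure"
    unfolding measurable_cong_sets[OF that(2) refl] by (rule measurable_path_space_eval) (use that in auto)
  have "?D P = ?D R"
  proof (rule measure_eqI_PiM_infinite)
    fix A and J :: "real set" assume J: "finite J" "J \<subseteq> {0..1}" and A: "\<And>j. j \<in> J \<Longrightarrow> A j \<in> sets (borel :: real measure)"
    have "(LINT w|P. (\<Prod>j\<in>J. indicator (A j) (w j))) = (LINT w|R. (\<Prod>j\<in>J. indicator (A j) (w j)) :: real)"
      by (rule joint_char_unique[OF P(1) R(1), where X="\<lambda>j w. w j" and I="{0..1}"])
         (use coord P R eq J A in auto)
    then show "emeasure (?D P) (prod_emb {0..1} (\<lambda>_. borel) J (Pi\<^sub>E J A)) = emeasure (?D R) (prod_emb {0..1} (\<lambda>_. borel) J (Pi\<^sub>E J A))"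
      by (simp only: emeasure_cylinder[OF P J A] emeasure_cylinder[OF R J A])
  next
    interpret P: prob_space P by fact
    show "finite_measure (?D P)" by (rule P.finite_measure_distr[OF id[OF P(2)]])
  qed simp_all
  show ?thesis
  proof (rule measure_eqI)
    show "sets P = sets R" using P R by simp
    fix A assume "A \<in> sets P"
    then have "A \<in> sets path_space" using P by simp
    then obtain B where B: "B \<in> sets (\<Pi>\<^sub>M t\<in>{0..1}. borel)" "A = cadlag_paths \<inter> B"
      by (auto simp: path_space_def sets_restrict_space)
    have "emeasure N A = emeasure (?D N) B" if "sets N = sets path_space" for N
    proof -
      have "space N = cadlag_paths" using sets_eq_imp_space_eq[OF that] by (simp add: space_path_space)
      then show ?thesis using B by (simp add: emeasure_distr[OF id[OF that] B(1)] Int_commute)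
    qed
    with \<open>?D P = ?D R\<close> P R show "emeasure P A = emeasure R A" by simp
  qed
qed

context levy_density
begin

text \<open>Since \<open>w 0 = 0\<close> almost surely, every linear combination of path values is
  one of increments along sorted times, and for these independence and the prescribed exponent give
  the same product as in the mixture. The hypothesis on \<nu> says that \<nu> and \<open>l\<close>
  times \<open>size_law\<close> have the same Levy exponent.\<close>

theorem compound_poisson_law_unique:
  assumes P: "compound_poisson_law \<nu> P"
    and \<nu>: "\<And>v. (CLINT x|\<nu>. iexp (v * x) - 1) = l * (CLINT x|size_law. iexp (v * x) - 1)"
  shows "P = distr poisson_law path_space (\<lambda>w. w)"
proof (rule path_law_eqI)
  have id: "(\<lambda>w. w) \<in> poisson_law \<rightarrow>\<^sub>M path_space"
    by (rule measurable_pure_jump_path) (simp add: measurable_ident_sets)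
  show pP: "prob_space P" and sP: "sets P = sets path_space" using P by (auto simp: compound_poisson_law_def)
  show "prob_space (distr poisson_law path_space (\<lambda>w. w))" by (rule Q.prob_space_distr[OF id])
  show "sets (distr poisson_law path_space (\<lambda>w. w)) = sets path_space" by simp
  interpret P: prob_space P by (rule pP)
  have coord: "(\<lambda>w. w j) \<in> borel_measurable path_space" if "j \<in> {0..1}" for j :: real
    by (rule measurable_path_space_eval) (use that in auto)
  have coordP: "(\<lambda>w. w j) \<in> borel_measurable P" if "j \<in> {0..1}" for j :: real
    unfolding measurable_cong_sets[OF sP refl] by (rule coord[OF that])
  fix J :: "real set" and u :: "real \<Rightarrow> real" assume J: "finite J" "J \<subseteq> {0..1}"
  obtain k :: nat and \<tau> v where \<tau>: "\<tau> \<in> {..k} \<rightarrow> {0..1}" "mono_on {..k} \<tau>"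
    and eq: "\<And>w. w 0 = 0 \<Longrightarrow> (\<Sum>j\<in>J. u j * w j) = (\<Sum>i<k. v i * (w (\<tau> (Suc i)) - w (\<tau> i)))"
    using sum_eq_increments[OF J, of u] by auto
  have \<tau>01: "\<tau> i \<in> {0..1}" if "i \<le> k" for i using \<tau>(1) that by auto
  let ?X = "\<lambda>i w. w (\<tau> (Suc i)) - w (\<tau> i) :: real"
  have meas_sum: "(\<lambda>w. iexp (\<Sum>j\<in>J. u j * w j)) \<in> borel_measurable M"
    if "\<And>j. j \<in> {0..1} \<Longrightarrow> (\<lambda>w. w j) \<in> borel_measurable M" for M :: "(real \<Rightarrow> real) measure"
  proof -
    have "(\<lambda>w. \<Sum>j\<in>J. u j * w j) \<in> borel_measurable M"
      by (intro borel_measurable_sum borel_measurable_times borel_measurable_const that) (use J in auto)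
    then show ?thesis by measurable
  qed
  have meas_inc: "(\<lambda>w. iexp (\<Sum>i<k. v i * ?X i w)) \<in> borel_measurable M"
    if "\<And>j. j \<in> {0..1} \<Longrightarrow> (\<lambda>w. w j) \<in> borel_measurable M" for M :: "(real \<Rightarrow> real) measure"
  proof -
    have "(\<lambda>w. \<Sum>i<k. v i * ?X i w) \<in> borel_measurable M"
      by (intro borel_measurable_sum borel_measurable_times borel_measurable_diff borel_measurable_const that \<tau>01) auto
    then show ?thesis by measurable
  qed
  have "(CLINT w|P. iexp (\<Sum>j\<in>J. u j * w j)) = (CLINT w|P. iexp (\<Sum>i<k. v i * ?X i w))"
  proof (rule integral_cong_AE)
    have "AE w in P. w 0 = 0" using P by (simp add: compound_poisson_law_def)
    then show "AE w in P. iexp (\<Sum>j\<in>J. u j * w j) = iexp (\<Sum>i<k. v i * ?X i w)"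
      by eventually_elim (simp only: eq)
  qed (rule meas_sum[OF coordP] meas_inc[OF coordP], assumption)+
  also have "\<dots> = (CLINT w|P. (\<Prod>i<k. iexp (v i * ?X i w)))"
    by (simp add: exp_sum[symmetric] sum_distrib_left del: of_real_mult of_real_diff)
  also have "\<dots> = (\<Prod>i<k. CLINT w|P. iexp (v i * ?X i w))"
  proof (rule P.indep_vars_lebesgue_integral)
    have "P.indep_vars (\<lambda>_. borel) ?X {..<k}"
      using P \<tau> unfolding compound_poisson_law_def by blast
    then show "P.indep_vars (\<lambda>_. borel) (\<lambda>i w. iexp (v i * ?X i w)) {..<k}"
      by (rule P.indep_vars_compose2) measurable
    fix i assume i: "i \<in> {..<k}"
    have [measurable]: "?X i \<in> borel_measurable P"
      using i by (intro borel_measurable_diff coordP \<tau>01) auto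
    have "(\<lambda>w. iexp (v i * ?X i w)) \<in> borel_measurable P" by measurable
    then show "integrable P (\<lambda>w. iexp (v i * ?X i w))"
      by (rule P.integrable_const_bound[of _ 1, rotated]) simp
  qed simp
  also have "\<dots> = (\<Prod>i<k. exp (of_real (\<tau> (Suc i) - \<tau> i) * (l * (CLINT x|size_law. iexp (v i * x) - 1))))"
  proof (rule prod.cong[OF refl])
    fix i assume i: "i \<in> {..<k}"
    have X[measurable]: "?X i \<in> borel_measurable P"
      using i by (intro borel_measurable_diff coordP \<tau>01) auto
    have "\<tau> i \<le> \<tau> (Suc i)" using mono_onD[OF \<tau>(2), of i "Suc i"] i by auto
    moreover have "0 \<le> \<tau> i" "\<tau> (Suc i) \<le> 1" using \<tau>01[of i] \<tau>01[of "Suc i"] i by auto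
    ultimately have "char (distr P borel (?X i)) (v i)
        = exp (complex_of_real (\<tau> (Suc i) - \<tau> i) * (CLINT x|\<nu>. iexp (v i * x) - 1))"
      using P unfolding compound_poisson_law_def by blast
    moreover have "char (distr P borel (?X i)) (v i) = (CLINT w|P. iexp (v i * ?X i w))"
      unfolding char_def by (rule integral_distr[OF X]) measurable
    ultimately show "(CLINT w|P. iexp (v i * ?X i w)) = exp (of_real (\<tau> (Suc i) - \<tau> i) * (l * (CLINT x|size_law. iexp (v i * x) - 1)))"
      unfolding \<nu> by simp
  qed
  also have "\<dots> = (CLINT w|poisson_law. iexp (\<Sum>i<k. v i * ?X i w))"
    by (rule poisson_law_increments[OF \<tau>, symmetric])
  also have "\<dots> = (CLINT w|poisson_law. iexp (\<Sum>j\<in>J. u j * w j))"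
  proof (rule integral_cong_AE)
    show "AE w in poisson_law. iexp (\<Sum>i<k. v i * ?X i w) = iexp (\<Sum>j\<in>J. u j * w j)"
      using AE_poisson_law_start by eventually_elim (simp only: eq)
  qed (rule meas_sum[OF measurable_compose[OF id coord]] meas_inc[OF measurable_compose[OF id coord]], assumption)+
  also have "\<dots> = (CLINT w|distr poisson_law path_space (\<lambda>w. w). iexp (\<Sum>j\<in>J. u j * w j))"
    by (rule integral_distr[symmetric, OF id meas_sum[OF coord]])
  finally show "(CLINT w|P. iexp (\<Sum>j\<in>J. u j * w j)) = (CLINT w|distr poisson_law path_space (\<lambda>w. w). iexp (\<Sum>j\<in>J. u j * w j))" .
qed

end

section \<open>Jumps of periodic Ornstein--Uhlenbeck paths\<close>

lemma measurable_OU_map[measurable (raw)]: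
  assumes Y: "Y \<in> M \<rightarrow>\<^sub>M pure_jump_space"
  shows "(\<lambda>x. OU_map c (Y x)) \<in> M \<rightarrow>\<^sub>M path_space"
proof (rule measurable_path_spaceI[OF OU_map_cadlag])
  have pj: "pure_jump (Y x)" if "x \<in> space M" for x
    using measurable_space[OF Y that] by (simp add: space_pure_jump_space)
  have [measurable]: "(\<lambda>x. exp_integral c (Y x) t) \<in> borel_measurable M" for t
  proof -
    have "(\<lambda>(x, s, y). exp (c * s) * y * (if s \<le> t then 1 else 0)) \<in> borel_measurable (M \<Otimes>\<^sub>M borel \<Otimes>\<^sub>M (borel :: real measure))"
      by measurable
    from measurable_jump_sum[OF Y this]
    have "(\<lambda>x. \<Sum>s\<in>jump_times (Y x). exp (c * s) * jump (Y x) s * (if s \<le> t then 1 else 0)) \<in> borel_measurable M"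
      by simp
    also have "?this \<longleftrightarrow> ?thesis"
      by (rule measurable_cong) (auto simp: exp_integral_eq[OF pj] indicator_def intro!: sum.cong)
    finally show ?thesis .
  qed
  fix t :: real assume "t \<in> {0..1}"
  then show "(\<lambda>x. OU_map c (Y x) t) \<in> borel_measurable M"
    by (simp add: OU_map_def)
qed

lemma OU_map_not_pure_jump: "\<not> pure_jump w \<Longrightarrow> OU_map c w = zero_path"
  by (auto simp: OU_map_def exp_integral_def zero_path_def)

text \<open>\<open>P\<close> is a measure on all cadlag paths, so measurability is required there;
  off the pure jump paths the map is constantly the zero path.\<close>

lemma measurable_OU_map_path: "OU_map c \<in> path_space \<rightarrow>\<^sub>M path_space"
proof (rule measurable_piecewise_restrict[where C="{{w. pure_jump w}, {w. \<not> pure_jump w}}"])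
  have "Measurable.pred path_space pure_jump"
    using measurable_pure_jump[of "\<lambda>w. w" path_space] by simp
  then have "{w \<in> space path_space. pure_jump w} \<in> sets path_space" "{w \<in> space path_space. \<not> pure_jump w} \<in> sets path_space"
    by (auto simp: pred_def)
  then show "\<Omega> \<inter> space path_space \<in> sets path_space" if "\<Omega> \<in> {{w. pure_jump w}, {w. \<not> pure_jump w}}" for \<Omega>
    using that by (auto simp: Int_def conj_commute)
  fix \<Omega> assume "\<Omega> \<in> {{w. pure_jump w}, {w. \<not> pure_jump w}}"
  then consider "\<Omega> = {w. pure_jump w}" | "\<Omega> = {w. \<not> pure_jump w}" by auto
  then show "OU_map c \<in> restrict_space path_space \<Omega> \<rightarrow>\<^sub>M path_space"
  proof cases
    case 1
    then show ?thesis using measurable_OU_map[of "\<lambda>w. w" pure_jump_space c]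
      by (simp add: pure_jump_space_def[symmetric])
  next
    case 2
    have "(\<lambda>_. zero_path) \<in> restrict_space path_space \<Omega> \<rightarrow>\<^sub>M path_space"
      using zero_path(1) by (auto simp: space_path_space space_pure_jump_space)
    also have "?this \<longleftrightarrow> ?thesis"
      by (rule measurable_cong) (auto simp: 2 space_restrict_space OU_map_not_pure_jump)
    finally show ?thesis .
  qed
qed auto

lemma measurable_path_add:
  assumes X: "X \<in> M \<rightarrow>\<^sub>M path_space" and Y: "Y \<in> M \<rightarrow>\<^sub>M path_space"
  shows "(\<lambda>x. path_add (X x) (Y x)) \<in> M \<rightarrow>\<^sub>M path_space"
proof (rule measurable_path_spaceI)
  show "path_add (X x) (Y x) \<in> cadlag_paths" if "x \<in> space M" for x
    using measurable_space[OF X that] measurable_space[OF Y that]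
    by (intro path_add_cadlag(1)) (auto simp: space_path_space)
  fix t :: real assume t: "t \<in> {0..1}"
  note [measurable] = measurable_path_space_eval[OF X t] measurable_path_space_eval[OF Y t]
  show "(\<lambda>x. path_add (X x) (Y x) t) \<in> borel_measurable M"
    using t by (simp add: path_add_def)
qed

section \<open>The perturbation seen on driving paths\<close>

lemma add_jump_zero_path: "add_jump zero_path p = step_path p"
  by (rule ext) (simp add: add_jump_def path_add_def zero_path_def step_path_def)

lemma OU_shift_eq_add_jump:
  "OU_shift c \<gamma> \<gamma>1 \<gamma>2 Z = path_add Z (OU_map c
     (add_jump (add_jump (add_jump zero_path (fst \<gamma>, - snd \<gamma>)) \<gamma>1) \<gamma>2))"
  unfolding OU_shift_eq add_jump_zero_path by (simp add: add_jump_def)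

lemma measurable_OU_shift:
  assumes [measurable]: "g \<in> M \<rightarrow>\<^sub>M borel \<Otimes>\<^sub>M borel" "g1 \<in> M \<rightarrow>\<^sub>M borel \<Otimes>\<^sub>M borel" "g2 \<in> M \<rightarrow>\<^sub>M borel \<Otimes>\<^sub>M borel"
    and X: "X \<in> M \<rightarrow>\<^sub>M path_space"
  shows "(\<lambda>x. OU_shift c (g x) (g1 x) (g2 x) (X x)) \<in> M \<rightarrow>\<^sub>M path_space"
proof -
  note [measurable] = zero_path(1)
  show ?thesis unfolding OU_shift_eq_add_jump
    by (intro measurable_path_add X measurable_OU_map) measurable
qed

text \<open>By additivity, the removed step cancels the added jump \<gamma> before the map is
  applied. This holds for every pair \<gamma>, as suits the Mecke formula, where \<gamma> is an
  integration variable.\<close>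

lemma OU_shift_OU_map:
  assumes w: "w \<in> space pure_jump_space"
  shows "OU_shift c \<gamma> \<gamma>1 \<gamma>2 (OU_map c (add_jump w \<gamma>)) = OU_map c (add_jump (add_jump w \<gamma>1) \<gamma>2)"
proof -
  let ?v = "add_jump (add_jump (add_jump zero_path (fst \<gamma>, - snd \<gamma>)) \<gamma>1) \<gamma>2"
  have v: "?v \<in> space pure_jump_space" by (intro add_jump_space zero_path(1))
  have w': "add_jump w \<gamma> \<in> space pure_jump_space" by (rule add_jump_space[OF w])
  have "path_add (add_jump w \<gamma>) ?v = add_jump (add_jump w \<gamma>1) \<gamma>2"
    by (rule ext) (auto simp: add_jump_def path_add_def step_path_def zero_path_def)
  moreover have "OU_map c (path_add (add_jump w \<gamma>) ?v) = path_add (OU_map c (add_jump w \<gamma>)) (OU_map c ?v)"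
    using v w' by (intro OU_map_path_add) (auto simp: space_pure_jump_space)
  ultimately show ?thesis unfolding OU_shift_eq_add_jump by simp
qed

text \<open>The exponential weight turns periodic Ornstein--Uhlenbeck paths into pure jump paths with the
  same jump times, which makes their jumps measurable.\<close>

definition exp_weight :: "real \<Rightarrow> (real \<Rightarrow> real) \<Rightarrow> real \<Rightarrow> real" where
  "exp_weight c Z = (\<lambda>t\<in>{0..1}. exp (c * t) * Z t)"

text \<open>An event of full mass for the periodic law, described by the path alone without
  reference to the driving path. Sums over jumps are finite and measurable on it.\<close>

definition OU_paths :: "real \<Rightarrow> (real \<Rightarrow> real) measure" where
  "OU_paths c = restrict_space path_space {Z \<in> cadlag_paths. pure_jump (exp_weight c Z)}"

lemma exp_weight:
  assumes Z: "Z \<in> cadlag_paths"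
  shows exp_weight_cadlag: "exp_weight c Z \<in> cadlag_paths"
    and jump_exp_weight: "jump (exp_weight c Z) t = exp (c * t) * jump Z t"
proof -
  have l: "(exp_weight c Z \<longlongrightarrow> exp (c * t) * (Z t - jump Z t)) (at_left t)" if "t \<in> {0<..1}" for t
  proof (rule Lim_transform_eventually)
    show "((\<lambda>r. exp (c * r) * Z r) \<longlongrightarrow> exp (c * t) * (Z t - jump Z t)) (at_left t)"
      by (intro tendsto_intros cadlag_left Z that)
    show "\<forall>\<^sub>F r in at_left t. exp (c * r) * Z r = exp_weight c Z r"
      using eventually_at_left_unit[OF that] by eventually_elim (simp add: exp_weight_def)
  qed
  show "exp_weight c Z \<in> cadlag_paths"
  proof (rule cadlag_pathsI[OF _ _ l])
    fix t :: real assume t: "t \<in> {0..<1}"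
    show "(exp_weight c Z \<longlongrightarrow> exp_weight c Z t) (at_right t)"
    proof (rule Lim_transform_eventually)
      have "((\<lambda>r. exp (c * r) * Z r) \<longlongrightarrow> exp (c * t) * Z t) (at_right t)"
        by (intro tendsto_intros cadlag_right Z t)
      then show "((\<lambda>r. exp (c * r) * Z r) \<longlongrightarrow> exp_weight c Z t) (at_right t)"
        using t by (simp add: exp_weight_def)
      show "\<forall>\<^sub>F r in at_right t. exp (c * r) * Z r = exp_weight c Z r"
        using eventually_at_right_unit[OF t] by eventually_elim (simp add: exp_weight_def)
    qed
  qed (auto simp: exp_weight_def)
  show "jump (exp_weight c Z) t = exp (c * t) * jump Z t"
  proof (cases "t \<in> {0<..1}")
    case True
    then show ?thesis using jump_eqI[OF True l[OF True]]
      by (simp add: exp_weight_def right_diff_distrib)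
  qed (auto simp: jump_def)
qed

lemma jump_times_exp_weight: "Z \<in> cadlag_paths \<Longrightarrow> jump_times (exp_weight c Z) = jump_times Z"
  by (simp add: jump_times_def jump_exp_weight)

lemma measurable_exp_weight:
  assumes X: "X \<in> M \<rightarrow>\<^sub>M path_space"
  shows "(\<lambda>x. exp_weight c (X x)) \<in> M \<rightarrow>\<^sub>M path_space"
proof (rule measurable_path_spaceI)
  show "exp_weight c (X x) \<in> cadlag_paths" if "x \<in> space M" for x
    using measurable_space[OF X that] by (intro exp_weight_cadlag) (simp add: space_path_space)
  fix t :: real assume t: "t \<in> {0..1}"
  note [measurable] = measurable_path_space_eval[OF X t]
  show "(\<lambda>x. exp_weight c (X x) t) \<in> borel_measurable M"
    using t by (simp add: exp_weight_def)
qed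

lemma space_OU_paths: "space (OU_paths c) = {Z \<in> cadlag_paths. pure_jump (exp_weight c Z)}"
  by (auto simp: OU_paths_def space_restrict_space space_path_space)

lemma space_OU_paths_sets: "space (OU_paths c) \<in> sets path_space"
proof -
  have "Measurable.pred path_space (\<lambda>Z. pure_jump (exp_weight c Z))"
    by (intro measurable_pure_jump measurable_exp_weight measurable_ident_sets refl)
  then show ?thesis by (simp add: pred_def space_OU_paths space_path_space)
qed

lemma finite_jump_times_OU_paths: "Z \<in> space (OU_paths c) \<Longrightarrow> finite (jump_times Z)"
  using pure_jump_finite[of "exp_weight c Z"] by (simp add: space_OU_paths jump_times_exp_weight)

lemma OU_map_OU_paths:
  assumes w: "w \<in> space pure_jump_space"
  shows "OU_map c w \<in> space (OU_paths c)"
proof -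
  have pj: "pure_jump w" using w by (simp add: space_pure_jump_space)
  let ?s = "step_sum (jump_times w) (\<lambda>s. exp (c * s) * jump w s) (exp_integral c w 1 / (exp c - 1))"
  have "exp_weight c (OU_map c w) = ?s"
  proof (rule extensionalityI)
    fix t :: real assume "t \<in> {0..1}"
    then show "exp_weight c (OU_map c w) t = ?s t"
      using OU_map_weighted[OF pj, of c] by (simp add: exp_weight_def mult.assoc[symmetric] exp_add[symmetric])
  qed (auto simp: exp_weight_def step_sum_def)
  moreover have "pure_jump ?s"
    by (rule step_sum(3)[OF pure_jump_finite[OF pj] jump_times_subset])
  ultimately show ?thesis by (simp add: space_OU_paths OU_map_cadlag)
qed

text \<open>The jumps are those of the pure jump path \<open>exp_weight c (X x)\<close> rescaled by
  \<open>exp (- c * s)\<close>, so the result for pure jump paths applies.\<close>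

lemma measurable_jump_sum_OU:
  fixes g :: "'a \<times> real \<times> real \<Rightarrow> ennreal"
  assumes X: "X \<in> M \<rightarrow>\<^sub>M OU_paths c" and g[measurable]: "g \<in> borel_measurable (M \<Otimes>\<^sub>M borel \<Otimes>\<^sub>M borel)"
  shows "(\<lambda>x. \<Sum>s\<in>jump_times (X x). g (x, s, jump (X x) s)) \<in> borel_measurable M"
proof -
  have X': "X \<in> M \<rightarrow>\<^sub>M path_space" using X unfolding OU_paths_def by (simp add: measurable_restrict_space2_iff)
  have sp: "X x \<in> space (OU_paths c)" if "x \<in> space M" for x using measurable_space[OF X that] .
  have Y: "(\<lambda>x. exp_weight c (X x)) \<in> M \<rightarrow>\<^sub>M pure_jump_space"
    by (intro measurable_pure_jump_spaceI measurable_exp_weight X') (use sp in \<open>auto simp: space_OU_paths\<close>)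
  have "(\<lambda>(x, s, y). g (x, s, exp (- c * s) * y)) \<in> borel_measurable (M \<Otimes>\<^sub>M borel \<Otimes>\<^sub>M borel)"
    by measurable
  from measurable_jump_sum[OF Y this]
  have "(\<lambda>x. \<Sum>s\<in>jump_times (exp_weight c (X x)). g (x, s, exp (- c * s) * jump (exp_weight c (X x)) s)) \<in> borel_measurable M"
    by simp
  also have "?this \<longleftrightarrow> ?thesis"
    by (rule measurable_cong)
       (use sp in \<open>simp add: space_OU_paths jump_times_exp_weight jump_exp_weight mult.assoc[symmetric] exp_add[symmetric]\<close>)
  finally show ?thesis .
qed

text \<open>Excluding the time \<open>s\<close> is replaced by a zero summand. The inner sum is then
  a measurable function of path and mark, and the result for single sums can be applied
  twice.\<close>

lemma measurable_jump_sum2_OU: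
  fixes h :: "(real \<Rightarrow> real) \<times> (real \<times> real) \<times> (real \<times> real) \<Rightarrow> ennreal"
  assumes h[measurable]: "h \<in> borel_measurable (OU_paths c \<Otimes>\<^sub>M (borel \<Otimes>\<^sub>M borel) \<Otimes>\<^sub>M (borel \<Otimes>\<^sub>M borel))"
  shows "(\<lambda>Z. \<Sum>s\<in>jump_times Z. \<Sum>t\<in>jump_times Z - {s}. h (Z, (s, jump Z s), (t, jump Z t))) \<in> borel_measurable (OU_paths c)"
proof -
  have inner: "(\<lambda>x. \<Sum>t\<in>jump_times (fst x). if t = fst (snd x) then 0 else h (fst x, snd x, (t, jump (fst x) t)))
     \<in> borel_measurable (OU_paths c \<Otimes>\<^sub>M borel \<Otimes>\<^sub>M borel)"
  proof -
    have "(\<lambda>(x, q). if fst q = fst (snd x) then 0 else h (fst x, snd x, q))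
      \<in> borel_measurable ((OU_paths c \<Otimes>\<^sub>M borel \<Otimes>\<^sub>M borel) \<Otimes>\<^sub>M borel \<Otimes>\<^sub>M borel)"
      by measurable
    from measurable_jump_sum_OU[OF measurable_fst this] show ?thesis by simp
  qed
  have "(\<lambda>Z. \<Sum>s\<in>jump_times Z. \<Sum>t\<in>jump_times Z. if t = s then 0 else h (Z, (s, jump Z s), (t, jump Z t))) \<in> borel_measurable (OU_paths c)"
    using measurable_jump_sum_OU[OF measurable_ident_sets[OF refl] inner] by (simp only: fst_conv snd_conv)
  also have "?this \<longleftrightarrow> ?thesis"
    by (intro measurable_cong sum.cong refl sum.mono_neutral_cong_right)
       (auto simp: finite_jump_times_OU_paths split: if_splits)
  finally show ?thesis .
qed

text \<open>Tonelli, one transposition at a time: the two-jump side has the first added mark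
  outermost and the time \<open>t\<close> innermost, whereas the operator side has the removed mark
  \<open>(t, x)\<close> outermost.\<close>

lemma nn_integral_lborel_rotate:
  assumes [measurable]: "f \<in> borel_measurable (borel \<Otimes>\<^sub>M borel \<Otimes>\<^sub>M borel \<Otimes>\<^sub>M borel \<Otimes>\<^sub>M borel)"
  shows "(\<integral>\<^sup>+s1. \<integral>\<^sup>+x1. \<integral>\<^sup>+s2. \<integral>\<^sup>+x. \<integral>\<^sup>+t. f (t, x, s2, s1, x1) \<partial>lborel \<partial>lborel \<partial>lborel \<partial>lborel \<partial>lborel)
    = (\<integral>\<^sup>+t. \<integral>\<^sup>+x. \<integral>\<^sup>+s2. \<integral>\<^sup>+s1. \<integral>\<^sup>+x1. f (t, x, s2, s1, x1) \<partial>lborel \<partial>lborel \<partial>lborel \<partial>lborel \<partial>(lborel :: real measure))"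
    (is "?L = ?R")
proof -
  note F = lborel_pair.Fubini'
  have "?L = (\<integral>\<^sup>+s1. \<integral>\<^sup>+x1. \<integral>\<^sup>+s2. \<integral>\<^sup>+t. \<integral>\<^sup>+x. f (t, x, s2, s1, x1) \<partial>lborel \<partial>lborel \<partial>lborel \<partial>lborel \<partial>lborel)"
    by (rule nn_integral_cong, rule nn_integral_cong, rule nn_integral_cong, rule F) measurable
  also have "\<dots> = (\<integral>\<^sup>+s1. \<integral>\<^sup>+x1. \<integral>\<^sup>+t. \<integral>\<^sup>+s2. \<integral>\<^sup>+x. f (t, x, s2, s1, x1) \<partial>lborel \<partial>lborel \<partial>lborel \<partial>lborel \<partial>lborel)"
    by (rule nn_integral_cong, rule nn_integral_cong, rule F) measurable
  also have "\<dots> = (\<integral>\<^sup>+s1. \<integral>\<^sup>+t. \<integral>\<^sup>+x1. \<integral>\<^sup>+s2. \<integral>\<^sup>+x. f (t, x, s2, s1, x1) \<partial>lborel \<partial>lborel \<partial>lborel \<partial>lborel \<partial>lborel)"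
    by (rule nn_integral_cong, rule F) measurable
  also have "\<dots> = (\<integral>\<^sup>+t. \<integral>\<^sup>+s1. \<integral>\<^sup>+x1. \<integral>\<^sup>+s2. \<integral>\<^sup>+x. f (t, x, s2, s1, x1) \<partial>lborel \<partial>lborel \<partial>lborel \<partial>lborel \<partial>lborel)"
    by (rule F) measurable
  also have "\<dots> = (\<integral>\<^sup>+t. \<integral>\<^sup>+s1. \<integral>\<^sup>+x1. \<integral>\<^sup>+x. \<integral>\<^sup>+s2. f (t, x, s2, s1, x1) \<partial>lborel \<partial>lborel \<partial>lborel \<partial>lborel \<partial>lborel)"
    by (rule nn_integral_cong, rule nn_integral_cong, rule nn_integral_cong, rule F) measurable
  also have "\<dots> = (\<integral>\<^sup>+t. \<integral>\<^sup>+s1. \<integral>\<^sup>+x. \<integral>\<^sup>+x1. \<integral>\<^sup>+s2. f (t, x, s2, s1, x1) \<partial>lborel \<partial>lborel \<partial>lborel \<partial>lborel \<partial>lborel)"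
    by (rule nn_integral_cong, rule nn_integral_cong, rule F) measurable
  also have "\<dots> = (\<integral>\<^sup>+t. \<integral>\<^sup>+x. \<integral>\<^sup>+s1. \<integral>\<^sup>+x1. \<integral>\<^sup>+s2. f (t, x, s2, s1, x1) \<partial>lborel \<partial>lborel \<partial>lborel \<partial>lborel \<partial>lborel)"
    by (rule nn_integral_cong, rule F) measurable
  also have "\<dots> = (\<integral>\<^sup>+t. \<integral>\<^sup>+x. \<integral>\<^sup>+s1. \<integral>\<^sup>+s2. \<integral>\<^sup>+x1. f (t, x, s2, s1, x1) \<partial>lborel \<partial>lborel \<partial>lborel \<partial>lborel \<partial>lborel)"
    by (rule nn_integral_cong, rule nn_integral_cong, rule nn_integral_cong, rule F) measurable
  also have "\<dots> = ?R"
    by (rule nn_integral_cong, rule nn_integral_cong, rule F) measurable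
  finally show ?thesis .
qed

section \<open>Both sides as integrals over added jumps\<close>

definition is_mark :: "real \<times> real \<Rightarrow> bool" where
  "is_mark p \<longleftrightarrow> fst p \<in> {0..1} \<and> snd p \<noteq> 0"

lemma measurable_is_mark[measurable]: "Measurable.pred (borel \<Otimes>\<^sub>M borel) is_mark"
  unfolding is_mark_def[abs_def] by measurable

text \<open>\<open>F\<close> is constrained only on genuine marks; its continuation by 0 can be
  integrated over the full line, and restrictions of the domain become values 0 of the
  integrand.\<close>

lemma measurable_extend_marks:
  fixes F :: "(real \<times> real) \<times> (real \<times> real) \<times> (real \<times> real) \<times> (real \<Rightarrow> real) \<Rightarrow> ennreal"
  assumes F: "F \<in> borel_measurable (marks \<Otimes>\<^sub>M marks \<Otimes>\<^sub>M marks \<Otimes>\<^sub>M path_space)"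
  shows "(\<lambda>(g, g1, g2, Z). if is_mark g \<and> is_mark g1 \<and> is_mark g2 then F (g, g1, g2, Z) else 0)
    \<in> borel_measurable ((borel \<Otimes>\<^sub>M borel) \<Otimes>\<^sub>M (borel \<Otimes>\<^sub>M borel) \<Otimes>\<^sub>M (borel \<Otimes>\<^sub>M borel) \<Otimes>\<^sub>M path_space)"
proof -
  \<comment> \<open>Pairs that are no marks are sent to \<open>(0, 1)\<close>, an arbitrary mark, so
    that \<open>F\<close> is composed with a total measurable map before the case
    distinction.\<close>
  define r where "r p = (if is_mark p then p else (0, 1))" for p
  have [measurable]: "r \<in> borel \<Otimes>\<^sub>M borel \<rightarrow>\<^sub>M marks"
    unfolding marks_def
  proof (rule measurable_restrict_space2)
    show "r \<in> space (borel \<Otimes>\<^sub>M borel) \<rightarrow> {0..1} \<times> - {0}"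
      by (auto simp: r_def is_mark_def split: if_splits)
    have "r \<in> borel \<Otimes>\<^sub>M borel \<rightarrow>\<^sub>M borel \<Otimes>\<^sub>M borel" unfolding r_def[abs_def] by measurable
    then show "r \<in> borel \<Otimes>\<^sub>M borel \<rightarrow>\<^sub>M borel" by (simp add: borel_prod)
  qed
  note [measurable] = F
  have "(\<lambda>(g, g1, g2, Z). if is_mark g \<and> is_mark g1 \<and> is_mark g2 then F (r g, r g1, r g2, Z) else 0)
    \<in> borel_measurable ((borel \<Otimes>\<^sub>M borel) \<Otimes>\<^sub>M (borel \<Otimes>\<^sub>M borel) \<Otimes>\<^sub>M (borel \<Otimes>\<^sub>M borel) \<Otimes>\<^sub>M path_space)"
    by measurable
  then show ?thesis
    by (rule measurable_cong[THEN iffD1, rotated]) (auto simp: r_def)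
qed

lemma nn_integral_jump_measure:
  assumes "g \<in> borel_measurable marks"
  shows "(\<integral>\<^sup>+\<gamma>. g \<gamma> \<partial>jump_measure Z) = (\<integral>\<^sup>+t. g (t, jump Z t) \<partial>count_space (jump_times Z))"
  unfolding jump_measure_def
  by (rule nn_integral_distr) (auto simp: assms, auto simp: marks_def space_restrict_space jump_times_def)

lemma nn_integral_lborel_cmult2:
  assumes [measurable]: "g \<in> borel_measurable (borel \<Otimes>\<^sub>M borel)"
  shows "c * (\<integral>\<^sup>+x. \<integral>\<^sup>+y. g (x, y) \<partial>lborel \<partial>lborel) = (\<integral>\<^sup>+x. \<integral>\<^sup>+y. c * g (x, y) \<partial>lborel \<partial>lborel)"
  by (rule trans[OF nn_integral_cmult[symmetric]], measurable, rule nn_integral_cong,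
      rule nn_integral_cmult[symmetric], measurable)

lemma nn_integral_lborel_cmult3:
  assumes [measurable]: "g \<in> borel_measurable (borel \<Otimes>\<^sub>M borel \<Otimes>\<^sub>M borel)"
  shows "c * (\<integral>\<^sup>+x. \<integral>\<^sup>+y. \<integral>\<^sup>+z. g (x, y, z) \<partial>lborel \<partial>lborel \<partial>lborel)
    = (\<integral>\<^sup>+x. \<integral>\<^sup>+y. \<integral>\<^sup>+z. c * g (x, y, z) \<partial>lborel \<partial>lborel \<partial>lborel)"
  by (rule trans[OF nn_integral_cmult[symmetric]], measurable, rule nn_integral_cong,
      rule nn_integral_lborel_cmult2, measurable)

lemma nn_integral_lborel_cmult4:
  assumes [measurable]: "g \<in> borel_measurable (borel \<Otimes>\<^sub>M borel \<Otimes>\<^sub>M borel \<Otimes>\<^sub>M borel)"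
  shows "c * (\<integral>\<^sup>+x. \<integral>\<^sup>+y. \<integral>\<^sup>+z. \<integral>\<^sup>+t. g (x, y, z, t) \<partial>lborel \<partial>lborel \<partial>lborel \<partial>lborel)
    = (\<integral>\<^sup>+x. \<integral>\<^sup>+y. \<integral>\<^sup>+z. \<integral>\<^sup>+t. c * g (x, y, z, t) \<partial>lborel \<partial>lborel \<partial>lborel \<partial>lborel)"
  by (rule trans[OF nn_integral_cmult[symmetric]], measurable, rule nn_integral_cong,
      rule nn_integral_lborel_cmult3, measurable)

text \<open>Gathers the nested weights of the two-jump formula under the innermost integral, where
  they can be compared pointwise with \<open>chi\<close>.\<close>

lemma nn_integral_lborel_weights:
  fixes a b d :: "real \<Rightarrow> ennreal"
  assumes k[measurable]: "k \<in> borel_measurable (borel \<Otimes>\<^sub>M borel \<Otimes>\<^sub>M borel \<Otimes>\<^sub>M borel)"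
    and [measurable]: "a \<in> borel_measurable borel" "b \<in> borel_measurable borel" "d \<in> borel_measurable borel"
  shows "c * (\<integral>\<^sup>+x. a x * (\<integral>\<^sup>+y. b y * (\<integral>\<^sup>+z. d z * (\<integral>\<^sup>+t. k (x, y, z, t) \<partial>lborel) \<partial>lborel) \<partial>lborel) \<partial>lborel)
    = (\<integral>\<^sup>+x. \<integral>\<^sup>+y. \<integral>\<^sup>+z. \<integral>\<^sup>+t. c * (a x * (b y * (d z * k (x, y, z, t)))) \<partial>lborel \<partial>lborel \<partial>lborel \<partial>lborel)"
proof -
  have "d z * (\<integral>\<^sup>+t. k (x, y, z, t) \<partial>lborel) = (\<integral>\<^sup>+t. d z * k (x, y, z, t) \<partial>lborel)" for x y z
    by (rule nn_integral_cmult[symmetric]) measurable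
  moreover have "b y * (\<integral>\<^sup>+z. \<integral>\<^sup>+t. d z * k (x, y, z, t) \<partial>lborel \<partial>lborel)
      = (\<integral>\<^sup>+z. \<integral>\<^sup>+t. b y * (d z * k (x, y, z, t)) \<partial>lborel \<partial>lborel)" for x y
    using nn_integral_lborel_cmult2[of "\<lambda>(z, t). d z * k (x, y, z, t)" "b y"] by simp
  moreover have "a x * (\<integral>\<^sup>+y. \<integral>\<^sup>+z. \<integral>\<^sup>+t. b y * (d z * k (x, y, z, t)) \<partial>lborel \<partial>lborel \<partial>lborel)
      = (\<integral>\<^sup>+y. \<integral>\<^sup>+z. \<integral>\<^sup>+t. a x * (b y * (d z * k (x, y, z, t))) \<partial>lborel \<partial>lborel \<partial>lborel)" for x
    using nn_integral_lborel_cmult3[of "\<lambda>(y, z, t). b y * (d z * k (x, y, z, t))" "a x"] by simp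
  moreover have "c * (\<integral>\<^sup>+x. \<integral>\<^sup>+y. \<integral>\<^sup>+z. \<integral>\<^sup>+t. a x * (b y * (d z * k (x, y, z, t))) \<partial>lborel \<partial>lborel \<partial>lborel \<partial>lborel)
      = (\<integral>\<^sup>+x. \<integral>\<^sup>+y. \<integral>\<^sup>+z. \<integral>\<^sup>+t. c * (a x * (b y * (d z * k (x, y, z, t)))) \<partial>lborel \<partial>lborel \<partial>lborel \<partial>lborel)"
    using nn_integral_lborel_cmult4[of "\<lambda>(x, y, z, t). a x * (b y * (d z * k (x, y, z, t)))" c] by simp
  ultimately show ?thesis by (simp only:)
qed

context levy_density
begin

lemma Mecke_density:
  assumes [measurable]: "G \<in> borel_measurable ((borel \<Otimes>\<^sub>M borel) \<Otimes>\<^sub>M pure_jump_space)"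
  shows "(\<integral>\<^sup>+w. (\<Sum>s\<in>jump_times w. G ((s, jump w s), w)) \<partial>poisson_law)
    = (\<integral>\<^sup>+w. \<integral>\<^sup>+t. indicator {0..1} t * (\<integral>\<^sup>+x. ennreal (n x) * G ((t, x), add_jump w (t, x)) \<partial>lborel) \<partial>lborel \<partial>poisson_law)"
proof -
  have "(\<integral>\<^sup>+w. (\<Sum>s\<in>jump_times w. G ((s, jump w s), w)) \<partial>poisson_law)
    = (\<integral>\<^sup>+w. ennreal l * (\<integral>\<^sup>+p. G (p, add_jump w p) \<partial>mark_law) \<partial>poisson_law)"
    by (subst Mecke[OF assms], rule nn_integral_cmult[symmetric]) measurable
  also have "\<dots> = (\<integral>\<^sup>+w. \<integral>\<^sup>+t. indicator {0..1} t * (\<integral>\<^sup>+x. ennreal (n x) * G ((t, x), add_jump w (t, x)) \<partial>lborel) \<partial>lborel \<partial>poisson_law)"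
    by (intro nn_integral_cong nn_integral_mark_law) measurable
  finally show ?thesis .
qed

lemma Mecke2_density:
  assumes [measurable]: "H \<in> borel_measurable ((borel \<Otimes>\<^sub>M borel) \<Otimes>\<^sub>M (borel \<Otimes>\<^sub>M borel) \<Otimes>\<^sub>M pure_jump_space)"
  shows "(\<integral>\<^sup>+w. (\<Sum>s\<in>jump_times w. \<Sum>t\<in>jump_times w - {s}. H ((s, jump w s), (t, jump w t), w)) \<partial>poisson_law)
    = (\<integral>\<^sup>+w. \<integral>\<^sup>+s1. indicator {0..1} s1 * (\<integral>\<^sup>+x1. ennreal (n x1) * (\<integral>\<^sup>+s2. indicator {0..1} s2 *
        (\<integral>\<^sup>+x2. ennreal (n x2) * H ((s1, x1), (s2, x2), add_jump (add_jump w (s1, x1)) (s2, x2)) \<partial>lborel) \<partial>lborel) \<partial>lborel) \<partial>lborel \<partial>poisson_law)"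
proof -
  let ?K = "\<lambda>w p. (\<integral>\<^sup>+s2. indicator {0..1} s2 * (\<integral>\<^sup>+x2. ennreal (n x2) * H (p, (s2, x2), add_jump (add_jump w p) (s2, x2)) \<partial>lborel) \<partial>lborel)"
  have "(\<integral>\<^sup>+w. (\<Sum>s\<in>jump_times w. \<Sum>t\<in>jump_times w - {s}. H ((s, jump w s), (t, jump w t), w)) \<partial>poisson_law)
    = (\<integral>\<^sup>+w. ennreal l * (ennreal l * (\<integral>\<^sup>+p. \<integral>\<^sup>+q. H (p, q, add_jump (add_jump w p) q) \<partial>mark_law \<partial>mark_law)) \<partial>poisson_law)"
    unfolding Mecke2[OF assms] by (subst nn_integral_cmult; (subst nn_integral_cmult)?) auto
  also have "\<dots> = (\<integral>\<^sup>+w. ennreal l * (\<integral>\<^sup>+p. ?K w p \<partial>mark_law) \<partial>poisson_law)"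
  proof (rule nn_integral_cong)
    fix w assume "w \<in> space poisson_law"
    then have [measurable]: "w \<in> space pure_jump_space" by simp
    have "ennreal l * (\<integral>\<^sup>+p. \<integral>\<^sup>+q. H (p, q, add_jump (add_jump w p) q) \<partial>mark_law \<partial>mark_law)
      = (\<integral>\<^sup>+p. ennreal l * (\<integral>\<^sup>+q. H (p, q, add_jump (add_jump w p) q) \<partial>mark_law) \<partial>mark_law)"
      by (rule nn_integral_cmult[symmetric]) measurable
    also have "\<dots> = (\<integral>\<^sup>+p. ?K w p \<partial>mark_law)"
    proof (rule nn_integral_cong)
      fix p :: "real \<times> real"
      have [measurable]: "p \<in> space (borel \<Otimes>\<^sub>M borel)" by (simp add: space_pair_measure)
      show "ennreal l * (\<integral>\<^sup>+q. H (p, q, add_jump (add_jump w p) q) \<partial>mark_law) = ?K w p"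
        by (rule nn_integral_mark_law) measurable
    qed
    finally show "ennreal l * (ennreal l * (\<integral>\<^sup>+p. \<integral>\<^sup>+q. H (p, q, add_jump (add_jump w p) q) \<partial>mark_law \<partial>mark_law))
      = ennreal l * (\<integral>\<^sup>+p. ?K w p \<partial>mark_law)" by simp
  qed
  also have "\<dots> = (\<integral>\<^sup>+w. \<integral>\<^sup>+s1. indicator {0..1} s1 * (\<integral>\<^sup>+x1. ennreal (n x1) * ?K w (s1, x1) \<partial>lborel) \<partial>lborel \<partial>poisson_law)"
  proof (rule nn_integral_cong)
    fix w assume "w \<in> space poisson_law"
    then have [measurable]: "w \<in> space pure_jump_space" by simp
    show "ennreal l * (\<integral>\<^sup>+p. ?K w p \<partial>mark_law) = (\<integral>\<^sup>+s1. indicator {0..1} s1 * (\<integral>\<^sup>+x1. ennreal (n x1) * ?K w (s1, x1) \<partial>lborel) \<partial>lborel)"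
      by (rule nn_integral_mark_law) measurable
  qed
  finally show ?thesis .
qed

section \<open>The periodic law and its exceptional paths\<close>

abbreviation OU_law :: "real \<Rightarrow> (real \<Rightarrow> real) measure" where
  "OU_law c \<equiv> distr poisson_law path_space (OU_map c)"

lemma measurable_OU_map_poisson: "OU_map c \<in> poisson_law \<rightarrow>\<^sub>M path_space"
  by (rule measurable_OU_map) (simp add: measurable_ident_sets)

lemma AE_OU_law: "AE Z in OU_law c. Z \<in> space (OU_paths c)"
proof -
  have "{Z \<in> space path_space. Z \<in> space (OU_paths c)} \<in> sets path_space"
    using space_OU_paths_sets[of c] by (simp add: space_OU_paths space_path_space)
  then show ?thesis
    by (subst AE_distr_iff[OF measurable_OU_map_poisson]) (auto simp: OU_map_OU_paths)
qed

text \<open>Functionals of the jumps come with measurability on \<open>OU_paths c\<close> only. That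
  event has full mass, so the formula for image measures survives; the second claim supplies the
  continuation by 0 to all of \<open>path_space\<close>.\<close>

lemma nn_integral_OU_law:
  assumes f: "f \<in> borel_measurable (OU_paths c)"
  shows "(\<integral>\<^sup>+Z. f Z \<partial>OU_law c) = (\<integral>\<^sup>+w. f (OU_map c w) \<partial>poisson_law)"
    and "(\<lambda>Z. f Z * indicator (space (OU_paths c)) Z) \<in> borel_measurable path_space"
proof -
  have S: "space (OU_paths c) = {Z. pure_jump (exp_weight c Z)} \<inter> space path_space"
    by (auto simp: space_OU_paths space_path_space)
  have R: "OU_paths c = restrict_space path_space (space (OU_paths c))"
    by (subst space_OU_paths) (rule OU_paths_def)
  show m: "(\<lambda>Z. f Z * indicator (space (OU_paths c)) Z) \<in> borel_measurable path_space"
    using f borel_measurable_restrict_space_iff_ennreal[of "space (OU_paths c)" path_space f] space_OU_paths_sets[of c]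
    unfolding R[symmetric] by (simp add: S Int_absorb2)
  have "(\<integral>\<^sup>+Z. f Z \<partial>OU_law c) = (\<integral>\<^sup>+Z. f Z * indicator (space (OU_paths c)) Z \<partial>OU_law c)"
  proof (rule nn_integral_cong_AE)
    show "AE Z in OU_law c. f Z = f Z * indicator (space (OU_paths c)) Z"
      using AE_OU_law by eventually_elim simp
  qed
  also have "\<dots> = (\<integral>\<^sup>+w. f (OU_map c w) * indicator (space (OU_paths c)) (OU_map c w) \<partial>poisson_law)"
    by (rule nn_integral_distr[OF measurable_OU_map_poisson]) (simp add: m)
  also have "\<dots> = (\<integral>\<^sup>+w. f (OU_map c w) \<partial>poisson_law)"
    by (rule nn_integral_cong) (simp add: OU_map_OU_paths)
  finally show "(\<integral>\<^sup>+Z. f Z \<partial>OU_law c) = (\<integral>\<^sup>+w. f (OU_map c w) \<partial>poisson_law)" .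
qed

text \<open>Given one jump size \<open>x1\<close>, the other size has a density and avoids
  \<open>- x1\<close>. Without cancellation \<open>(t, x1 + x2)\<close> is a mark, so that
  \<open>F\<close> and its continuation by 0 agree on the pair side.\<close>

lemma AE_OU_law_no_cancel:
  "AE Z in OU_law c. \<forall>s\<in>jump_times Z. \<forall>t\<in>jump_times Z - {s}. jump Z s + jump Z t \<noteq> 0"
proof -
  let ?h = "\<lambda>(Z :: real \<Rightarrow> real, p :: real \<times> real, q :: real \<times> real). if snd p + snd q = 0 then 1 else 0 :: ennreal"
  \<comment> \<open>The number of ordered pairs of cancelling jumps; its expectation turns out to be
    0.\<close>
  let ?D = "\<lambda>Z. \<Sum>s\<in>jump_times Z. \<Sum>t\<in>jump_times Z - {s}. ?h (Z, (s, jump Z s), (t, jump Z t))"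
  have D: "?D \<in> borel_measurable (OU_paths c)"
    by (rule measurable_jump_sum2_OU) measurable
  have "(\<integral>\<^sup>+Z. ?D Z \<partial>OU_law c) = (\<integral>\<^sup>+w. (\<Sum>s\<in>jump_times w. \<Sum>t\<in>jump_times w - {s}.
      (\<lambda>(p, q, w). if snd p + snd q = 0 then 1 else 0) ((s, jump w s), (t, jump w t), w)) \<partial>poisson_law)"
    unfolding nn_integral_OU_law(1)[OF D]
    by (rule nn_integral_cong) (simp add: jump_OU_map space_pure_jump_space)
  also have "\<dots> = 0"
  proof -
    have zero: "(\<integral>\<^sup>+x2. ennreal (n x2) * (if x1 + x2 = 0 then 1 else 0) \<partial>lborel) = 0" for x1
    proof -
      have "AE x2 in lborel. ennreal (n x2) * (if x1 + x2 = 0 then 1 else 0) = 0"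
        using AE_lborel_singleton[of "- x1"] by eventually_elim auto
      then have "(\<integral>\<^sup>+x2. ennreal (n x2) * (if x1 + x2 = 0 then 1 else 0) \<partial>lborel) = (\<integral>\<^sup>+x2. 0 \<partial>(lborel :: real measure))"
        by (rule nn_integral_cong_AE)
      then show ?thesis by simp
    qed
    have m: "(\<lambda>(p :: real \<times> real, q :: real \<times> real, w). if snd p + snd q = 0 then 1 else 0 :: ennreal)
      \<in> borel_measurable ((borel \<Otimes>\<^sub>M borel) \<Otimes>\<^sub>M (borel \<Otimes>\<^sub>M borel) \<Otimes>\<^sub>M pure_jump_space)"
      by measurable
    show ?thesis
      by (rule trans[OF Mecke2_density[OF m]]) (simp only: prod.case snd_conv zero, simp)
  qed
  finally have 0: "(\<integral>\<^sup>+Z. ?D Z \<partial>OU_law c) = 0" .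
  have "AE Z in OU_law c. ?D Z * indicator (space (OU_paths c)) Z = ?D Z"
    using AE_OU_law by eventually_elim simp
  from trans[OF nn_integral_cong_AE[OF this] 0]
  have "AE Z in OU_law c. ?D Z * indicator (space (OU_paths c)) Z = 0"
    using nn_integral_OU_law(2)[OF D] by (subst (asm) nn_integral_0_iff_AE) auto
  with AE_OU_law show ?thesis
  proof eventually_elim
    case (elim Z)
    have "finite (jump_times Z)" using elim(1) by (rule finite_jump_times_OU_paths)
    with elim show ?case by (auto split: if_splits)
  qed
qed

context
  fixes c :: real and F F' :: "(real \<times> real) \<times> (real \<times> real) \<times> (real \<times> real) \<times> (real \<Rightarrow> real) \<Rightarrow> ennreal"
  assumes F'[measurable]: "F' \<in> borel_measurable ((borel \<Otimes>\<^sub>M borel) \<Otimes>\<^sub>M (borel \<Otimes>\<^sub>M borel) \<Otimes>\<^sub>M (borel \<Otimes>\<^sub>M borel) \<Otimes>\<^sub>M path_space)"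
    and F'_eq: "\<And>g g1 g2 Z. F' (g, g1, g2, Z) = (if is_mark g \<and> is_mark g1 \<and> is_mark g2 then F (g, g1, g2, Z) else 0)"
begin

text \<open>The contribution of one atom \<gamma> to the operator: the Dirac mass puts
  \<open>x2 = snd \<gamma> - x1\<close>, and all domain restrictions are absorbed into
  \<open>F'\<close>.\<close>

private definition perturb :: "(real \<times> real) \<times> (real \<Rightarrow> real) \<Rightarrow> ennreal" where
  "perturb = (\<lambda>(\<gamma>, Z). \<integral>\<^sup>+s2. \<integral>\<^sup>+s1. \<integral>\<^sup>+x1. F' (\<gamma>, (s1, x1), (s2, snd \<gamma> - x1),
      OU_shift c \<gamma> (s1, x1) (s2, snd \<gamma> - x1) Z) \<partial>lborel \<partial>lborel \<partial>lborel)"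

private lemma measurable_perturb[measurable]: "perturb \<in> borel_measurable ((borel \<Otimes>\<^sub>M borel) \<Otimes>\<^sub>M path_space)"
proof -
  have [measurable]: "(\<lambda>x. OU_shift c (fst (fst (fst (fst x)))) (snd (fst x), snd x) (snd (fst (fst x)), snd (fst (fst (fst (fst x)))) - snd x)
     (snd (fst (fst (fst x)))))
     \<in> (((((borel \<Otimes>\<^sub>M borel) \<Otimes>\<^sub>M path_space) \<Otimes>\<^sub>M borel) \<Otimes>\<^sub>M borel) \<Otimes>\<^sub>M borel) \<rightarrow>\<^sub>M path_space"
    by (rule measurable_OU_shift) measurable
  show ?thesis unfolding perturb_def split_beta' by measurable
qed

private lemma OU_operator_eq:
  assumes Z: "Z \<in> space (OU_paths c)"
  shows "OU_operator c F Z = (\<Sum>s\<in>jump_times Z. perturb ((s, jump Z s), Z))"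
proof -
  have [measurable]: "Z \<in> space path_space" using Z by (simp add: space_OU_paths space_path_space)
  let ?I = "\<lambda>\<gamma>. \<integral>\<^sup>+s2\<in>{0..1}. (\<integral>\<^sup>+s1\<in>{0..1}. (\<integral>\<^sup>+x1\<in>- {0}. (\<integral>\<^sup>+x2\<in>- {0}.
        F (\<gamma>, (s1, x1), (s2, x2), OU_shift c \<gamma> (s1, x1) (s2, x2) Z)
      \<partial>return borel (snd \<gamma> - x1)) \<partial>lborel) \<partial>lborel) \<partial>lborel"
  have I: "?I \<gamma> = perturb (\<gamma>, Z)" if \<gamma>: "is_mark \<gamma>" for \<gamma>
  proof -
    have [measurable]: "\<gamma> \<in> space (borel \<Otimes>\<^sub>M borel)" by (simp add: space_pair_measure)
    have inner: "(\<integral>\<^sup>+x2\<in>- {0}. F (\<gamma>, (s1, x1), (s2, x2), OU_shift c \<gamma> (s1, x1) (s2, x2) Z) \<partial>return borel (snd \<gamma> - x1)) * indicator (- {0}) x1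
        = F' (\<gamma>, (s1, x1), (s2, snd \<gamma> - x1), OU_shift c \<gamma> (s1, x1) (s2, snd \<gamma> - x1) Z)"
      if s: "s1 \<in> {0..1}" "s2 \<in> {0..1}" for s1 s2 x1
    proof (cases "x1 = 0")
      case True
      then show ?thesis by (simp add: F'_eq is_mark_def)
    next
      case False
      have [measurable]: "(\<lambda>x2. OU_shift c \<gamma> (s1, x1) (s2, x2) Z) \<in> borel \<rightarrow>\<^sub>M path_space"
        by (rule measurable_OU_shift) measurable
      have "(\<integral>\<^sup>+x2\<in>- {0}. F (\<gamma>, (s1, x1), (s2, x2), OU_shift c \<gamma> (s1, x1) (s2, x2) Z) \<partial>return borel (snd \<gamma> - x1))
        = (\<integral>\<^sup>+x2. F' (\<gamma>, (s1, x1), (s2, x2), OU_shift c \<gamma> (s1, x1) (s2, x2) Z) \<partial>return borel (snd \<gamma> - x1))"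
        by (rule nn_integral_cong) (use False s \<gamma> in \<open>auto simp: F'_eq is_mark_def indicator_def\<close>)
      also have "\<dots> = F' (\<gamma>, (s1, x1), (s2, snd \<gamma> - x1), OU_shift c \<gamma> (s1, x1) (s2, snd \<gamma> - x1) Z)"
        by (rule nn_integral_return) auto
      finally show ?thesis using False by simp
    qed
    show ?thesis unfolding perturb_def prod.case
    proof (rule nn_integral_cong)
      fix s2 :: real
      let ?f = "\<lambda>s1 x1. F' (\<gamma>, (s1, x1), (s2, snd \<gamma> - x1), OU_shift c \<gamma> (s1, x1) (s2, snd \<gamma> - x1) Z)"
      let ?g = "\<lambda>s1 x1. (\<integral>\<^sup>+x2\<in>- {0}. F (\<gamma>, (s1, x1), (s2, x2), OU_shift c \<gamma> (s1, x1) (s2, x2) Z) \<partial>return borel (snd \<gamma> - x1))"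
      show "(\<integral>\<^sup>+s1\<in>{0..1}. (\<integral>\<^sup>+x1\<in>- {0}. ?g s1 x1 \<partial>lborel) \<partial>lborel) * indicator {0..1} s2 = (\<integral>\<^sup>+s1. \<integral>\<^sup>+x1. ?f s1 x1 \<partial>lborel \<partial>lborel)"
      proof (cases "s2 \<in> {0..1}")
        case True
        have "(\<integral>\<^sup>+x1\<in>- {0}. ?g s1 x1 \<partial>lborel) * indicator {0..1} s1 = (\<integral>\<^sup>+x1. ?f s1 x1 \<partial>lborel)" for s1
        proof (cases "s1 \<in> {0..1}")
          case s1: True
          have "(\<integral>\<^sup>+x1\<in>- {0}. ?g s1 x1 \<partial>lborel) = (\<integral>\<^sup>+x1. ?f s1 x1 \<partial>lborel)"
            by (rule nn_integral_cong) (rule inner[OF s1 True])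
          with s1 show ?thesis by simp
        next
          case s1: False
          then have "\<not> is_mark (s1, x1)" for x1 unfolding is_mark_def fst_conv by blast
          with s1 show ?thesis by (simp add: F'_eq)
        qed
        with True show ?thesis by simp
      next
        case False
        then have "\<not> is_mark (s2, x)" for x unfolding is_mark_def fst_conv by blast
        with False show ?thesis by (simp add: F'_eq)
      qed
    qed
  qed
  \<comment> \<open>On \<open>marks\<close> the integrand coincides with \<open>perturb\<close>,
    whose measurability it inherits.\<close>
  have "?I \<in> borel_measurable marks"
  proof -
    have "(\<lambda>p. p) \<in> borel \<rightarrow>\<^sub>M (borel \<Otimes>\<^sub>M borel :: (real \<times> real) measure)"
      by (simp add: borel_prod)
    then have "(\<lambda>p. p) \<in> marks \<rightarrow>\<^sub>M borel \<Otimes>\<^sub>M borel"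
      unfolding marks_def by (rule measurable_restrict_space1)
    then have "(\<lambda>\<gamma>. perturb (\<gamma>, Z)) \<in> borel_measurable marks" by measurable
    also have "?this \<longleftrightarrow> ?thesis"
    proof (rule measurable_cong)
      fix p assume "p \<in> space marks"
      then have "is_mark p" by (auto simp: marks_def space_restrict_space is_mark_def)
      then show "perturb (p, Z) = ?I p" by (rule I[symmetric])
    qed
    finally show ?thesis .
  qed
  from nn_integral_jump_measure[OF this, of Z]
  have "OU_operator c F Z = (\<integral>\<^sup>+t. ?I (t, jump Z t) \<partial>count_space (jump_times Z))"
    unfolding OU_operator_def .
  also have "\<dots> = (\<integral>\<^sup>+t. perturb ((t, jump Z t), Z) \<partial>count_space (jump_times Z))"
    by (intro nn_integral_cong I) (auto simp: is_mark_def jump_times_def)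
  finally show ?thesis
    by (simp add: nn_integral_count_space_finite finite_jump_times_OU_paths[OF Z])
qed

private abbreviation (input) integrand where
  "integrand w t x s1 x1 s2 x2 \<equiv>
    F' ((t, x), (s1, x1), (s2, x2), OU_map c (add_jump (add_jump w (s1, x1)) (s2, x2)))"

text \<open>Mecke's formula adds \<open>(t, x)\<close> as a jump and the shift exchanges it for two
  others, so the path in the integrand no longer contains it. It survives in the first argument of
  \<open>F'\<close>, in the weight \<open>n x\<close> and in the constraint
  \<open>x2 = x - x1\<close>.\<close>

private lemma operator_side:
  "(\<integral>\<^sup>+Z. OU_operator c F Z \<partial>OU_law c) = (\<integral>\<^sup>+w. \<integral>\<^sup>+t. \<integral>\<^sup>+x. \<integral>\<^sup>+s2. \<integral>\<^sup>+s1. \<integral>\<^sup>+x1.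
      ennreal (n x) * integrand w t x s1 x1 s2 (x - x1) \<partial>lborel \<partial>lborel \<partial>lborel \<partial>lborel \<partial>lborel \<partial>poisson_law)"
proof -
  have inc: "(\<lambda>x. x) \<in> OU_paths c \<rightarrow>\<^sub>M path_space"
    unfolding OU_paths_def by (rule measurable_restrict_space1) simp
  have m: "(\<lambda>Z. \<Sum>s\<in>jump_times Z. perturb ((s, jump Z s), Z)) \<in> borel_measurable (OU_paths c)"
  proof -
    have "(\<lambda>(Z, p). perturb (p, Z)) \<in> borel_measurable (OU_paths c \<Otimes>\<^sub>M borel \<Otimes>\<^sub>M borel)"
      using inc by measurable
    from measurable_jump_sum_OU[OF measurable_ident_sets[OF refl] this] show ?thesis by simp
  qed
  have "(\<integral>\<^sup>+Z. OU_operator c F Z \<partial>OU_law c) = (\<integral>\<^sup>+Z. (\<Sum>s\<in>jump_times Z. perturb ((s, jump Z s), Z)) \<partial>OU_law c)"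
  proof (rule nn_integral_cong_AE)
    show "AE Z in OU_law c. OU_operator c F Z = (\<Sum>s\<in>jump_times Z. perturb ((s, jump Z s), Z))"
      using AE_OU_law by eventually_elim (rule OU_operator_eq)
  qed
  also have "\<dots> = (\<integral>\<^sup>+w. (\<Sum>s\<in>jump_times w. (\<lambda>x. perturb (fst x, OU_map c (snd x))) ((s, jump w s), w)) \<partial>poisson_law)"
    unfolding nn_integral_OU_law(1)[OF m]
    by (rule nn_integral_cong) (simp add: jump_OU_map space_pure_jump_space)
  also have "\<dots> = (\<integral>\<^sup>+w. \<integral>\<^sup>+t. indicator {0..1} t * (\<integral>\<^sup>+x. ennreal (n x) * perturb ((t, x), OU_map c (add_jump w (t, x))) \<partial>lborel) \<partial>lborel \<partial>poisson_law)"
  proof -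
    have m: "(\<lambda>x. perturb (fst x, OU_map c (snd x))) \<in> borel_measurable ((borel \<Otimes>\<^sub>M borel) \<Otimes>\<^sub>M pure_jump_space)"
      by measurable
    show ?thesis by (rule trans[OF Mecke_density[OF m]]) (simp only: fst_conv snd_conv)
  qed
  also have "\<dots> = (\<integral>\<^sup>+w. \<integral>\<^sup>+t. \<integral>\<^sup>+x. \<integral>\<^sup>+s2. \<integral>\<^sup>+s1. \<integral>\<^sup>+x1.
      ennreal (n x) * integrand w t x s1 x1 s2 (x - x1) \<partial>lborel \<partial>lborel \<partial>lborel \<partial>lborel \<partial>lborel \<partial>poisson_law)"
  proof (rule nn_integral_cong, rule nn_integral_cong)
    fix w t assume "w \<in> space poisson_law"
    then have w[measurable]: "w \<in> space pure_jump_space" by simp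
    have p: "perturb ((t, x), OU_map c (add_jump w (t, x))) = (\<integral>\<^sup>+s2. \<integral>\<^sup>+s1. \<integral>\<^sup>+x1. integrand w t x s1 x1 s2 (x - x1) \<partial>lborel \<partial>lborel \<partial>lborel)" for x
      unfolding perturb_def by (simp add: OU_shift_OU_map[OF w])
    have "(\<integral>\<^sup>+x. ennreal (n x) * perturb ((t, x), OU_map c (add_jump w (t, x))) \<partial>lborel)
      = (\<integral>\<^sup>+x. \<integral>\<^sup>+s2. \<integral>\<^sup>+s1. \<integral>\<^sup>+x1. ennreal (n x) * integrand w t x s1 x1 s2 (x - x1) \<partial>lborel \<partial>lborel \<partial>lborel \<partial>lborel)"
      unfolding p by (simp add: nn_integral_cmult)
    moreover have "(\<integral>\<^sup>+x. \<integral>\<^sup>+s2. \<integral>\<^sup>+s1. \<integral>\<^sup>+x1. ennreal (n x) * integrand w t x s1 x1 s2 (x - x1) \<partial>lborel \<partial>lborel \<partial>lborel \<partial>lborel) = 0"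
      if "t \<notin> {0..1}"
    proof -
      have "\<not> is_mark (t, x)" for x using that unfolding is_mark_def fst_conv by blast
      then show ?thesis by (simp add: F'_eq)
    qed
    ultimately show "indicator {0..1} t * (\<integral>\<^sup>+x. ennreal (n x) * perturb ((t, x), OU_map c (add_jump w (t, x))) \<partial>lborel)
       = (\<integral>\<^sup>+x. \<integral>\<^sup>+s2. \<integral>\<^sup>+s1. \<integral>\<^sup>+x1. ennreal (n x) * integrand w t x s1 x1 s2 (x - x1) \<partial>lborel \<partial>lborel \<partial>lborel \<partial>lborel)"
      by (cases "t \<in> {0..1}") auto
  qed
  finally show ?thesis .
qed

private definition pair_weight where
  "pair_weight = (\<lambda>(Z, p, q). ennreal (chi n (snd p) (snd q)) * (\<integral>\<^sup>+t. F' ((t, snd p + snd q), p, q, Z) \<partial>lborel))"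

private lemma measurable_pair_weight[measurable]:
  "pair_weight \<in> borel_measurable (path_space \<Otimes>\<^sub>M (borel \<Otimes>\<^sub>M borel) \<Otimes>\<^sub>M (borel \<Otimes>\<^sub>M borel))"
  unfolding pair_weight_def chi_def split_beta' by measurable

private abbreviation (input) pair_integral where
  "pair_integral n0 Z \<equiv> (\<integral>\<^sup>+(s1, s2). ennreal (chi n0 (jump Z s1) (jump Z s2)) *
        (\<integral>\<^sup>+t\<in>{0..1}. F ((t, jump Z s1 + jump Z s2), (s1, jump Z s1), (s2, jump Z s2), Z) \<partial>lborel)
      \<partial>count_space {(s1, s2). s1 \<in> jump_times Z \<and> s2 \<in> jump_times Z \<and> s1 \<noteq> s2})"

text \<open>\<open>n0\<close> is the density given off the origin and \<open>n\<close> its version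
  on the whole line. As jumps are nonzero and do not cancel, \<open>chi\<close> only sees arguments
  where the two agree; for the same reason \<open>F\<close> and \<open>F'\<close> agree for every
  \<open>t\<close> in \<open>{0..1}\<close>.\<close>

private lemma pair_sum_eq:
  assumes Z: "Z \<in> space (OU_paths c)" and n0: "\<And>x. x \<noteq> 0 \<Longrightarrow> n0 x = n x"
    and nc: "\<forall>s\<in>jump_times Z. \<forall>t\<in>jump_times Z - {s}. jump Z s + jump Z t \<noteq> 0"
  shows "pair_integral n0 Z
    = (\<Sum>s\<in>jump_times Z. \<Sum>t\<in>jump_times Z - {s}. pair_weight (Z, (s, jump Z s), (t, jump Z t)))"
proof -
  have fin: "finite (jump_times Z)" by (rule finite_jump_times_OU_paths[OF Z])
  have set: "{(s1, s2). s1 \<in> jump_times Z \<and> s2 \<in> jump_times Z \<and> s1 \<noteq> s2} = (SIGMA s:jump_times Z. jump_times Z - {s})"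
    by auto
  have "pair_integral n0 Z
    = (\<Sum>(s1, s2)\<in>(SIGMA s:jump_times Z. jump_times Z - {s}). ennreal (chi n0 (jump Z s1) (jump Z s2)) *
        (\<integral>\<^sup>+t\<in>{0..1}. F ((t, jump Z s1 + jump Z s2), (s1, jump Z s1), (s2, jump Z s2), Z) \<partial>lborel))"
    unfolding set by (rule nn_integral_count_space_finite) (use fin in auto)
  also have "\<dots> = (\<Sum>(s1, s2)\<in>(SIGMA s:jump_times Z. jump_times Z - {s}). pair_weight (Z, (s1, jump Z s1), (s2, jump Z s2)))"
  proof (rule sum.cong[OF refl])
    fix p assume "p \<in> (SIGMA s:jump_times Z. jump_times Z - {s})"
    then obtain s1 s2 where p: "p = (s1, s2)" and s: "s1 \<in> jump_times Z" "s2 \<in> jump_times Z" "s2 \<noteq> s1" by auto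
    then have ne: "jump Z s1 \<noteq> 0" "jump Z s2 \<noteq> 0" "s1 \<in> {0..1}" "s2 \<in> {0..1}" "jump Z s1 + jump Z s2 \<noteq> 0"
      using nc by (auto simp: jump_times_def)
    have "chi n0 (jump Z s1) (jump Z s2) = chi n (jump Z s1) (jump Z s2)"
      using ne by (simp add: chi_def n0)
    moreover have "(\<integral>\<^sup>+t\<in>{0..1}. F ((t, jump Z s1 + jump Z s2), (s1, jump Z s1), (s2, jump Z s2), Z) \<partial>lborel)
       = (\<integral>\<^sup>+t. F' ((t, jump Z s1 + jump Z s2), (s1, jump Z s1), (s2, jump Z s2), Z) \<partial>lborel)"
      by (rule nn_integral_cong) (use ne in \<open>auto simp: F'_eq is_mark_def indicator_def\<close>)
    ultimately show "(case p of (s1, s2) \<Rightarrow> ennreal (chi n0 (jump Z s1) (jump Z s2)) *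
        (\<integral>\<^sup>+t\<in>{0..1}. F ((t, jump Z s1 + jump Z s2), (s1, jump Z s1), (s2, jump Z s2), Z) \<partial>lborel))
      = (case p of (s1, s2) \<Rightarrow> pair_weight (Z, (s1, jump Z s1), (s2, jump Z s2)))"
      by (simp add: pair_weight_def p)
  qed
  also have "\<dots> = (\<Sum>s\<in>jump_times Z. \<Sum>t\<in>jump_times Z - {s}. pair_weight (Z, (s, jump Z s), (t, jump Z t)))"
    by (rule sum.Sigma[symmetric]) (use fin in auto)
  finally show ?thesis .
qed

private lemma pair_side:
  assumes n0: "\<And>x. x \<noteq> 0 \<Longrightarrow> n0 x = n x" and n_pos: "\<And>x. x \<noteq> 0 \<Longrightarrow> 0 < n x"
  shows "(\<integral>\<^sup>+Z. pair_integral n0 Z \<partial>OU_law c)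
    = (\<integral>\<^sup>+w. \<integral>\<^sup>+s1. \<integral>\<^sup>+x1. \<integral>\<^sup>+s2. \<integral>\<^sup>+x. \<integral>\<^sup>+t.
      ennreal (n x) * integrand w t x s1 x1 s2 (x - x1) \<partial>lborel \<partial>lborel \<partial>lborel \<partial>lborel \<partial>lborel \<partial>poisson_law)"
    (is "?L = _")
proof -
  have inc: "(\<lambda>x. x) \<in> OU_paths c \<rightarrow>\<^sub>M path_space"
    unfolding OU_paths_def by (rule measurable_restrict_space1) simp
  have m: "(\<lambda>Z. \<Sum>s\<in>jump_times Z. \<Sum>t\<in>jump_times Z - {s}. pair_weight (Z, (s, jump Z s), (t, jump Z t)))
     \<in> borel_measurable (OU_paths c)"
  proof (rule measurable_jump_sum2_OU)
    have "(\<lambda>x. (fst x, snd x)) \<in> OU_paths c \<Otimes>\<^sub>M (borel \<Otimes>\<^sub>M borel) \<Otimes>\<^sub>M (borel \<Otimes>\<^sub>M borel) \<rightarrow>\<^sub>M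
       path_space \<Otimes>\<^sub>M (borel \<Otimes>\<^sub>M borel) \<Otimes>\<^sub>M (borel \<Otimes>\<^sub>M borel)"
      by (intro measurable_Pair measurable_compose[OF measurable_fst inc] measurable_snd)
    from measurable_compose[OF this measurable_pair_weight]
    show "pair_weight \<in> borel_measurable (OU_paths c \<Otimes>\<^sub>M (borel \<Otimes>\<^sub>M borel) \<Otimes>\<^sub>M (borel \<Otimes>\<^sub>M borel))"
      by simp
  qed
  have "?L = (\<integral>\<^sup>+Z. (\<Sum>s\<in>jump_times Z. \<Sum>t\<in>jump_times Z - {s}. pair_weight (Z, (s, jump Z s), (t, jump Z t))) \<partial>OU_law c)"
  proof (rule nn_integral_cong_AE)
    show "AE Z in OU_law c. pair_integral n0 Z
      = (\<Sum>s\<in>jump_times Z. \<Sum>t\<in>jump_times Z - {s}. pair_weight (Z, (s, jump Z s), (t, jump Z t)))"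
      using AE_OU_law AE_OU_law_no_cancel by eventually_elim (rule pair_sum_eq[OF _ n0])
  qed
  also have "\<dots> = (\<integral>\<^sup>+w. (\<Sum>s\<in>jump_times w. \<Sum>t\<in>jump_times w - {s}.
      (\<lambda>x. pair_weight (OU_map c (snd (snd x)), fst x, fst (snd x))) ((s, jump w s), (t, jump w t), w)) \<partial>poisson_law)"
    unfolding nn_integral_OU_law(1)[OF m]
    by (rule nn_integral_cong) (simp add: jump_OU_map space_pure_jump_space)
  also have "\<dots> = (\<integral>\<^sup>+w. \<integral>\<^sup>+s1. indicator {0..1} s1 * (\<integral>\<^sup>+x1. ennreal (n x1) * (\<integral>\<^sup>+s2. indicator {0..1} s2 *
        (\<integral>\<^sup>+x2. ennreal (n x2) * pair_weight (OU_map c (add_jump (add_jump w (s1, x1)) (s2, x2)), (s1, x1), (s2, x2)) \<partial>lborel) \<partial>lborel) \<partial>lborel) \<partial>lborel \<partial>poisson_law)"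
  proof -
    have m: "(\<lambda>x. pair_weight (OU_map c (snd (snd x)), fst x, fst (snd x)))
      \<in> borel_measurable ((borel \<Otimes>\<^sub>M borel) \<Otimes>\<^sub>M (borel \<Otimes>\<^sub>M borel) \<Otimes>\<^sub>M pure_jump_space)"
      by measurable
    show ?thesis by (rule trans[OF Mecke2_density[OF m]]) (simp only: fst_conv snd_conv)
  qed
  also have "\<dots> = (\<integral>\<^sup>+w. \<integral>\<^sup>+s1. \<integral>\<^sup>+x1. \<integral>\<^sup>+s2. \<integral>\<^sup>+x. \<integral>\<^sup>+t.
      ennreal (n x) * integrand w t x s1 x1 s2 (x - x1) \<partial>lborel \<partial>lborel \<partial>lborel \<partial>lborel \<partial>lborel \<partial>poisson_law)"
  proof (rule nn_integral_cong, rule nn_integral_cong)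
    fix w and s1 :: real assume "w \<in> space poisson_law"
    then have w[measurable]: "w \<in> space pure_jump_space" by simp
    let ?pw = "\<lambda>x1 s2 x2. pair_weight (OU_map c (add_jump (add_jump w (s1, x1)) (s2, x2)), (s1, x1), (s2, x2))"
    \<comment> \<open>If all three pairs are marks, the densities at \<open>x1\<close> and
      \<open>x2\<close> cancel against the denominator of \<open>chi\<close>, by positivity.
      Otherwise \<open>F'\<close> makes both sides 0.\<close>
    have pt: "indicator {0..1} s1 * (ennreal (n x1) * (indicator {0..1} s2 * (ennreal (n x2) * (ennreal (chi n x1 x2) * integrand w t (x1 + x2) s1 x1 s2 x2))))
       = ennreal (n (x1 + x2)) * integrand w t (x1 + x2) s1 x1 s2 x2" for x1 s2 x2 t
    proof (cases "is_mark (t, x1 + x2) \<and> is_mark (s1, x1) \<and> is_mark (s2, x2)")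
      case True
      then have ne: "x1 \<noteq> 0" "x2 \<noteq> 0" "s1 \<in> {0..1}" "s2 \<in> {0..1}" by (auto simp: is_mark_def)
      have "ennreal (n x1) * (ennreal (n x2) * ennreal (chi n x1 x2)) = ennreal (n (x1 + x2))"
        using n_pos[OF ne(1)] n_pos[OF ne(2)] n_nonneg[of "x1 + x2"]
        by (simp add: ennreal_mult[symmetric] chi_def)
      with ne show ?thesis by (simp add: mult.assoc[symmetric])
    qed (auto simp: F'_eq)
    have "indicator {0..1} s1 * (\<integral>\<^sup>+x1. ennreal (n x1) * (\<integral>\<^sup>+s2. indicator {0..1} s2 * (\<integral>\<^sup>+x2. ennreal (n x2) * ?pw x1 s2 x2 \<partial>lborel) \<partial>lborel) \<partial>lborel)
      = (\<integral>\<^sup>+x1. \<integral>\<^sup>+s2. \<integral>\<^sup>+x2. \<integral>\<^sup>+t. indicator {0..1} s1 * (ennreal (n x1) * (indicator {0..1} s2 * (ennreal (n x2) * (ennreal (chi n x1 x2) * integrand w t (x1 + x2) s1 x1 s2 x2))))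
         \<partial>lborel \<partial>lborel \<partial>lborel \<partial>lborel)"
    proof -
      have k: "(\<lambda>(x1, s2, x2, t). ennreal (chi n x1 x2) * integrand w t (x1 + x2) s1 x1 s2 x2)
        \<in> borel_measurable (borel \<Otimes>\<^sub>M borel \<Otimes>\<^sub>M borel \<Otimes>\<^sub>M borel)"
        unfolding chi_def by measurable
      have pw: "?pw x1 s2 x2 = (\<integral>\<^sup>+t. ennreal (chi n x1 x2) * integrand w t (x1 + x2) s1 x1 s2 x2 \<partial>lborel)" for x1 s2 x2
        unfolding pair_weight_def prod.case snd_conv by (rule nn_integral_cmult[symmetric]) measurable
      note W = nn_integral_lborel_weights[OF k, of "\<lambda>x. ennreal (n x)" "indicator {0..1}" "\<lambda>x. ennreal (n x)" "indicator {0..1} s1"]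
      show ?thesis unfolding pw by (rule W[unfolded prod.case]) measurable
    qed
    also have "\<dots> = (\<integral>\<^sup>+x1. \<integral>\<^sup>+s2. \<integral>\<^sup>+x2. \<integral>\<^sup>+t. ennreal (n (x1 + x2)) * integrand w t (x1 + x2) s1 x1 s2 x2 \<partial>lborel \<partial>lborel \<partial>lborel \<partial>lborel)"
      unfolding pt ..
    also have "\<dots> = (\<integral>\<^sup>+x1. \<integral>\<^sup>+s2. \<integral>\<^sup>+x. \<integral>\<^sup>+t. ennreal (n x) * integrand w t x s1 x1 s2 (x - x1) \<partial>lborel \<partial>lborel \<partial>lborel \<partial>lborel)"
    proof (rule nn_integral_cong, rule nn_integral_cong)
      fix x1 s2 :: real
      have [measurable]: "(s1, x1) \<in> space (borel \<Otimes>\<^sub>M borel)" "add_jump w (s1, x1) \<in> space pure_jump_space"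
        using add_jump_space[OF w] by (simp_all add: space_pair_measure)
      show "(\<integral>\<^sup>+x2. \<integral>\<^sup>+t. ennreal (n (x1 + x2)) * integrand w t (x1 + x2) s1 x1 s2 x2 \<partial>lborel \<partial>lborel)
        = (\<integral>\<^sup>+x. \<integral>\<^sup>+t. ennreal (n x) * integrand w t x s1 x1 s2 (x - x1) \<partial>lborel \<partial>lborel)"
      proof -
        have m: "(\<lambda>x2. \<integral>\<^sup>+t. ennreal (n (x1 + x2)) * integrand w t (x1 + x2) s1 x1 s2 x2 \<partial>lborel) \<in> borel_measurable borel"
          by measurable
        \<comment> \<open>Translation invariance of Lebesgue measure, with
          \<open>x2 = x - x1\<close>.\<close>
        have "x1 + (- x1 + 1 * x) = x" "- x1 + 1 * x = x - x1" for x by simp_all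
        with nn_integral_real_affine[OF m, of 1 "- x1"] show ?thesis by (simp only:) simp
      qed
    qed
    finally show "indicator {0..1} s1 * (\<integral>\<^sup>+x1. ennreal (n x1) * (\<integral>\<^sup>+s2. indicator {0..1} s2 * (\<integral>\<^sup>+x2. ennreal (n x2) * ?pw x1 s2 x2 \<partial>lborel) \<partial>lborel) \<partial>lborel)
      = (\<integral>\<^sup>+x1. \<integral>\<^sup>+s2. \<integral>\<^sup>+x. \<integral>\<^sup>+t. ennreal (n x) * integrand w t x s1 x1 s2 (x - x1) \<partial>lborel \<partial>lborel \<partial>lborel \<partial>lborel)" .
  qed
  finally show ?thesis .
qed

lemma OU_operator_integral:
  assumes n0: "\<And>x. x \<noteq> 0 \<Longrightarrow> n0 x = n x" and n_pos: "\<And>x. x \<noteq> 0 \<Longrightarrow> 0 < n x"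
  shows "(\<integral>\<^sup>+Z. OU_operator c F Z \<partial>OU_law c)
    = (\<integral>\<^sup>+Z. (\<integral>\<^sup>+(s1, s2). ennreal (chi n0 (jump Z s1) (jump Z s2)) *
        (\<integral>\<^sup>+t\<in>{0..1}. F ((t, jump Z s1 + jump Z s2), (s1, jump Z s1), (s2, jump Z s2), Z) \<partial>lborel)
      \<partial>count_space {(s1, s2). s1 \<in> jump_times Z \<and> s2 \<in> jump_times Z \<and> s1 \<noteq> s2}) \<partial>OU_law c)"
proof (rule trans[OF operator_side trans[OF nn_integral_cong pair_side[OF assms, symmetric]]])
  fix w assume "w \<in> space poisson_law"
  then have [measurable]: "w \<in> space pure_jump_space" by simp
  have "(\<lambda>(t, x, s2, s1, x1). ennreal (n x) * integrand w t x s1 x1 s2 (x - x1))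
    \<in> borel_measurable (borel \<Otimes>\<^sub>M borel \<Otimes>\<^sub>M borel \<Otimes>\<^sub>M borel \<Otimes>\<^sub>M borel)"
    by measurable
  from nn_integral_lborel_rotate[OF this]
  show "(\<integral>\<^sup>+t. \<integral>\<^sup>+x. \<integral>\<^sup>+s2. \<integral>\<^sup>+s1. \<integral>\<^sup>+x1. ennreal (n x) * integrand w t x s1 x1 s2 (x - x1) \<partial>lborel \<partial>lborel \<partial>lborel \<partial>lborel \<partial>lborel)
    = (\<integral>\<^sup>+s1. \<integral>\<^sup>+x1. \<integral>\<^sup>+s2. \<integral>\<^sup>+x. \<integral>\<^sup>+t. ennreal (n x) * integrand w t x s1 x1 s2 (x - x1) \<partial>lborel \<partial>lborel \<partial>lborel \<partial>lborel \<partial>lborel)"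
    by simp
qed

end

end

section \<open>From a density off the origin to a density on the whole line\<close>

theorem proposition4p1:
  fixes c :: real and \<nu> :: "real measure" and n :: "real \<Rightarrow> real"
    and P :: "(real \<Rightarrow> real) measure"
    and F :: "(real \<times> real) \<times> (real \<times> real) \<times> (real \<times> real) \<times> (real \<Rightarrow> real) \<Rightarrow> ennreal"
  assumes "c \<noteq> 0"
    and "n \<in> borel_measurable (restrict_space borel (- {0}))"
    and "\<And>x. x \<noteq> 0 \<Longrightarrow> n x > 0"
    and "\<nu> = density (restrict_space lborel (- {0})) (\<lambda>x. ennreal (n x))"
    and "finite_measure \<nu>"
    and "compound_poisson_law \<nu> P"
    and "F \<in> borel_measurable (marks \<Otimes>\<^sub>M marks \<Otimes>\<^sub>M marks \<Otimes>\<^sub>M path_space)"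
  shows "(\<integral>\<^sup>+Z. OU_operator c F Z \<partial>periodic_OU_law c P) =
    (\<integral>\<^sup>+Z. (\<integral>\<^sup>+(s1, s2).
        ennreal (chi n (jump Z s1) (jump Z s2)) *
        (\<integral>\<^sup>+t\<in>{0..1}. F ((t, jump Z s1 + jump Z s2), (s1, jump Z s1), (s2, jump Z s2), Z) \<partial>lborel)
      \<partial>count_space {(s1, s2). s1 \<in> jump_times Z \<and> s2 \<in> jump_times Z \<and> s1 \<noteq> s2})
    \<partial>periodic_OU_law c P)"
proof -
  \<comment> \<open>The hypotheses leave \<open>n 0\<close> arbitrary; the value 0 gives a Borel
    density on the whole line.\<close>
  define m where "m x = (if x = 0 then 0 else n x)" for x
  have m_meas[measurable]: "m \<in> borel_measurable borel"
  proof -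
    have "(\<lambda>x. if x \<in> - {0} then n x else 0) \<in> borel_measurable borel"
      using assms(2) by (subst measurable_If_restrict_space_iff) (auto simp: Compl_eq)
    also have "(\<lambda>x. if x \<in> - {0} then n x else 0) = m" by (auto simp: m_def)
    finally show ?thesis .
  qed
  have m_pos: "x \<noteq> 0 \<Longrightarrow> 0 < m x" and m_eq: "x \<noteq> 0 \<Longrightarrow> n x = m x" for x
    using assms(3) by (auto simp: m_def)
  have m_nonneg: "0 \<le> m x" for x using assms(3)[of x] by (auto simp: m_def)
  have density_meas: "n \<in> borel_measurable (restrict_space lborel (- {0}))"
    using assms(2) measurable_cong_sets[OF sets_restrict_space_cong[OF sets_lborel] refl] by blast
  have total: "emeasure \<nu> (space \<nu>) = (\<integral>\<^sup>+x. ennreal (m x) \<partial>lborel)"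
  proof -
    let ?L = "restrict_space lborel (- {0}) :: real measure"
    have "emeasure \<nu> (space \<nu>) = (\<integral>\<^sup>+x. ennreal (n x) * indicator (space ?L) x \<partial>?L)"
      unfolding assms(4) space_density
      by (rule emeasure_density[OF measurable_compose[OF density_meas measurable_ennreal] sets.top])
    also have "\<dots> = (\<integral>\<^sup>+x. ennreal (n x) \<partial>?L)" by (rule nn_integral_cong) simp
    also have "\<dots> = (\<integral>\<^sup>+x. ennreal (n x) * indicator (- {0}) x \<partial>lborel)"
      by (rule nn_integral_restrict_space) simp
    also have "\<dots> = (\<integral>\<^sup>+x. ennreal (m x) \<partial>lborel)"
      by (rule nn_integral_cong) (simp add: m_def indicator_def)
    finally show ?thesis .
  qed
  interpret \<nu>: finite_measure \<nu> by fact
  define l where "l = measure \<nu> (space \<nu>)"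
  have int_m: "(\<integral>\<^sup>+x. ennreal (m x) \<partial>lborel) = ennreal l"
    unfolding total[symmetric] l_def by (rule \<nu>.emeasure_eq_measure)
  \<comment> \<open>A density that is positive off the origin cannot integrate to 0, a single point
    being a Lebesgue null set.\<close>
  have "l \<noteq> 0"
  proof
    assume "l = 0"
    then have "(\<integral>\<^sup>+x. ennreal (m x) \<partial>lborel) = 0" using int_m by simp
    then have "AE x in lborel. ennreal (m x) = 0"
      by (subst (asm) nn_integral_0_iff_AE) auto
    then have "AE x::real in lborel. False"
      using AE_lborel_singleton[of 0] by eventually_elim (use m_pos in \<open>force simp: ennreal_eq_0_iff not_less[symmetric]\<close>)
    then show False by (simp add: eventually_False ae_filter_eq_bot_iff)
  qed
  then have l: "l > 0" using measure_nonneg[of \<nu> "space \<nu>"] by (simp add: l_def less_le)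
  interpret levy_density m l
    by standard (use m_nonneg int_m l in \<open>auto simp: m_def\<close>)
  \<comment> \<open>The Levy exponent of \<nu>, rewritten with the probability density
    \<open>m / l\<close>; this is what identifies \<open>P\<close> with the mixture.\<close>
  have "(CLINT x|\<nu>. iexp (v * x) - 1) = l * (CLINT x|size_law. iexp (v * x) - 1)" for v
  proof -
    have iexp_meas: "(\<lambda>x. iexp (v * x) - 1) \<in> borel_measurable (restrict_space lborel (- {0}))"
      by (rule measurable_restrict_space1) measurable
    have "(CLINT x|\<nu>. iexp (v * x) - 1) = (CLINT x|restrict_space lborel (- {0}). n x *\<^sub>R (iexp (v * x) - 1))"
      unfolding assms(4)
      by (rule integral_density[OF iexp_meas density_meas])
         (rule AE_I2, rule less_imp_le, rule assms(3), simp)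
    also have "\<dots> = (CLINT x|lborel. indicator (- {0}) x *\<^sub>R (n x *\<^sub>R (iexp (v * x) - 1)))"
      by (rule integral_restrict_space) simp
    also have "\<dots> = (CLINT x|lborel. l * ((m x / l) *\<^sub>R (iexp (v * x) - 1)))"
      using l by (intro Bochner_Integration.integral_cong) (auto simp: m_def indicator_def scaleR_conv_of_real)
    also have "\<dots> = l * (CLINT x|lborel. (m x / l) *\<^sub>R (iexp (v * x) - 1))"
      by (rule integral_mult_right_zero)
    also have "(CLINT x|lborel. (m x / l) *\<^sub>R (iexp (v * x) - 1)) = (CLINT x|size_law. iexp (v * x) - 1)"
      unfolding size_law_def using l m_nonneg by (intro integral_density[symmetric]) auto
    finally show ?thesis .
  qed
  then have P: "P = distr poisson_law path_space (\<lambda>w. w)"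
    by (rule compound_poisson_law_unique[OF assms(6)])
  have law: "periodic_OU_law c P = OU_law c"
    unfolding periodic_OU_law_def P
    by (subst distr_distr[OF measurable_OU_map_path])
       (auto intro: measurable_pure_jump_path measurable_ident_sets simp: comp_def)
  show ?thesis unfolding law
    by (rule OU_operator_integral[OF measurable_extend_marks[OF assms(7)] _ m_eq m_pos]) auto
qed

end
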